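(* Let $\mathcal{S}$ be a Polish space, $p(x,dy)$ a transition probability kernel on $\mathcal{S}$, $g:\mathcal{S}\to\mathbb{R}^d$ a bounded Borel measurable function, $y_0\in\mathcal{S}$, and $A\subset\mathbb{R}^d$ a Borel set. Assume: (1) (uniform recurrence) there exist a probability measure $\nu_p$ on $\mathcal{S}$, an integer $m_0\in\mathbb{N}$ and real numbers $a,b>0$ such that $a\,\nu_p(B)\le p^{(m_0)}(x,B)\le b\,\nu_p(B)$ for all $x\in\mathcal{S}$ and all Borel sets $B\subset\mathcal{S}$, where $p^{(m_0)}$ is the $m_0$-step transition kernel; (2) $\inf_{\beta\in\bar A}L(\beta)=\inf_{\beta\in A^\circ}L(\beta)$, where $\bar A$ and $A^\circ$ are the closure and the interior of $A$ and $L$ is the rate function defined in the context. For each $n$, let $V^n=V^n(y_0)$ be the minimal second moment, over all adaptive controls $\alpha^n$, of the importance sampling estimator $\bar X_n$ defined in the context, and let $W^n=-\frac1n\log V^n$. Then $$\lim_{n\to\infty}W^n=2\inf_{\beta\in A}L(\beta).$$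
   Context: **Eigenvalue, eigenfunction and rate function.** Under assumption (1), for each $\alpha\in\mathbb{R}^d$ the nonnegative kernel $e^{\langle\alpha,g(y)\rangle}p(x,dy)$ is known to admit a unique real eigenvalue $e^{H(\alpha)}$ and a unique (up to a positive multiplicative constant) eigenfunction $r(\cdot;\alpha)$ such that $$\int_{\mathcal{S}}e^{\langle\alpha,g(y)\rangle}r(y;\alpha)\,p(x,dy)=e^{H(\alpha)}r(x;\alpha)\quad\text{for all }x\in\mathcal{S},$$ and such that $c_\alpha\le r(x;\alpha)\le C_\alpha$ for all $x\in\mathcal{S}$, for some constants $0<c_\alpha<C_\alpha<\infty$; moreover $H$ is analytic and strictly convex on $\mathbb{R}^d$ with $H(0)=0$. (Below only ratios $r(y;\alpha)/r(x;\alpha)$ appear, so the normalization of $r(\cdot;\alpha)$ is irrelevant.) The rate function is $$L(\beta)=\sup_{\alpha\in\mathbb{R}^d}[\langle\alpha,\beta\rangle-H(\alpha)]\in[0,\infty],\qquad\beta\in\mathbb{R}^d .$$ If $Y=\{Y_j\}_{j\ge0}$ is the time-homogeneous Markov chain with kernel $p$ and $Y_0\equiv y_0$, and $S_n=g(Y_0)+\dots+g(Y_{n-1})$, it is known that $\{S_n/n\}$ satisfies the large deviation principle with rate function $L$. **Adaptive importance sampling.** A control is a collection $\alpha^n=\{\alpha^n_j(\cdot,\cdot),\ j=1,\dots,n-1\}$ of Borel measurable functions $\alpha^n_j:\mathcal{S}\times\mathbb{R}^d\to\mathbb{R}^d$. Given a control, define the process $\bar Y^n_0\equiv y_0$, $\bar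 S^n_j=\sum_{i=0}^{j-1}g(\bar Y^n_i)$ for $j=0,\dots,n$, where for $1\le j\le n-1$ the conditional distribution of $\bar Y^n_j$ given $\bar Y^n_0,\dots,\bar Y^n_{j-1}$ is $$\exp\{\langle\alpha^n_j,g(y)\rangle-H(\alpha^n_j)\}\,\frac{r(y;\alpha^n_j)}{r(\bar Y^n_{j-1};\alpha^n_j)}\,p(\bar Y^n_{j-1},dy),$$ with $\alpha^n_j$ abbreviating $\alpha^n_j(\bar Y^n_{j-1},\bar S^n_j/n)$. Define $$\bar X_n=1_{\{\bar S^n_n/n\in A\}}\exp\Big\{\sum_{j=1}^{n-1}\big(-\langle\alpha^n_j,g(\bar Y^n_j)\rangle+H(\alpha^n_j)\big)\Big\}\prod_{j=1}^{n-1}\frac{r(\bar Y^n_{j-1};\alpha^n_j)}{r(\bar Y^n_j;\alpha^n_j)},$$ which is an unbiased estimator of $P\{S_n/n\in A\}$. Then $$V^n(y_0)=\inf_{\alpha^n}E[\bar X_n^2],$$ the infimum being over all controls $\alpha^n$. *)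

theory Defs
  imports "HOL-Probability.Probability"
begin

text \<open>
  The state space is a type of class \<open>polish_space\<close> and a transition probability kernel on it is a
  measurable map from \<open>borel\<close> to \<open>prob_algebra borel\<close>.
\<close>

primrec kernel_power :: "('s::polish_space \<Rightarrow> 's measure) \<Rightarrow> nat \<Rightarrow> 's \<Rightarrow> 's measure" where
  "kernel_power p 0 x = return borel x"
| "kernel_power p (Suc m) x = p x \<bind> kernel_power p m"

definition uniformly_recurrent :: "('s::polish_space \<Rightarrow> 's measure) \<Rightarrow> bool" where
  "uniformly_recurrent p \<longleftrightarrow>
     (\<exists>(\<nu>::'s measure) (m::nat) (a::real) (b::real).
        prob_space \<nu> \<and> sets \<nu> = sets borel \<and> 1 \<le> m \<and> 0 < a \<and> 0 < b \<and>
        (\<forall>x. \<forall>B\<in>sets borel.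
           a * measure \<nu> B \<le> measure (kernel_power p m x) B \<and>
           measure (kernel_power p m x) B \<le> b * measure \<nu> B))"

definition is_eigenpair ::
  "('s::polish_space \<Rightarrow> 's measure) \<Rightarrow> ('s \<Rightarrow> real^'d) \<Rightarrow> real^'d \<Rightarrow> real \<Rightarrow> ('s \<Rightarrow> real) \<Rightarrow> bool" where
  "is_eigenpair p g \<alpha> h r \<longleftrightarrow>
     r \<in> borel_measurable borel \<and>
     (\<exists>c C. 0 < c \<and> c < C \<and> (\<forall>x. c \<le> r x \<and> r x \<le> C)) \<and>
     (\<forall>x. (\<integral>y. exp (\<alpha> \<bullet> g y) * r y \<partial>p x) = exp h * r x)"

definition eig_H ::
  "('s::polish_space \<Rightarrow> 's measure) \<Rightarrow> ('s \<Rightarrow> real^'d) \<Rightarrow> real^'d \<Rightarrow> real" where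
  "eig_H p g \<alpha> = (THE h. \<exists>r. is_eigenpair p g \<alpha> h r)"

text \<open>
  The eigenfunction is determined only up to a positive factor depending on \<open>\<alpha>\<close>; \<open>eig_r\<close> picks one
  arbitrarily for each \<open>\<alpha>\<close> and is therefore not claimed to be measurable in \<open>\<alpha>\<close>. Below it enters
  only through the ratios \<open>eig_r p g \<alpha> y / eig_r p g \<alpha> x\<close>, which do not depend on the choice.
\<close>

definition eig_r ::
  "('s::polish_space \<Rightarrow> 's measure) \<Rightarrow> ('s \<Rightarrow> real^'d) \<Rightarrow> real^'d \<Rightarrow> 's \<Rightarrow> real" where
  "eig_r p g \<alpha> = (SOME r. is_eigenpair p g \<alpha> (eig_H p g \<alpha>) r)"

definition rate_L ::
  "('s::polish_space \<Rightarrow> 's measure) \<Rightarrow> ('s \<Rightarrow> real^'d) \<Rightarrow> real^'d \<Rightarrow> ereal" where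
  "rate_L p g \<beta> = (SUP \<alpha>. ereal (\<alpha> \<bullet> \<beta> - eig_H p g \<alpha>))"

type_synonym ('s, 'd) control = "nat \<Rightarrow> 's \<times> (real^'d) \<Rightarrow> real^'d"

definition controls :: "nat \<Rightarrow> ('s::polish_space, 'd::finite) control set" where
  "controls n = {u. \<forall>j\<in>{1..<n}. u j \<in> borel_measurable borel}"

definition S_bar :: "('s \<Rightarrow> real^'d) \<Rightarrow> nat \<Rightarrow> (nat \<Rightarrow> 's) \<Rightarrow> real^'d" where
  "S_bar g j \<omega> = (\<Sum>i<j. g (\<omega> i))"

definition applied_control ::
  "('s \<Rightarrow> real^'d) \<Rightarrow> nat \<Rightarrow> ('s, 'd) control \<Rightarrow> nat \<Rightarrow> (nat \<Rightarrow> 's) \<Rightarrow> real^'d" where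
  "applied_control g n u j \<omega> = u j (\<omega> (j - 1), (1 / real n) *\<^sub>R S_bar g j \<omega>)"

definition twisted_kernel ::
  "('s::polish_space \<Rightarrow> 's measure) \<Rightarrow> ('s \<Rightarrow> real^'d) \<Rightarrow> real^'d \<Rightarrow> 's \<Rightarrow> 's measure" where
  "twisted_kernel p g \<alpha> x =
     density (p x) (\<lambda>y. ennreal (exp (\<alpha> \<bullet> g y - eig_H p g \<alpha>) * (eig_r p g \<alpha> y / eig_r p g \<alpha> x)))"

text \<open>
  Conditional law of the \<open>j\<close>-th state of the controlled process given the path \<open>\<omega>\<close> of the states
  with index below \<open>j\<close>. The case \<open>j = 0\<close> encodes the initial state \<open>y0\<close>; the process is only used up
  to time \<open>n - 1\<close>, so the value for \<open>j \<ge> n\<close> is immaterial padding.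
\<close>

definition control_step ::
  "('s::polish_space \<Rightarrow> 's measure) \<Rightarrow> ('s \<Rightarrow> real^'d) \<Rightarrow> 's \<Rightarrow> nat \<Rightarrow> ('s, 'd::finite) control \<Rightarrow>
     nat \<Rightarrow> (nat \<Rightarrow> 's) \<Rightarrow> 's measure" where
  "control_step p g y0 n u j \<omega> =
     (if j \<in> {1..<n} then twisted_kernel p g (applied_control g n u j \<omega>) (\<omega> (j - 1))
      else return borel y0)"

text \<open>
  Joint law of the first \<open>n\<close> states (indices \<open>0, \<dots>, n - 1\<close>) on \<open>PiM {0..<n} (\<lambda>_. borel)\<close>, by the
  Ionescu-Tulcea construction started from the empty path.
\<close>

definition controlled_law ::
  "('s::polish_space \<Rightarrow> 's measure) \<Rightarrow> ('s \<Rightarrow> real^'d) \<Rightarrow> 's \<Rightarrow> nat \<Rightarrow> ('s, 'd::finite) control \<Rightarrow>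
     (nat \<Rightarrow> 's) measure" where
  "controlled_law p g y0 n u =
     Ionescu_Tulcea.C (control_step p g y0 n u) (\<lambda>_. borel) 0 n (\<lambda>_. undefined)"

definition X_bar ::
  "('s::polish_space \<Rightarrow> 's measure) \<Rightarrow> ('s \<Rightarrow> real^'d) \<Rightarrow> (real^'d) set \<Rightarrow> nat \<Rightarrow>
     ('s, 'd::finite) control \<Rightarrow> (nat \<Rightarrow> 's) \<Rightarrow> real" where
  "X_bar p g A n u \<omega> =
     indicator A ((1 / real n) *\<^sub>R S_bar g n \<omega>) *
     exp (\<Sum>j\<in>{1..<n}. - (applied_control g n u j \<omega> \<bullet> g (\<omega> j)) + eig_H p g (applied_control g n u j \<omega>)) *
     (\<Prod>j\<in>{1..<n}. eig_r p g (applied_control g n u j \<omega>) (\<omega> (j - 1)) /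
                      eig_r p g (applied_control g n u j \<omega>) (\<omega> j))"

definition V_min ::
  "('s::polish_space \<Rightarrow> 's measure) \<Rightarrow> ('s \<Rightarrow> real^'d) \<Rightarrow> (real^'d) set \<Rightarrow> 's \<Rightarrow> nat \<Rightarrow> ennreal" where
  "V_min p g A y0 n =
     (INF u\<in>controls n. \<integral>\<^sup>+\<omega>. ennreal ((X_bar p g A n u \<omega>)\<^sup>2) \<partial>controlled_law p g y0 n u)"

text \<open>Extended logarithm, with \<open>log 0 = -\<infinity>\<close> and \<open>log \<infinity> = \<infinity>\<close>.\<close>

definition ext_ln :: "ennreal \<Rightarrow> ereal" where
  "ext_ln v = (if v = 0 then -\<infinity> else if v = \<infinity> then \<infinity> else ereal (ln (enn2real v)))"

definition W_rate ::
  "('s::polish_space \<Rightarrow> 's measure) \<Rightarrow> ('s \<Rightarrow> real^'d) \<Rightarrow> (real^'d) set \<Rightarrow> 's \<Rightarrow> nat \<Rightarrow> ereal" where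
  "W_rate p g A y0 n = - (ereal (1 / real n) * ext_ln (V_min p g A y0 n))"

end

theory Submission
  imports Defs
begin

text \<open>
  Uniform recurrence gives a Harnack inequality for the \<open>m\<close>-th power of the tilted operator
  \<open>f \<mapsto> \<integral> exp (\<alpha> \<bullet> g y) f y p(x, dy)\<close>, so Birkhoff's contraction argument makes ratios of its iterates
  converge geometrically. This yields the eigenpair, its uniqueness, and the continuity and
  measurability of \<open>r(y; \<alpha>) / r(x; \<alpha>)\<close> in \<open>\<alpha>\<close>.

  By Cauchy-Schwarz \<open>V\<^sup>n \<ge> P{S\<^sub>n / n \<in> A}\<^sup>2\<close> for every control. The exponential rate at which the chain
  can be forced, uniformly in its starting point, to have mean \<open>\<beta>\<close> is convex in \<open>\<beta>\<close> by the Markov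
  property, and its conjugate dominates \<open>H\<close>; separating hyperplanes then bound it above by \<open>L\<close>.

  In the other direction, compactness yields finitely many parameters \<open>a\<close> such that on \<open>A\<close> one of the
  affine functions \<open>a \<bullet> \<beta> - H a\<close> is at least \<open>c\<close>, for a given \<open>c\<close> below the infimum of \<open>L\<close>. Using as
  control the softmax average of the parameters, whose temperature is fixed as \<open>n\<close> grows, the
  softened maximum of the affine functions is almost a supermartingale bound of the second moment;
  convexity of \<open>H\<close> handles the averaging, and the control moves so little per step that the
  eigenfunction ratios nearly telescope.
\<close>

text \<open>The definitions pick eigenpairs by \<open>THE\<close> and \<open>SOME\<close>, so only
  ratios of eigenfunction values carry information. The contraction rate depends on \<alpha> only
  through a bound on its norm, which makes all estimates of these ratios uniform on balls of
  parameters and over all states.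

  For a constant control \<open>a\<close>, the function
  \<open>exp (2 * (a \<bullet> v - k * H a))\<close> times the squared eigenfunction solves the
  recursion for second moments with equality: the factor 2 yields two copies of the density of the
  twisted kernel, one of which cancels \<open>1 / dens\<close>. One such function is large enough at
  time n only on a half-space, so the maximum over several \<open>a\<close> is wanted, but it has
  kinks at which no single control works. Hence 2 is split as \<open>N * \<eta>\<close>: the power
  \<open>Z ^ N\<close> with small \<eta> is a smooth substitute for the maximum, and the gradient of
  its logarithm is twice the softmax mean, which is exactly the control used. The error per step is
  of order \<eta>, so it suffices to let \<eta> tend to 0 after n tends to infinity.

  The two bounds lead to the infimum of L over the closure and over the interior of A.\<close>

section \<open>Bounded Borel functions and one-step estimates for the tilted operator\<close>

definition bdd_borel :: "('a::topological_space \<Rightarrow> real) \<Rightarrow> bool" where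
  "bdd_borel f \<longleftrightarrow> f \<in> borel_measurable borel \<and> (\<exists>B. \<forall>x. \<bar>f x\<bar> \<le> B)"

lemma bdd_borelI: "f \<in> borel_measurable borel \<Longrightarrow> (\<And>x. \<bar>f x\<bar> \<le> B) \<Longrightarrow> bdd_borel f"
  by (auto simp: bdd_borel_def)

lemma bdd_borel_measurable [measurable_dest]: "bdd_borel f \<Longrightarrow> f \<in> borel_measurable borel"
  by (simp add: bdd_borel_def)

lemma bdd_borel_const [simp]: "bdd_borel (\<lambda>x. c)"
  by (auto simp: bdd_borel_def)

lemma bdd_borel_lin:
  assumes "bdd_borel f" "bdd_borel h" shows "bdd_borel (\<lambda>x. a * f x + b * h x)"
proof -
  obtain B C where B: "\<And>x. \<bar>f x\<bar> \<le> B" and C: "\<And>x. \<bar>h x\<bar> \<le> C"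
    using assms by (auto simp: bdd_borel_def)
  have [measurable]: "f \<in> borel_measurable borel" "h \<in> borel_measurable borel"
    using assms by (auto simp: bdd_borel_def)
  have "\<bar>a * f x + b * h x\<bar> \<le> \<bar>a\<bar> * B + \<bar>b\<bar> * C" for x
    using mult_left_mono[OF B[of x], of "\<bar>a\<bar>"] mult_left_mono[OF C[of x], of "\<bar>b\<bar>"]
      abs_triangle_ineq[of "a * f x" "b * h x"] by (simp add: abs_mult)
  then show ?thesis by (intro bdd_borelI) auto
qed

lemma bdd_borel_scale: "bdd_borel f \<Longrightarrow> bdd_borel (\<lambda>x. a * f x)"
  using bdd_borel_lin[of f f a 0] by simp

text \<open>Uniform recurrence enters in the form \<open>harnack\<close>, which compares the m-step
  laws from two starting points directly; the reference measure and its two constants are merged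
  into \<open>D\<close>.\<close>

locale bounded_chain =
  fixes p :: "'s::polish_space \<Rightarrow> 's measure"
    and g :: "'s \<Rightarrow> real^'d"
    and R D :: real and m :: nat
  assumes kernel: "p \<in> borel \<rightarrow>\<^sub>M prob_algebra borel"
    and g_meas [measurable]: "g \<in> borel_measurable borel"
    and g_le: "\<And>x. norm (g x) \<le> R"
    and m_pos: "1 \<le> m" and D_ge: "1 \<le> D"
    and harnack: "\<And>x y B. B \<in> sets borel \<Longrightarrow>
      measure (kernel_power p m x) B \<le> D * measure (kernel_power p m y) B"
begin

lemma R_nonneg: "0 \<le> R"
  using norm_ge_zero[of "g undefined"] g_le[of undefined] by linarith

lemma kernel_subprob [measurable]: "p \<in> borel \<rightarrow>\<^sub>M subprob_algebra borel"
  by (rule measurable_prob_algebraD[OF kernel])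

lemma prob_space_p: "prob_space (p x)"
  using measurable_space[OF kernel, of x] by (simp add: space_prob_algebra)

lemma sets_p [simp, measurable_cong]: "sets (p x) = sets borel"
  using measurable_space[OF kernel, of x] by (simp add: space_prob_algebra)

lemma space_p [simp]: "space (p x) = UNIV"
  using sets_eq_imp_space_eq[OF sets_p] by simp

lemma measure_p_UNIV [simp]: "measure (p x) UNIV = 1"
  using prob_space.prob_space[OF prob_space_p, of x] by simp

lemma inner_g_le: "\<bar>\<alpha> \<bullet> g y\<bar> \<le> R * norm \<alpha>"
proof -
  have "\<bar>\<alpha> \<bullet> g y\<bar> \<le> norm \<alpha> * norm (g y)" by (rule Cauchy_Schwarz_ineq2)
  also have "\<dots> \<le> norm \<alpha> * R" by (intro mult_left_mono g_le) simp
  finally show ?thesis by (simp add: mult.commute)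
qed

lemma inner_g_le': "\<alpha> \<bullet> g y \<le> R * norm \<alpha>" "- (R * norm \<alpha>) \<le> \<alpha> \<bullet> g y"
  using inner_g_le[of \<alpha> y] by auto

definition tilt :: "real^'d \<Rightarrow> ('s \<Rightarrow> real) \<Rightarrow> 's \<Rightarrow> real" where
  "tilt \<alpha> f x = (\<integral>y. exp (\<alpha> \<bullet> g y) * f y \<partial>p x)"

lemma tilt_integrable:
  assumes "bdd_borel f" shows "integrable (p x) (\<lambda>y. exp (\<alpha> \<bullet> g y) * f y)"
proof -
  interpret prob_space "p x" by (rule prob_space_p)
  have [measurable]: "f \<in> borel_measurable borel" using assms by (rule bdd_borel_measurable)
  obtain B where B: "\<And>x. \<bar>f x\<bar> \<le> B" using assms by (auto simp: bdd_borel_def)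
  have "norm (exp (\<alpha> \<bullet> g y) * f y) \<le> exp (R * norm \<alpha>) * B" for y
    using inner_g_le'[of \<alpha> y] B[of y] by (auto simp: abs_mult intro!: mult_mono)
  then show ?thesis by (intro integrable_const_bound[where B="exp (R * norm \<alpha>) * B"]) auto
qed

lemma tilt_bdd_borel:
  assumes "bdd_borel f" shows "bdd_borel (tilt \<alpha> f)"
proof -
  have [measurable]: "f \<in> borel_measurable borel" using assms by (rule bdd_borel_measurable)
  obtain B where B: "\<And>x. \<bar>f x\<bar> \<le> B" using assms by (auto simp: bdd_borel_def)
  have "(\<lambda>x. tilt \<alpha> f x) \<in> borel_measurable borel"
    unfolding tilt_def by measurable
  moreover have "\<bar>tilt \<alpha> f x\<bar> \<le> exp (R * norm \<alpha>) * B" for x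
  proof -
    interpret prob_space "p x" by (rule prob_space_p)
    have bd: "\<bar>exp (\<alpha> \<bullet> g y) * f y\<bar> \<le> exp (R * norm \<alpha>) * B" for y
      using inner_g_le'[of \<alpha> y] B[of y] by (auto simp: abs_mult intro!: mult_mono)
    have "\<bar>tilt \<alpha> f x\<bar> \<le> (\<integral>y. \<bar>exp (\<alpha> \<bullet> g y) * f y\<bar> \<partial>p x)"
      unfolding tilt_def by (rule integral_abs_bound)
    also have "\<dots> \<le> (\<integral>y. exp (R * norm \<alpha>) * B \<partial>p x)"
      by (intro integral_mono bd integrable_abs tilt_integrable assms) auto
    finally show ?thesis by (simp add: prob_space)
  qed
  ultimately show ?thesis by (rule bdd_borelI)
qed

lemma tilt_lin:
  assumes "bdd_borel f" "bdd_borel h"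
  shows "tilt \<alpha> (\<lambda>x. a * f x + b * h x) = (\<lambda>x. a * tilt \<alpha> f x + b * tilt \<alpha> h x)"
proof
  fix x
  have "tilt \<alpha> (\<lambda>x. a * f x + b * h x) x =
      (\<integral>y. a * (exp (\<alpha> \<bullet> g y) * f y) + b * (exp (\<alpha> \<bullet> g y) * h y) \<partial>p x)"
    unfolding tilt_def by (intro Bochner_Integration.integral_cong) (auto simp: algebra_simps)
  also have "\<dots> = a * tilt \<alpha> f x + b * tilt \<alpha> h x"
    unfolding tilt_def using tilt_integrable[OF assms(1)] tilt_integrable[OF assms(2)] by simp
  finally show "tilt \<alpha> (\<lambda>x. a * f x + b * h x) x = a * tilt \<alpha> f x + b * tilt \<alpha> h x" .
qed

lemma tilt_mono:
  assumes "bdd_borel f" "bdd_borel h" "\<And>x. f x \<le> h x"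
  shows "tilt \<alpha> f x \<le> tilt \<alpha> h x"
  unfolding tilt_def by (intro integral_mono tilt_integrable assms mult_left_mono) auto

lemma tilt_nn_integral:
  assumes "bdd_borel f" "\<And>x. 0 \<le> f x"
  shows "(\<integral>\<^sup>+y. ennreal (exp (\<alpha> \<bullet> g y) * f y) \<partial>p x) = ennreal (tilt \<alpha> f x)"
  unfolding tilt_def by (intro nn_integral_eq_integral tilt_integrable assms) (auto simp: assms)

lemma tilt_change:
  assumes "bdd_borel f" "\<And>x. 0 \<le> f x"
  shows "tilt \<alpha> f x \<le> exp (R * norm (\<alpha> - \<beta>)) * tilt \<beta> f x"
proof -
  have "tilt \<alpha> f x \<le> (\<integral>y. exp (R * norm (\<alpha> - \<beta>)) * (exp (\<beta> \<bullet> g y) * f y) \<partial>p x)"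
    unfolding tilt_def
  proof (intro integral_mono tilt_integrable integrable_mult_right assms)
    fix y
    have "exp (\<alpha> \<bullet> g y) \<le> exp (R * norm (\<alpha> - \<beta>)) * exp (\<beta> \<bullet> g y)"
      using inner_g_le'(1)[of "\<alpha> - \<beta>" y] by (simp add: inner_diff_left flip: exp_add)
    from mult_right_mono[OF this assms(2)[of y]]
    show "exp (\<alpha> \<bullet> g y) * f y \<le> exp (R * norm (\<alpha> - \<beta>)) * (exp (\<beta> \<bullet> g y) * f y)"
      by (simp add: mult.assoc)
  qed
  also have "\<dots> = exp (R * norm (\<alpha> - \<beta>)) * tilt \<beta> f x"
    by (simp add: tilt_def)
  finally show ?thesis .
qed

lemma tilt_pos:
  assumes "bdd_borel f" "0 < c" "\<And>x. c \<le> f x"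
  shows "exp (- (R * norm \<alpha>)) * c \<le> tilt \<alpha> f x"
proof -
  interpret prob_space "p x" by (rule prob_space_p)
  have "(\<integral>y. exp (- (R * norm \<alpha>)) * c \<partial>p x) \<le> tilt \<alpha> f x"
    unfolding tilt_def
    by (intro integral_mono tilt_integrable assms mult_mono) (use assms inner_g_le'[of \<alpha>] in auto)
  then show ?thesis by (simp add: prob_space)
qed

subsection \<open>Iterates\<close>

abbreviation tiltn :: "real^'d \<Rightarrow> nat \<Rightarrow> ('s \<Rightarrow> real) \<Rightarrow> 's \<Rightarrow> real" where
  "tiltn \<alpha> n \<equiv> tilt \<alpha> ^^ n"

lemma tiltn_bdd_borel: "bdd_borel f \<Longrightarrow> bdd_borel (tiltn \<alpha> n f)"
  by (induction n) (auto intro: tilt_bdd_borel)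

lemma tiltn_lin:
  assumes "bdd_borel f" "bdd_borel h"
  shows "tiltn \<alpha> n (\<lambda>x. a * f x + b * h x) = (\<lambda>x. a * tiltn \<alpha> n f x + b * tiltn \<alpha> n h x)"
  by (induction n) (simp_all add: tilt_lin tiltn_bdd_borel assms)

lemma tiltn_scale:
  assumes "bdd_borel f"
  shows "tiltn \<alpha> n (\<lambda>x. a * f x) = (\<lambda>x. a * tiltn \<alpha> n f x)"
  using tiltn_lin[OF assms assms, where \<alpha>=\<alpha> and n=n and a=a and b=0] by simp

lemma tiltn_mono:
  assumes "bdd_borel f" "bdd_borel h" "\<And>x. f x \<le> h x"
  shows "tiltn \<alpha> n f x \<le> tiltn \<alpha> n h x"
  by (induction n arbitrary: x) (auto intro!: tilt_mono tiltn_bdd_borel assms)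

lemma tiltn_zero [simp]: "tiltn \<alpha> n (\<lambda>x. 0) = (\<lambda>x. 0)"
  using tiltn_scale[of "\<lambda>x. 0" n \<alpha> 0] by simp

lemma tiltn_nonneg: "bdd_borel f \<Longrightarrow> (\<And>x. 0 \<le> f x) \<Longrightarrow> 0 \<le> tiltn \<alpha> n f x"
  using tiltn_mono[of "\<lambda>x. 0" f n \<alpha> x] by simp

lemma tiltn_lower:
  assumes "bdd_borel f" "0 < c" "\<And>x. c \<le> f x"
  shows "\<exists>d>0. \<forall>x. d \<le> tiltn \<alpha> n f x"
proof (induction n)
  case 0 then show ?case using assms by auto
next
  case (Suc n)
  then obtain d where "0 < d" "\<And>x. d \<le> tiltn \<alpha> n f x" by auto
  from tilt_pos[OF tiltn_bdd_borel[OF assms(1)] this]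
  show ?case using \<open>0 < d\<close> by (intro exI[of _ "exp (- (R * norm \<alpha>)) * d"]) auto
qed

lemma tiltn_pos:
  assumes "bdd_borel f" "0 < c" "\<And>x. c \<le> f x"
  shows "0 < tiltn \<alpha> n f x"
  using tiltn_lower[OF assms, where \<alpha>=\<alpha> and n=n] less_le_trans by blast

lemma tiltn_one_pos: "0 < tiltn \<alpha> n (\<lambda>x. 1) x"
  by (rule tiltn_pos[of _ 1]) auto

lemma tiltn_change:
  assumes "bdd_borel f" "\<And>x. 0 \<le> f x"
  shows "tiltn \<alpha> n f x \<le> exp (n * R * norm (\<alpha> - \<beta>)) * tiltn \<beta> n f x"
proof (induction n arbitrary: x)
  case (Suc n)
  let ?e = "exp (n * R * norm (\<alpha> - \<beta>))"
  have "tiltn \<alpha> (Suc n) f x \<le> exp (R * norm (\<alpha> - \<beta>)) * tilt \<beta> (tiltn \<alpha> n f) x"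
    using tilt_change[OF tiltn_bdd_borel tiltn_nonneg] assms by simp
  also have "tilt \<beta> (tiltn \<alpha> n f) x \<le> tilt \<beta> (\<lambda>x. ?e * tiltn \<beta> n f x) x"
    by (intro tilt_mono Suc tiltn_bdd_borel bdd_borel_scale assms)
  also have "\<dots> = ?e * tiltn \<beta> (Suc n) f x"
    using tiltn_scale[of "tiltn \<beta> n f" 1 \<beta> ?e] by (simp add: tiltn_bdd_borel assms)
  finally show ?case by (simp add: algebra_simps exp_add)
qed simp

subsection \<open>The Harnack inequality\<close>

lemma kernel_power_prob [measurable]: "kernel_power p n \<in> borel \<rightarrow>\<^sub>M prob_algebra borel"
proof (induction n)
  case 0
  have "kernel_power p 0 = return borel" by auto
  then show ?case by simp
next
  case (Suc n)
  have "kernel_power p (Suc n) = (\<lambda>x. p x \<bind> kernel_power p n)" by auto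
  then show ?case using measurable_bind_prob_space[OF kernel Suc] by simp
qed

lemma kernel_power_subprob [measurable]: "kernel_power p n \<in> borel \<rightarrow>\<^sub>M subprob_algebra borel"
  by (rule measurable_prob_algebraD[OF kernel_power_prob])

lemma sets_kernel_power [simp, measurable_cong]: "sets (kernel_power p n x) = sets borel"
  using measurable_space[OF kernel_power_prob, of x n] by (simp add: space_prob_algebra)

lemma prob_space_kernel_power: "prob_space (kernel_power p n x)"
  using measurable_space[OF kernel_power_prob, of x n] by (simp add: space_prob_algebra)

lemma nn_integral_kernel_power_Suc:
  assumes [measurable]: "f \<in> borel_measurable borel"
  shows "(\<integral>\<^sup>+z. f z \<partial>kernel_power p (Suc n) x) = (\<integral>\<^sup>+y. \<integral>\<^sup>+z. f z \<partial>kernel_power p n y \<partial>p x)"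
  by (simp add: nn_integral_bind[where B=borel])

lemma nn_harnack:
  assumes [measurable]: "f \<in> borel_measurable borel"
  shows "(\<integral>\<^sup>+z. f z \<partial>kernel_power p m x) \<le> ennreal D * (\<integral>\<^sup>+z. f z \<partial>kernel_power p m y)"
proof -
  interpret x: prob_space "kernel_power p m x" by (rule prob_space_kernel_power)
  interpret y: prob_space "kernel_power p m y" by (rule prob_space_kernel_power)
  \<comment> \<open>Read as an inequality between measures, the setwise comparison passes to all
    nonnegative integrands.\<close>
  have "kernel_power p m x \<le> scale_measure (ennreal D) (kernel_power p m y)"
  proof (subst le_measure)
    show "\<forall>B\<in>sets (kernel_power p m x). emeasure (kernel_power p m x) B
        \<le> emeasure (scale_measure (ennreal D) (kernel_power p m y)) B"
      using harnack[of _ x y] D_ge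
      by (auto simp: x.emeasure_eq_measure y.emeasure_eq_measure simp flip: ennreal_mult')
  qed simp
  from nn_integral_mono_measure[OF _ this, of f] show ?thesis
    by (simp add: nn_integral_scale_measure)
qed

text \<open>At parameter 0 there is no tilt, so this translates the comparison of the laws
  \<open>kernel_power p m x\<close> into one of iterates of \<open>tilt\<close>.\<close>

lemma tiltn_zero_kernel_power:
  assumes "bdd_borel f" "\<And>x. 0 \<le> f x"
  shows "ennreal (tiltn 0 n f x) = (\<integral>\<^sup>+z. ennreal (f z) \<partial>kernel_power p n x)"
proof (induction n arbitrary: x)
  case 0
  have [measurable]: "f \<in> borel_measurable borel" using assms(1) by (rule bdd_borel_measurable)
  show ?case by (simp add: nn_integral_return)
next
  case (Suc n)
  have [measurable]: "f \<in> borel_measurable borel" using assms(1) by (rule bdd_borel_measurable)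
  have "ennreal (tiltn 0 (Suc n) f x) = (\<integral>\<^sup>+y. ennreal (tiltn 0 n f y) \<partial>p x)"
    using tilt_nn_integral[of "tiltn 0 n f" x 0] tiltn_bdd_borel[OF assms(1)] tiltn_nonneg[OF assms] by simp
  then show ?case by (simp add: Suc nn_integral_kernel_power_Suc del: kernel_power.simps)
qed

text \<open>The exponential pays for replacing \<alpha> by 0 and returning to \<alpha>, each time
  over m steps. Only the bound \<open>M\<close> on the norm of \<alpha> enters.\<close>

definition harnack_const :: "real \<Rightarrow> real" where "harnack_const M = D * exp (2 * m * R * M)"

lemma harnack_const_ge: "0 \<le> M \<Longrightarrow> 1 \<le> harnack_const M"
  using D_ge R_nonneg mult_mono[of 1 D 1 "exp (2 * m * R * M)"] by (simp add: harnack_const_def)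

lemma tiltn_harnack:
  assumes "bdd_borel f" "\<And>x. 0 \<le> f x" "norm \<alpha> \<le> M"
  shows "tiltn \<alpha> m f x \<le> harnack_const M * tiltn \<alpha> m f y"
proof -
  let ?e = "exp (m * R * norm \<alpha>)"
  have [measurable]: "f \<in> borel_measurable borel" using assms(1) by (rule bdd_borel_measurable)
  have "ennreal (tiltn 0 m f x) \<le> ennreal (D * tiltn 0 m f y)"
    using nn_harnack[of "\<lambda>x. ennreal (f x)" x y] D_ge
    by (simp add: tiltn_zero_kernel_power assms ennreal_mult')
  then have *: "tiltn 0 m f x \<le> D * tiltn 0 m f y"
    using D_ge tiltn_nonneg[OF assms(1,2)] by (simp add: ennreal_le_iff)
  have "tiltn \<alpha> m f x \<le> ?e * tiltn 0 m f x"
    using tiltn_change[OF assms(1,2), where \<alpha>=\<alpha> and n=m and x=x and \<beta>=0] by simp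
  also have "\<dots> \<le> ?e * (D * tiltn 0 m f y)"
    using * by simp
  also have "\<dots> \<le> ?e * (D * (?e * tiltn \<alpha> m f y))"
    using tiltn_change[OF assms(1,2), where \<alpha>=0 and n=m and x=y and \<beta>=\<alpha>] D_ge by simp
  also have "\<dots> = D * exp (2 * m * R * norm \<alpha>) * tiltn \<alpha> m f y"
    by (simp add: algebra_simps flip: exp_add)
  also have "\<dots> \<le> harnack_const M * tiltn \<alpha> m f y"
    unfolding harnack_const_def using D_ge R_nonneg assms(3) tiltn_nonneg[OF assms(1,2)]
    by (intro mult_right_mono mult_left_mono) (auto intro!: mult_left_mono)
  finally show ?thesis .
qed

text \<open>In \<open>birkhoff_step\<close> one factor \<open>harnack_const M\<close> is lost in
  comparing numerators at two states and another one in comparing denominators, hence the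
  square.\<close>

definition contraction :: "real \<Rightarrow> real" where "contraction M = 1 - 1 / (harnack_const M)\<^sup>2"

lemma contraction_bounds: "0 \<le> M \<Longrightarrow> 0 \<le> contraction M" "0 \<le> M \<Longrightarrow> contraction M < 1"
  using harnack_const_ge[of M] by (auto simp: contraction_def)

text \<open>Birkhoff's contraction: the Harnack inequality, applied to the two nonnegative functions
  \<open>f - s h\<close> and \<open>t h - f\<close>, which sum to \<open>(t - s) h\<close>, raises the lower and lowers the upper bound.\<close>

lemma birkhoff_step:
  assumes f: "bdd_borel f" and h: "bdd_borel h" and c: "0 < c" "\<And>x. c \<le> h x"
    and s: "\<And>x. s * h x \<le> f x" and t: "\<And>x. f x \<le> t * h x" and M: "norm \<alpha> \<le> M"
  shows "\<exists>s' t'. s \<le> s' \<and> t' \<le> t \<and> t' - s' = contraction M * (t - s) \<and>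
    (\<forall>x. s' * tiltn \<alpha> m h x \<le> tiltn \<alpha> m f x \<and> tiltn \<alpha> m f x \<le> t' * tiltn \<alpha> m h x)"
proof -
  let ?U = "tiltn \<alpha> m" and ?D = "harnack_const M"
  let ?u = "\<lambda>x. 1 * f x + (- s) * h x" and ?v = "\<lambda>x. t * h x + (- 1) * f x"
  obtain z :: 's where True by simp
  have M0: "0 \<le> M" using M norm_ge_zero[of \<alpha>] by linarith
  note D = harnack_const_ge[OF M0]
  have bu: "bdd_borel ?u" and bv: "bdd_borel ?v" by (intro bdd_borel_lin f h)+
  have Uu: "?U ?u = (\<lambda>x. 1 * ?U f x + (- s) * ?U h x)" and Uv: "?U ?v = (\<lambda>x. t * ?U h x + (- 1) * ?U f x)"
    by (intro tiltn_lin f h)+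
  have u0: "0 \<le> ?u x" and v0: "0 \<le> ?v x" for x using s[of x] t[of x] by auto
  have hpos: "0 < ?U h x" for x using tiltn_pos[OF h c] .
  have h0: "0 \<le> h x" for x using c(2)[of x] c(1) by linarith
  have key: "?U w z / ?U h z / ?D\<^sup>2 * ?U h x \<le> ?U w x" if "bdd_borel w" "\<And>x. 0 \<le> w x" for w x
  proof -
    have 1: "?U w z \<le> ?D * ?U w x" by (rule tiltn_harnack[OF that M])
    have 2: "?U h x \<le> ?D * ?U h z" by (rule tiltn_harnack[OF h h0 M])
    have "?U w z * ?U h x \<le> (?D * ?U w x) * (?D * ?U h z)"
      using 1 2 D tiltn_nonneg[OF that, of m \<alpha>] less_imp_le[OF hpos] by (intro mult_mono) auto
    then show ?thesis using hpos[of z] D by (simp add: field_simps power2_eq_square)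
  qed
  define a where "a = ?U ?u z / ?U h z / ?D\<^sup>2"
  define b where "b = ?U ?v z / ?U h z / ?D\<^sup>2"
  have nn: "0 \<le> a" "0 \<le> b"
    using tiltn_nonneg[OF bu u0, where \<alpha>=\<alpha> and n=m and x=z] tiltn_nonneg[OF bv v0, where \<alpha>=\<alpha> and n=m and x=z]
      less_imp_le[OF hpos[of z]] unfolding a_def b_def by auto
  have "a + b = (?U ?u z + ?U ?v z) / ?U h z / ?D\<^sup>2"
    by (simp add: a_def b_def add_divide_distrib)
  also have "?U ?u z + ?U ?v z = (t - s) * ?U h z"
    unfolding Uu Uv by (simp add: algebra_simps)
  finally have ab: "a + b = (t - s) / ?D\<^sup>2" using hpos[of z] by simp
  have "(s + a) * ?U h x \<le> ?U f x" for x
  proof -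
    have "a * ?U h x \<le> ?U ?u x" unfolding a_def by (rule key[OF bu u0])
    then have "a * ?U h x \<le> 1 * ?U f x + (- s) * ?U h x" unfolding Uu .
    then show ?thesis by (simp add: algebra_simps)
  qed
  moreover have "?U f x \<le> (t - b) * ?U h x" for x
  proof -
    have "b * ?U h x \<le> ?U ?v x" unfolding b_def by (rule key[OF bv v0])
    then have "b * ?U h x \<le> t * ?U h x + (- 1) * ?U f x" unfolding Uv .
    then show ?thesis by (simp add: algebra_simps)
  qed
  moreover have "(t - b) - (s + a) = contraction M * (t - s)"
    using ab by (simp add: contraction_def algebra_simps)
  ultimately show ?thesis using nn by (intro exI[of _ "s + a"] exI[of _ "t - b"]) auto
qed

text \<open>The \<open>i\<close> surplus steps are made first and use positivity only. Thus any
  number of steps that is at least \<open>j * m\<close> contracts by the j-th power.\<close>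

lemma birkhoff_iterate:
  assumes f: "bdd_borel f" and h: "bdd_borel h" and c: "0 < c" "\<And>x. c \<le> h x"
    and s: "\<And>x. s * h x \<le> f x" and t: "\<And>x. f x \<le> t * h x" and M: "norm \<alpha> \<le> M"
  shows "\<exists>s' t'. s \<le> s' \<and> t' \<le> t \<and> t' - s' = contraction M ^ j * (t - s) \<and>
    (\<forall>x. s' * tiltn \<alpha> (j * m + i) h x \<le> tiltn \<alpha> (j * m + i) f x \<and>
         tiltn \<alpha> (j * m + i) f x \<le> t' * tiltn \<alpha> (j * m + i) h x)"
proof (induction j)
  case 0
  have "s * tiltn \<alpha> i h x \<le> tiltn \<alpha> i f x" for x
    using tiltn_mono[OF bdd_borel_scale[OF h] f s, of i \<alpha> x] by (simp add: tiltn_scale h)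
  moreover have "tiltn \<alpha> i f x \<le> t * tiltn \<alpha> i h x" for x
    using tiltn_mono[OF f bdd_borel_scale[OF h] t, of i \<alpha> x] by (simp add: tiltn_scale h)
  ultimately show ?case by auto
next
  case (Suc j)
  let ?n = "j * m + i"
  obtain s' t' where st: "s \<le> s'" "t' \<le> t" "t' - s' = contraction M ^ j * (t - s)"
    "\<And>x. s' * tiltn \<alpha> ?n h x \<le> tiltn \<alpha> ?n f x" "\<And>x. tiltn \<alpha> ?n f x \<le> t' * tiltn \<alpha> ?n h x"
    using Suc by auto
  obtain d where d: "0 < d" "\<And>x. d \<le> tiltn \<alpha> ?n h x" using tiltn_lower[OF h c] by blast
  have eq: "tiltn \<alpha> m (tiltn \<alpha> ?n w) = tiltn \<alpha> (Suc j * m + i) w" for w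
    by (simp add: funpow_add)
  from birkhoff_step[OF tiltn_bdd_borel[OF f] tiltn_bdd_borel[OF h] d st(4,5) M]
  obtain s'' t'' where "s' \<le> s''" "t'' \<le> t'" "t'' - s'' = contraction M * (t' - s')"
    "\<And>x. s'' * tiltn \<alpha> m (tiltn \<alpha> ?n h) x \<le> tiltn \<alpha> m (tiltn \<alpha> ?n f) x \<and>
      tiltn \<alpha> m (tiltn \<alpha> ?n f) x \<le> t'' * tiltn \<alpha> m (tiltn \<alpha> ?n h) x" by blast
  then show ?case
    using st(1-3) unfolding eq by (intro exI[of _ s''] exI[of _ t'']) auto
qed

text \<open>The additive gap of the two bounds becomes a multiplicative one because the lower bound
  never falls below \<open>s > 0\<close>: t' - s' is at most \<open>contraction M ^ j * t\<close>,
  and t is at most t * s' / s.\<close>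

lemma birkhoff_ratio:
  assumes f: "bdd_borel f" and h: "bdd_borel h" and c: "0 < c" "\<And>x. c \<le> h x"
    and s: "0 < s" "\<And>x. s * h x \<le> f x" and t: "\<And>x. f x \<le> t * h x"
    and M: "norm \<alpha> \<le> M" and n: "j * m \<le> n"
  shows "tiltn \<alpha> n f x * tiltn \<alpha> n h y \<le> (1 + t / s * contraction M ^ j) * (tiltn \<alpha> n f y * tiltn \<alpha> n h x)"
proof -
  have M0: "0 \<le> M" using M norm_ge_zero[of \<alpha>] by linarith
  obtain i where n: "n = j * m + i" using n le_Suc_ex by blast
  obtain s' t' where st: "s \<le> s'" "t' \<le> t" "t' - s' = contraction M ^ j * (t - s)"
    "\<And>x. s' * tiltn \<alpha> n h x \<le> tiltn \<alpha> n f x" "\<And>x. tiltn \<alpha> n f x \<le> t' * tiltn \<alpha> n h x"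
    using birkhoff_iterate[OF f h c s(2) t M, of j i] unfolding n by blast
  have hp: "0 < tiltn \<alpha> n h x" for x using tiltn_pos[OF h c] .
  have s'p: "0 < s'" using s st by simp
  have th: "0 \<le> contraction M ^ j" using contraction_bounds(1)[OF M0] by simp
  have st0: "s \<le> t"
  proof -
    have "s * h x \<le> t * h x" using s(2)[of x] t[of x] by linarith
    then show ?thesis using c(1) c(2)[of x] by (simp add: mult_le_cancel_right)
  qed
  have "t' = s' + contraction M ^ j * (t - s)" using st(3) by simp
  also have "\<dots> \<le> s' + contraction M ^ j * t * (s' / s)"
  proof -
    have "contraction M ^ j * (t - s) \<le> contraction M ^ j * (t * (s' / s))"
      using th s st(1) st0 mult_left_mono[of 1 "s'/s" t]
      by (intro mult_left_mono) auto
    then show ?thesis by (simp add: mult.assoc)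
  qed
  also have "\<dots> = (1 + t / s * contraction M ^ j) * s'" using s by (simp add: field_simps)
  finally have t'le: "t' \<le> (1 + t / s * contraction M ^ j) * s'" .
  have e0: "0 \<le> 1 + t / s * contraction M ^ j" using th s st0 by simp
  have "tiltn \<alpha> n f x * tiltn \<alpha> n h y \<le> (t' * tiltn \<alpha> n h x) * tiltn \<alpha> n h y"
    using st(5)[of x] hp[of y] by simp
  also have "\<dots> \<le> ((1 + t / s * contraction M ^ j) * s' * tiltn \<alpha> n h x) * tiltn \<alpha> n h y"
    using t'le hp[of x] hp[of y] by (intro mult_right_mono) auto
  also have "\<dots> = (1 + t / s * contraction M ^ j) * tiltn \<alpha> n h x * (s' * tiltn \<alpha> n h y)"
    by (simp add: algebra_simps)
  also have "\<dots> \<le> (1 + t / s * contraction M ^ j) * tiltn \<alpha> n h x * tiltn \<alpha> n f y"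
    using st(4)[of y] e0 hp[of x] by (intro mult_left_mono) auto
  finally show ?thesis by (simp add: algebra_simps)
qed

subsection \<open>Existence of the eigenpair\<close>

text \<open>From m steps on this is the Harnack inequality. For fewer steps the iterate and its
  reciprocal are bounded by \<open>exp (n * R * norm \<alpha>)\<close>, and the square of this is at
  most the exponential part of \<open>harnack_const M\<close>.\<close>

lemma tiltn_one_ratio:
  assumes M: "norm \<alpha> \<le> M"
  shows "tiltn \<alpha> n (\<lambda>x. 1) x \<le> harnack_const M * tiltn \<alpha> n (\<lambda>x. 1) y"
proof (cases "m \<le> n")
  case True
  then obtain i where n: "n = m + i" using le_Suc_ex by blast
  show ?thesis
    unfolding n using tiltn_harnack[OF tiltn_bdd_borel tiltn_nonneg M, of "\<lambda>x. 1" i \<alpha>]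
    by (simp add: funpow_add)
next
  case False
  let ?e = "exp (n * R * norm \<alpha>)"
  have M0: "0 \<le> M" using M norm_ge_zero[of \<alpha>] by linarith
  have one: "tiltn 0 n (\<lambda>x. 1) = (\<lambda>x. 1)"
    by (induction n) (auto simp: tilt_def)
  have 1: "tiltn \<alpha> n (\<lambda>x. 1) x \<le> ?e" using tiltn_change[of "\<lambda>x. 1" n \<alpha> x 0] by (simp add: one)
  have 2: "1 \<le> ?e * tiltn \<alpha> n (\<lambda>x. 1) y" using tiltn_change[of "\<lambda>x. 1" n 0 y \<alpha>] by (simp add: one)
  have "n * R * norm \<alpha> \<le> m * R * M"
    using False M R_nonneg by (intro mult_mono) auto
  then have "exp (2 * (n * R * norm \<alpha>)) \<le> exp (2 * (m * R * M))" by simp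
  then have "?e * ?e \<le> exp (2 * m * R * M)"
    by (simp add: mult.assoc mult.left_commute flip: exp_add)
  also have "\<dots> \<le> harnack_const M" unfolding harnack_const_def using D_ge by simp
  finally have 3: "?e * ?e \<le> harnack_const M" .
  have "tiltn \<alpha> n (\<lambda>x. 1) x \<le> ?e * (?e * tiltn \<alpha> n (\<lambda>x. 1) y)"
  proof (rule order_trans[OF 1])
    have "?e * 1 \<le> ?e * (?e * tiltn \<alpha> n (\<lambda>x. 1) y)" by (intro mult_left_mono 2) simp
    then show "?e \<le> ?e * (?e * tiltn \<alpha> n (\<lambda>x. 1) y)" by (simp only: mult_1_right)
  qed
  also have "\<dots> \<le> harnack_const M * tiltn \<alpha> n (\<lambda>x. 1) y"
    using mult_right_mono[OF 3 less_imp_le[OF tiltn_one_pos[of n \<alpha> y]]] by (simp add: mult.assoc)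
  finally show ?thesis .
qed

text \<open>The iterate \<open>f (n + k)\<close> is obtained from \<open>f k\<close>, and
  \<open>f n\<close> from 1, by the same n steps, so Birkhoff's contraction compares them. The
  bounds for \<open>f k\<close> have quotient \<open>(harnack_const M)\<^sup>2\<close>; the third
  factor comes from turning the multiplicative error into an additive one, the ratios being at most
  \<open>harnack_const M\<close>.\<close>

lemma normalized_iterates_Cauchy:
  assumes M: "norm \<alpha> \<le> M" and n: "j * m \<le> n"
  defines "f \<equiv> \<lambda>n. tiltn \<alpha> n (\<lambda>x. 1)"
  shows "\<bar>f (n + k) x / f (n + k) y - f n x / f n y\<bar> \<le> (harnack_const M) ^ 3 * contraction M ^ j"
proof -
  let ?D = "harnack_const M"
  have M0: "0 \<le> M" using M norm_ge_zero[of \<alpha>] by linarith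
  note D = harnack_const_ge[OF M0]
  have fp: "0 < f n x" for n x unfolding f_def by (rule tiltn_one_pos)
  have fr: "f n x \<le> ?D * f n y" for n x y unfolding f_def by (rule tiltn_one_ratio[OF M])
  have fn: "tiltn \<alpha> n (\<lambda>x. 1) = f n" by (simp add: f_def)
  have add: "tiltn \<alpha> n (f k) = f (n + k)" by (simp add: f_def funpow_add)
  define e where "e = ?D\<^sup>2 * contraction M ^ j"
  have e0: "0 \<le> e" unfolding e_def using contraction_bounds(1)[OF M0] by simp
  have bf: "bdd_borel (f k)" unfolding f_def by (intro tiltn_bdd_borel) simp
  have "tiltn \<alpha> n (f k) u * tiltn \<alpha> n (\<lambda>x. 1) v \<le>
     (1 + (?D * f k x) / (f k x / ?D) * contraction M ^ j) * (tiltn \<alpha> n (f k) v * tiltn \<alpha> n (\<lambda>x. 1) u)" for u v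
    using fr[where y=x] fr[where x=x] fp[of k x] D
    by (intro birkhoff_ratio[OF bf bdd_borel_const zero_less_one _ _ _ _ M n]) (auto simp: field_simps)
  moreover have "(?D * f k x) / (f k x / ?D) * contraction M ^ j = e"
    using fp[of k x] D by (simp add: e_def power2_eq_square)
  ultimately have key: "f (n + k) u * f n v \<le> (1 + e) * (f (n + k) v * f n u)" for u v
    by (simp only: add fn)
  define P where "P = f (n + k) x / f (n + k) y"
  define Q where "Q = f n x / f n y"
  have PQ: "0 < P" "0 < Q" "P \<le> ?D" "Q \<le> ?D" using fp fr by (auto simp: pos_divide_le_eq P_def Q_def)
  have "P \<le> (1 + e) * Q" using key[of x y] fp[of n y] fp[of "n+k" y] by (simp add: field_simps P_def Q_def)
  moreover have "Q \<le> (1 + e) * P" using key[of y x] fp[of n y] fp[of "n+k" y] by (simp add: field_simps P_def Q_def)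
  moreover have "e * Q \<le> e * ?D" "e * P \<le> e * ?D" using PQ e0 by (simp_all add: mult_left_mono)
  ultimately have "\<bar>P - Q\<bar> \<le> e * ?D" by (simp add: algebra_simps abs_le_iff)
  then show ?thesis by (simp add: P_def Q_def e_def power2_eq_square power3_eq_cube algebra_simps)
qed

text \<open>Power iteration: the iterates of 1, divided by their value at a fixed state
  \<open>?z\<close>, converge to a limit \<open>r\<close> that lies between \<open>1 / ?D\<close>
  and \<open>?D\<close>. Since \<open>r\<close> equals 1 at \<open>?z\<close>, the eigenvalue can be
  read off as \<open>tilt \<alpha> r ?z\<close>.\<close>

lemma eigenpair_exists: "\<exists>h r. is_eigenpair p g \<alpha> h r"
proof -
  define f where "f = (\<lambda>n. tiltn \<alpha> n (\<lambda>x. 1))"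
  let ?D = "harnack_const (norm \<alpha>)" and ?z = "undefined :: 's"
  note D = harnack_const_ge[OF norm_ge_zero[of \<alpha>]]
  define q where "q = (\<lambda>n x. f n x / f n ?z)"
  have fp: "0 < f n x" for n x unfolding f_def by (rule tiltn_one_pos)
  have fr: "f n x \<le> ?D * f n y" for n x y unfolding f_def by (rule tiltn_one_ratio) simp
  have bf: "bdd_borel (f n)" for n unfolding f_def by (intro tiltn_bdd_borel) simp
  have [measurable]: "f n \<in> borel_measurable borel" for n using bf by (rule bdd_borel_measurable)
  have q: "0 < q n x" "q n x \<le> ?D" "1 / ?D \<le> q n x" for n x
    using fp[of n] fr[of n x ?z] fr[of n ?z x] D by (auto simp: q_def field_simps)
  have "Cauchy (\<lambda>n. q n x)" for x
  proof (rule metric_CauchyI)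
    fix \<epsilon> :: real assume \<epsilon>: "0 < \<epsilon>"
    have "(\<lambda>j. ?D ^ 3 * contraction (norm \<alpha>) ^ j) \<longlonglongrightarrow> ?D ^ 3 * 0"
      by (intro tendsto_intros LIMSEQ_realpow_zero contraction_bounds norm_ge_zero)
    then have "\<forall>\<^sub>F j in sequentially. ?D ^ 3 * contraction (norm \<alpha>) ^ j < \<epsilon> / 2"
      using \<epsilon> by (intro order_tendstoD) auto
    then obtain j where j: "?D ^ 3 * contraction (norm \<alpha>) ^ j < \<epsilon> / 2"
      by (auto simp: eventually_sequentially)
    have *: "\<bar>q n x - q (j * m) x\<bar> < \<epsilon> / 2" if "j * m \<le> n" for n
    proof -
      have "n = j * m + (n - j * m)" using that by simp
      then show ?thesis
        using normalized_iterates_Cauchy[of \<alpha> "norm \<alpha>" j "j * m" "n - j * m" x ?z] j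
        by (simp add: q_def f_def)
    qed
    show "\<exists>M. \<forall>n\<ge>M. \<forall>k\<ge>M. dist (q n x) (q k x) < \<epsilon>"
    proof (intro exI allI impI)
      fix n k assume "j * m \<le> n" "j * m \<le> k"
      from *[OF this(1)] *[OF this(2)] show "dist (q n x) (q k x) < \<epsilon>"
        unfolding dist_real_def by linarith
    qed
  qed
  then have "\<exists>l. (\<lambda>n. q n x) \<longlonglongrightarrow> l" for x
    using Cauchy_convergent_iff convergent_def by blast
  then obtain r where r: "\<And>x. (\<lambda>n. q n x) \<longlonglongrightarrow> r x" by metis
  have rmeas [measurable]: "r \<in> borel_measurable borel"
  proof (rule borel_measurable_LIMSEQ_real)
    show "(\<lambda>n. q n x) \<longlonglongrightarrow> r x" for x by (rule r)
    show "q n \<in> borel_measurable borel" for n unfolding q_def by measurable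
  qed
  have rb: "1 / ?D \<le> r x" "r x \<le> ?D" for x
    using LIMSEQ_le_const[OF r[of x], of "1 / ?D"] LIMSEQ_le_const2[OF r[of x], of ?D] q by auto
  have lim: "(\<lambda>n. tilt \<alpha> (q n) x) \<longlonglongrightarrow> tilt \<alpha> r x" for x
    unfolding tilt_def
  proof (rule integral_dominated_convergence[where w="\<lambda>_. exp (R * norm \<alpha>) * ?D"])
    interpret prob_space "p x" by (rule prob_space_p)
    show "integrable (p x) (\<lambda>_. exp (R * norm \<alpha>) * ?D)" by simp
    show "AE y in p x. (\<lambda>n. exp (\<alpha> \<bullet> g y) * q n y) \<longlonglongrightarrow> exp (\<alpha> \<bullet> g y) * r y"
      by (intro AE_I2 tendsto_intros r)
    show "AE y in p x. norm (exp (\<alpha> \<bullet> g y) * q n y) \<le> exp (R * norm \<alpha>) * ?D" for n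
      using q inner_g_le'[of \<alpha>]
      by (intro AE_I2) (auto simp: abs_mult less_imp_le abs_of_pos intro!: mult_mono)
  qed (auto simp: q_def)
  have step: "tilt \<alpha> (q n) x = f (Suc n) x / f n ?z" for n x
  proof -
    have "tilt \<alpha> (q n) x = (1 / f n ?z) * tilt \<alpha> (f n) x"
      using tilt_lin[OF bf bf, of \<alpha> "1 / f n ?z" n 0 n] by (simp add: q_def)
    then show ?thesis by (simp add: f_def)
  qed
  let ?l = "tilt \<alpha> r ?z"
  have "tilt \<alpha> r x = ?l * r x" for x
  proof (rule LIMSEQ_unique[OF lim])
    \<comment> \<open>Applying the operator to \<open>q n\<close> gives \<open>q (Suc n)\<close> up
      to the normalising factor, which is the value at \<open>?z\<close>. The eigenvalue equation is
      the limit of this identity.\<close>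
    have "(\<lambda>n. tilt \<alpha> (q n) ?z * q (Suc n) x) \<longlonglongrightarrow> ?l * r x"
      by (intro tendsto_intros lim LIMSEQ_Suc r)
    moreover have "tilt \<alpha> (q n) ?z * q (Suc n) x = tilt \<alpha> (q n) x" for n
      using fp[of "Suc n" ?z] fp[of n ?z] unfolding step by (simp add: q_def)
    ultimately show "(\<lambda>n. tilt \<alpha> (q n) x) \<longlonglongrightarrow> ?l * r x" by simp
  qed
  moreover have "0 < ?l"
  proof -
    have rpos: "0 < 1 / ?D" using D by simp
    then have "0 < r x" for x using rb(1)[of x] by linarith
    then have "bdd_borel r" using rb(2) by (intro bdd_borelI[of _ ?D] rmeas) (simp add: abs_of_pos)
    have "0 < exp (- (R * norm \<alpha>)) * (1 / ?D)" using rpos by simp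
    also have "\<dots> \<le> ?l" by (rule tilt_pos[OF \<open>bdd_borel r\<close> rpos rb(1)])
    finally show ?thesis .
  qed
  \<comment> \<open>\<open>is_eigenpair\<close> demands strictly different bounds, while
    \<open>1 / ?D\<close> and \<open>?D\<close> can coincide; hence the upper bound
    \<open>?D + 1\<close>.\<close>
  moreover have "0 < 1 / ?D" "1 / ?D \<le> 1" "1 < ?D + 1" using D by auto
  moreover have "r x \<le> ?D + 1" for x using rb(2)[of x] by simp
  ultimately obtain l C where "0 < l" "\<And>x. tilt \<alpha> r x = l * r x" "1 / ?D < C" "0 < 1 / ?D" "\<And>x. r x \<le> C"
    by (metis order_le_less_trans)
  then have "is_eigenpair p g \<alpha> (ln l) r"
    unfolding is_eigenpair_def using rb(1) rmeas
    by (intro conjI exI[of _ "1 / ?D"] exI[of _ C] allI) (simp_all add: tilt_def)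
  then show ?thesis by blast
qed

subsection \<open>Uniqueness of the eigenvalue\<close>

text \<open>Under iteration the subsolution \<open>r\<close> grows at least like
  \<open>exp (n * l)\<close> and the supersolution \<open>f\<close> at most like
  \<open>exp (n * \<mu>)\<close>. As \<open>r\<close> is at most a constant times \<open>f\<close>,
  the case \<open>l > \<mu>\<close> fails for large n.\<close>

lemma growth_compare:
  assumes f: "bdd_borel f" "0 < c" "\<And>x. c \<le> f x" "\<And>x. tilt \<alpha> f x \<le> exp \<mu> * f x"
    and r: "bdd_borel r" "0 < d" "\<And>x. d \<le> r x" "\<And>x. exp l * r x \<le> tilt \<alpha> r x"
  shows "l \<le> \<mu>"
proof (rule ccontr)
  assume "\<not> l \<le> \<mu>"
  obtain z :: 's where True by simp
  obtain B where B: "\<And>x. \<bar>r x\<bar> \<le> B" using r(1) by (auto simp: bdd_borel_def)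
  have B0: "0 < B" using B[of z] r(2) r(3)[of z] by auto
  have up: "tiltn \<alpha> n f x \<le> exp (n * \<mu>) * f x" for n x
  proof (induction n arbitrary: x)
    case (Suc n)
    have "tiltn \<alpha> (Suc n) f x \<le> tilt \<alpha> (\<lambda>x. exp (n * \<mu>) * f x) x"
      unfolding funpow.simps o_def by (intro tilt_mono tiltn_bdd_borel bdd_borel_scale f Suc)
    also have "\<dots> = exp (n * \<mu>) * tilt \<alpha> f x" using tiltn_scale[OF f(1), of 1] by simp
    also have "\<dots> \<le> exp (n * \<mu>) * (exp \<mu> * f x)" using f(4) by simp
    finally show ?case by (simp add: exp_add algebra_simps)
  qed simp
  have lo: "exp (n * l) * r x \<le> tiltn \<alpha> n r x" for n x
  proof (induction n arbitrary: x)
    case (Suc n)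
    have "exp (n * l) * (exp l * r x) \<le> exp (n * l) * tilt \<alpha> r x" using r(4) by simp
    also have "\<dots> = tilt \<alpha> (\<lambda>x. exp (n * l) * r x) x" using tiltn_scale[OF r(1), of 1] by simp
    also have "\<dots> \<le> tiltn \<alpha> (Suc n) r x"
      unfolding funpow.simps o_def by (intro tilt_mono tiltn_bdd_borel bdd_borel_scale r Suc)
    finally show ?case by (simp add: exp_add algebra_simps)
  qed simp
  have rf: "r x \<le> B / c * f x" for x
  proof -
    have "r x \<le> B / c * c" using B[of x] f(2) by simp
    also have "\<dots> \<le> B / c * f x" using B0 f(2) f(3)[of x] by (intro mult_left_mono) auto
    finally show ?thesis .
  qed
  have "exp (n * (l - \<mu>)) \<le> B / c * f z / r z" for n :: nat
  proof -
    have "exp (n * l) * r z \<le> tiltn \<alpha> n r z" by (rule lo)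
    also have "\<dots> \<le> tiltn \<alpha> n (\<lambda>x. B / c * f x) z"
      by (intro tiltn_mono r bdd_borel_scale f rf)
    also have "\<dots> = B / c * tiltn \<alpha> n f z"
      by (simp only: tiltn_scale[OF f(1)])
    also have "\<dots> \<le> B / c * (exp (n * \<mu>) * f z)"
      using up[of n z] B0 f(2) by (intro mult_left_mono) auto
    finally have "exp (n * l) * r z \<le> B / c * (exp (n * \<mu>) * f z)" .
    then have "exp (n * l) * r z \<le> exp (n * \<mu>) * (B / c * f z)" by (simp add: algebra_simps)
    moreover have "exp (n * l) = exp (n * \<mu>) * exp (n * (l - \<mu>))"
      by (simp add: algebra_simps flip: exp_add)
    ultimately have "exp (n * \<mu>) * (exp (n * (l - \<mu>)) * r z) \<le> exp (n * \<mu>) * (B / c * f z)"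
      by (simp only: mult.assoc)
    then have "exp (n * (l - \<mu>)) * r z \<le> B / c * f z" by (rule mult_left_le_imp_le) simp
    moreover have "0 < r z" using r(2) r(3)[of z] by simp
    ultimately show ?thesis by (simp only: pos_le_divide_eq)
  qed
  moreover have "filterlim (\<lambda>n. exp (real n * (l - \<mu>))) at_top sequentially"
  proof (rule filterlim_compose[OF exp_at_top])
    show "filterlim (\<lambda>n. real n * (l - \<mu>)) at_top sequentially"
      using \<open>\<not> l \<le> \<mu>\<close>
      by (intro filterlim_at_top_mult_tendsto_pos[OF tendsto_const]) (auto intro: filterlim_real_sequentially)
  qed
  then have "\<forall>\<^sub>F n in sequentially. B / c * f z / r z < exp (real n * (l - \<mu>))"
    by (simp add: filterlim_at_top_dense)
  then obtain n where "B / c * f z / r z < exp (real n * (l - \<mu>))"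
    by (auto simp: eventually_sequentially)
  ultimately show False by (meson not_le)
qed

lemma eigenpair_facts:
  assumes "is_eigenpair p g \<alpha> h r"
  shows "bdd_borel r" "\<exists>c>0. \<forall>x. c \<le> r x" "tilt \<alpha> r x = exp h * r x"
proof -
  from assms obtain c C where c: "r \<in> borel_measurable borel" "0 < c" "\<And>x. c \<le> r x" "\<And>x. r x \<le> C"
    by (auto simp: is_eigenpair_def)
  have "\<bar>r x\<bar> \<le> C" for x using c(2) c(3)[of x] c(4)[of x] by auto
  then show "bdd_borel r" "\<exists>c>0. \<forall>x. c \<le> r x" "tilt \<alpha> r x = exp h * r x"
    using c assms by (auto intro!: bdd_borelI simp: is_eigenpair_def tilt_def)
qed

lemma eigenvalue_unique:
  assumes "is_eigenpair p g \<alpha> h r" "is_eigenpair p g \<alpha> h' r'"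
  shows "h = h'"
proof -
  have "h \<le> h'" if "is_eigenpair p g \<alpha> h r" "is_eigenpair p g \<alpha> h' r'" for h r h' r'
  proof -
    note t = that
    obtain c c' where "0 < c" "\<And>x. c \<le> r x" "0 < c'" "\<And>x. c' \<le> r' x"
      using eigenpair_facts(2)[OF t(1)] eigenpair_facts(2)[OF t(2)] by auto
    then show ?thesis
      using eigenpair_facts(1,3)[OF t(1)] eigenpair_facts(1,3)[OF t(2)]
      by (intro growth_compare[of r' c' \<alpha> h' r c h]) auto
  qed
  from this[OF assms] this[OF assms(2,1)] show ?thesis by simp
qed

abbreviation "H \<equiv> eig_H p g"
abbreviation "r\<^sub>0 \<equiv> eig_r p g"

lemma eigenpair: "is_eigenpair p g \<alpha> (H \<alpha>) (r\<^sub>0 \<alpha>)"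
proof -
  have "\<exists>!h. \<exists>r. is_eigenpair p g \<alpha> h r"
    using eigenpair_exists[of \<alpha>] eigenvalue_unique by blast
  then have "\<exists>r. is_eigenpair p g \<alpha> (H \<alpha>) r"
    unfolding eig_H_def by (rule theI')
  then show ?thesis unfolding eig_r_def by (rule someI_ex)
qed

lemmas r_bdd_borel = eigenpair_facts(1)[OF eigenpair]
  and tilt_r = eigenpair_facts(3)[OF eigenpair]

lemma r_lower: "\<exists>c>0. \<forall>x. c \<le> r\<^sub>0 \<alpha> x"
  by (rule eigenpair_facts(2)[OF eigenpair])

lemma r_pos: "0 < r\<^sub>0 \<alpha> x"
  using r_lower[of \<alpha>] less_le_trans by blast

lemma tiltn_r: "tiltn \<alpha> n (r\<^sub>0 \<alpha>) = (\<lambda>x. exp (n * H \<alpha>) * r\<^sub>0 \<alpha> x)"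
proof (induction n)
  case (Suc n)
  then show ?case
    using tiltn_scale[OF r_bdd_borel[of \<alpha>], of 1 \<alpha> "exp (n * H \<alpha>)"]
    by (simp add: tilt_r exp_add algebra_simps)
qed simp

text \<open>Any positive supersolution bounds the eigenvalue from above. Both the Lipschitz bound
  and the convexity of \<open>H\<close> are obtained by exhibiting one.\<close>

lemma H_le:
  assumes "bdd_borel f" "0 < c" "\<And>x. c \<le> f x" "\<And>x. tilt \<alpha> f x \<le> exp \<mu> * f x"
  shows "H \<alpha> \<le> \<mu>"
proof -
  obtain d where d: "d > 0" "\<And>x. d \<le> r\<^sub>0 \<alpha> x" using r_lower by blast
  show ?thesis by (rule growth_compare[OF assms r_bdd_borel d]) (simp add: tilt_r)
qed

subsection \<open>Regularity of the eigenvalue and the eigenfunction in the parameter\<close>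

lemma H_lipschitz: "H \<alpha> \<le> H \<beta> + R * norm (\<alpha> - \<beta>)"
proof -
  obtain d where d: "d > 0" "\<And>x. d \<le> r\<^sub>0 \<beta> x" using r_lower by blast
  show ?thesis
  proof (rule H_le[OF r_bdd_borel d])
    fix x
    show "tilt \<alpha> (r\<^sub>0 \<beta>) x \<le> exp (H \<beta> + R * norm (\<alpha> - \<beta>)) * r\<^sub>0 \<beta> x"
      using tilt_change[OF r_bdd_borel less_imp_le[OF r_pos], of \<alpha> \<beta> x \<beta>]
      by (simp add: tilt_r exp_add algebra_simps)
  qed
qed

lemma H_continuous: "continuous_on UNIV H"
proof (rule continuous_onI)
  fix \<alpha> :: "real^'d" and e :: real assume "0 < e"
  show "\<exists>d>0. \<forall>\<beta>\<in>UNIV. dist \<beta> \<alpha> < d \<longrightarrow> dist (H \<beta>) (H \<alpha>) \<le> e"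
  proof (intro exI[of _ "e / (R + 1)"] conjI ballI impI)
    show "0 < e / (R + 1)" using \<open>0 < e\<close> R_nonneg by simp
    fix \<beta> assume "dist \<beta> \<alpha> < e / (R + 1)"
    then have "(R + 1) * norm (\<beta> - \<alpha>) \<le> e"
      using R_nonneg by (simp add: dist_norm field_simps)
    then have "R * norm (\<beta> - \<alpha>) \<le> e"
      using norm_ge_zero[of "\<beta> - \<alpha>"] by (simp only: distrib_right)
    then show "dist (H \<beta>) (H \<alpha>) \<le> e"
      using H_lipschitz[of \<alpha> \<beta>] H_lipschitz[of \<beta> \<alpha>]
      by (simp add: dist_real_def abs_le_iff norm_minus_commute)
  qed
qed

lemma H_measurable [measurable]: "H \<in> borel_measurable borel"
  by (rule borel_measurable_continuous_onI[OF H_continuous])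

lemma H_zero [simp]: "H 0 = 0"
proof -
  have "is_eigenpair p g 0 0 (\<lambda>x. 1)"
    unfolding is_eigenpair_def
    by (intro conjI, simp, rule exI[of _ 1], rule exI[of _ 2], simp_all)
  from eigenvalue_unique[OF eigenpair this] show ?thesis .
qed

lemma exp_jensen:
  fixes \<rho> :: "'b \<Rightarrow> real"
  assumes "finite F" "\<And>a. a \<in> F \<Longrightarrow> 0 \<le> \<rho> a" "sum \<rho> F = 1"
  shows "exp (\<Sum>a\<in>F. \<rho> a * u a) \<le> (\<Sum>a\<in>F. \<rho> a * exp (u a))"
proof -
  have "F \<noteq> {}" using assms(3) by auto
  from convex_on_sum[OF assms(1) this exp_convex assms(3,2), where y=u]
  show ?thesis by simp
qed

text \<open>The geometric mean of the eigenfunctions with weights \<open>\<rho>\<close> is a supersolution at the averaged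
  parameter, by Jensen's inequality for \<open>exp\<close>.\<close>

lemma H_jensen:
  assumes F: "finite F" and \<rho>: "\<And>a. a \<in> F \<Longrightarrow> 0 \<le> \<rho> a" "sum \<rho> F = 1"
  shows "H (\<Sum>a\<in>F. \<rho> a *\<^sub>R a) \<le> (\<Sum>a\<in>F. \<rho> a * H a)"
proof -
  let ?\<gamma> = "\<Sum>a\<in>F. \<rho> a *\<^sub>R a"
  define f where "f = (\<lambda>x. exp (\<Sum>a\<in>F. \<rho> a * ln (r\<^sub>0 a x)))"
  obtain c where c: "\<And>a. 0 < c a" "\<And>a x. c a \<le> r\<^sub>0 a x" using r_lower by metis
  have "\<exists>B. \<forall>x. \<bar>r\<^sub>0 a x\<bar> \<le> B" for a using r_bdd_borel[of a] by (simp add: bdd_borel_def)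
  then obtain B where B: "\<And>a x. \<bar>r\<^sub>0 a x\<bar> \<le> B a" by metis
  have [measurable]: "r\<^sub>0 a \<in> borel_measurable borel" for a using r_bdd_borel by (rule bdd_borel_measurable)
  have flow: "exp (\<Sum>a\<in>F. \<rho> a * ln (c a)) \<le> f x" for x
    unfolding f_def using \<rho>(1) c r_pos by (auto intro!: sum_mono mult_left_mono)
  have "\<bar>f x\<bar> \<le> (\<Sum>a\<in>F. \<rho> a * B a)" for x
  proof -
    have "f x \<le> (\<Sum>a\<in>F. \<rho> a * exp (ln (r\<^sub>0 a x)))"
      unfolding f_def by (rule exp_jensen[OF F \<rho>])
    also have "\<dots> \<le> (\<Sum>a\<in>F. \<rho> a * B a)"
      using \<rho>(1) B r_pos by (intro sum_mono mult_left_mono) (auto simp: abs_le_iff)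
    finally show ?thesis by (simp add: f_def)
  qed
  moreover have "f \<in> borel_measurable borel" unfolding f_def by measurable
  ultimately have bf: "bdd_borel f" by (intro bdd_borelI)
  show ?thesis
  proof (rule H_le[OF bf _ flow])
    fix x
    \<comment> \<open>These weights normalise each summand by the eigenvalue equation at
      \<open>x\<close>, so that the summand of \<open>a\<close> integrates to
      \<open>\<rho> a\<close> and the total is 1.\<close>
    let ?w = "\<lambda>a. \<rho> a / (r\<^sub>0 a x * exp (H a))"
    let ?K = "exp (\<Sum>a\<in>F. \<rho> a * H a) * f x"
    have int: "integrable (p x) (\<lambda>y. exp (a \<bullet> g y) * r\<^sub>0 a y)" for a
      by (rule tilt_integrable[OF r_bdd_borel])
    have pt: "exp (?\<gamma> \<bullet> g y) * f y \<le> ?K * (\<Sum>a\<in>F. ?w a * (exp (a \<bullet> g y) * r\<^sub>0 a y))" for y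
    proof -
      let ?u = "\<lambda>a. a \<bullet> g y + ln (r\<^sub>0 a y) - ln (r\<^sub>0 a x) - H a"
      have "exp (?\<gamma> \<bullet> g y) * f y = ?K * exp (\<Sum>a\<in>F. \<rho> a * ?u a)"
        unfolding f_def
        by (simp add: inner_sum_left algebra_simps sum.distrib sum_subtractf flip: exp_add)
      also have "\<dots> \<le> ?K * (\<Sum>a\<in>F. \<rho> a * exp (?u a))"
        by (intro mult_left_mono exp_jensen F \<rho>) (auto simp: f_def)
      also have "(\<Sum>a\<in>F. \<rho> a * exp (?u a)) = (\<Sum>a\<in>F. ?w a * (exp (a \<bullet> g y) * r\<^sub>0 a y))"
        by (intro sum.cong) (auto simp: exp_diff exp_add r_pos field_simps)
      finally show ?thesis .
    qed
    have "tilt ?\<gamma> f x \<le> (\<integral>y. ?K * (\<Sum>a\<in>F. ?w a * (exp (a \<bullet> g y) * r\<^sub>0 a y)) \<partial>p x)"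
      unfolding tilt_def
      by (intro integral_mono tilt_integrable bf pt integrable_mult_right Bochner_Integration.integrable_sum int)
    also have "\<dots> = ?K * (\<Sum>a\<in>F. ?w a * tilt a (r\<^sub>0 a) x)"
      using int by (simp add: tilt_def integrable_mult_right)
    also have "(\<Sum>a\<in>F. ?w a * tilt a (r\<^sub>0 a) x) = (\<Sum>a\<in>F. \<rho> a)"
      using r_pos[of _ x] by (intro sum.cong) (auto simp: tilt_r less_imp_neq[symmetric])
    finally show "tilt ?\<gamma> f x \<le> exp (\<Sum>a\<in>F. \<rho> a * H a) * f x" by (simp add: \<rho>)
  qed simp
qed

text \<open>An eigenfunction is a multiple of its own m-th iterate.\<close>

lemma r_harnack:
  assumes "norm \<alpha> \<le> M" shows "r\<^sub>0 \<alpha> x \<le> harnack_const M * r\<^sub>0 \<alpha> y"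
proof -
  have "tiltn \<alpha> m (r\<^sub>0 \<alpha>) x \<le> harnack_const M * tiltn \<alpha> m (r\<^sub>0 \<alpha>) y"
    by (rule tiltn_harnack[OF r_bdd_borel less_imp_le[OF r_pos] assms])
  then show ?thesis by (simp add: tiltn_r)
qed

text \<open>Iterates of 1 depend on \<alpha> in an explicit way, unlike the chosen eigenfunction.
  This bound, uniform over norms up to \<open>M\<close>, transfers their continuity and
  measurability in \<alpha> to the ratios of \<open>eig_r\<close>.\<close>

lemma r_approx:
  assumes M: "norm \<alpha> \<le> M" and n: "j * m \<le> n"
  shows "r\<^sub>0 \<alpha> x * tiltn \<alpha> n (\<lambda>x. 1) y \<le>
    (1 + (harnack_const M)\<^sup>2 * contraction M ^ j) * (r\<^sub>0 \<alpha> y * tiltn \<alpha> n (\<lambda>x. 1) x)"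
proof -
  have M0: "0 \<le> M" using M norm_ge_zero[of \<alpha>] by linarith
  note D = harnack_const_ge[OF M0] and rp = r_pos[of \<alpha> y]
  have "tiltn \<alpha> n (r\<^sub>0 \<alpha>) x * tiltn \<alpha> n (\<lambda>x. 1) y \<le>
    (1 + (harnack_const M * r\<^sub>0 \<alpha> y) / (r\<^sub>0 \<alpha> y / harnack_const M) * contraction M ^ j) * (tiltn \<alpha> n (r\<^sub>0 \<alpha>) y * tiltn \<alpha> n (\<lambda>x. 1) x)"
    using r_harnack[OF M, where y=y] r_harnack[OF M, where x=y] r_pos[of \<alpha>] D
    by (intro birkhoff_ratio[OF r_bdd_borel bdd_borel_const zero_less_one _ _ _ _ M n]) (auto simp: field_simps)
  moreover have "(harnack_const M * r\<^sub>0 \<alpha> y) / (r\<^sub>0 \<alpha> y / harnack_const M) = (harnack_const M)\<^sup>2"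
    using rp D by (simp add: power2_eq_square)
  ultimately have "exp (n * H \<alpha>) * (r\<^sub>0 \<alpha> x * tiltn \<alpha> n (\<lambda>x. 1) y) \<le>
    exp (n * H \<alpha>) * ((1 + (harnack_const M)\<^sup>2 * contraction M ^ j) * (r\<^sub>0 \<alpha> y * tiltn \<alpha> n (\<lambda>x. 1) x))"
    by (simp add: tiltn_r mult.assoc mult.left_commute)
  then show ?thesis by (rule mult_left_le_imp_le) simp
qed

lemma contraction_tendsto:
  assumes "0 \<le> M"
  shows "(\<lambda>j. K * contraction M ^ j) \<longlonglongrightarrow> 0"
proof -
  have "(\<lambda>j. K * contraction M ^ j) \<longlonglongrightarrow> K * 0"
    by (intro tendsto_intros LIMSEQ_realpow_zero contraction_bounds assms)
  then show ?thesis by simp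
qed

text \<open>Four errors of \<tau> / 4 each: two from replacing eigenfunctions by iterates of 1, at
  \<alpha> and at \<beta>, and two from changing the parameter in numerator and denominator. The
  number of steps is fixed first, and \<delta> after it.\<close>

lemma r_ratio_continuous:
  assumes M: "0 \<le> M" and \<tau>: "0 < \<tau>"
  shows "\<exists>\<delta>>0. \<forall>\<alpha> \<beta> x y. norm \<alpha> \<le> M \<longrightarrow> norm \<beta> \<le> M \<longrightarrow> norm (\<alpha> - \<beta>) \<le> \<delta> \<longrightarrow>
    r\<^sub>0 \<alpha> x / r\<^sub>0 \<alpha> y \<le> exp \<tau> * (r\<^sub>0 \<beta> x / r\<^sub>0 \<beta> y)"
proof -
  have "\<forall>\<^sub>F j in sequentially. (harnack_const M)\<^sup>2 * contraction M ^ j < \<tau> / 4"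
    using \<tau> by (intro order_tendstoD[OF contraction_tendsto] M) auto
  then obtain j where j: "(harnack_const M)\<^sup>2 * contraction M ^ j < \<tau> / 4" by (auto simp: eventually_sequentially)
  define n where "n = j * m"
  define e where "e = 1 + (harnack_const M)\<^sup>2 * contraction M ^ j"
  have "e \<le> 1 + \<tau> / 4" using j unfolding e_def by linarith
  then have e: "1 \<le> e" "e \<le> exp (\<tau> / 4)"
    using exp_ge_add_one_self[of "\<tau> / 4"] contraction_bounds(1)[OF M]
    by (simp add: e_def, linarith)
  \<comment> \<open>A change of parameter costs a factor \<open>exp (n * R * \<delta>)\<close> over
    n steps; the added 1 keeps the denominator positive when \<open>n * R\<close> vanishes.\<close>
  define \<delta> where "\<delta> = \<tau> / (4 * (n * R + 1))"
  have nR: "0 \<le> n * R" using R_nonneg by simp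
  have \<delta>: "0 < \<delta>" "n * R * \<delta> \<le> \<tau> / 4" using \<tau> nR by (auto simp: \<delta>_def field_simps)
  have "r\<^sub>0 \<alpha> x / r\<^sub>0 \<alpha> y \<le> exp \<tau> * (r\<^sub>0 \<beta> x / r\<^sub>0 \<beta> y)"
    if ab: "norm \<alpha> \<le> M" "norm \<beta> \<le> M" "norm (\<alpha> - \<beta>) \<le> \<delta>" for \<alpha> \<beta> x y
  proof -
    let ?f = "\<lambda>\<alpha>. tiltn \<alpha> n (\<lambda>x. 1)" and ?q = "exp (\<tau> / 4)"
    have fp: "0 < ?f \<alpha> x" for \<alpha> x by (rule tiltn_one_pos)
    have ch: "?f \<alpha> x \<le> ?q * ?f \<beta> x" if "norm (\<alpha> - \<beta>) \<le> \<delta>" for \<alpha> \<beta> x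
    proof -
      have "n * R * norm (\<alpha> - \<beta>) \<le> n * R * \<delta>" by (intro mult_left_mono that nR)
      with \<delta> have "exp (n * R * norm (\<alpha> - \<beta>)) \<le> ?q" by simp
      then have "exp (n * R * norm (\<alpha> - \<beta>)) * ?f \<beta> x \<le> ?q * ?f \<beta> x"
        by (rule mult_right_mono) (rule less_imp_le[OF fp])
      moreover have "?f \<alpha> x \<le> exp (n * R * norm (\<alpha> - \<beta>)) * ?f \<beta> x"
        by (rule tiltn_change) auto
      ultimately show ?thesis by (rule order_trans[rotated])
    qed
    have "r\<^sub>0 \<alpha> x / r\<^sub>0 \<alpha> y \<le> e * (?f \<alpha> x / ?f \<alpha> y)"
      using r_approx[OF ab(1), of j n x y] fp[of \<alpha> y] r_pos[of \<alpha> y]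
      by (simp add: n_def e_def field_simps)
    also have "\<dots> \<le> e * ((?q * ?f \<beta> x) / (?f \<beta> y / ?q))"
    proof (intro mult_left_mono frac_le)
      show "?f \<beta> y / ?q \<le> ?f \<alpha> y"
        using ch[of \<beta> \<alpha> y] ab(3) by (simp add: norm_minus_commute field_simps)
    qed (use ch[OF ab(3)] fp e in \<open>auto intro: less_imp_le\<close>)
    also have "\<dots> = (e * ?q * ?q) * (?f \<beta> x / ?f \<beta> y)" by simp
    also have "\<dots> \<le> (e * ?q * ?q) * (e * (r\<^sub>0 \<beta> x / r\<^sub>0 \<beta> y))"
    proof (rule mult_left_mono)
      show "?f \<beta> x / ?f \<beta> y \<le> e * (r\<^sub>0 \<beta> x / r\<^sub>0 \<beta> y)"
        using r_approx[OF ab(2), of j n y x] fp[of \<beta> y] r_pos[of \<beta> y]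
        by (simp add: n_def e_def field_simps)
    qed (use e in auto)
    also have "\<dots> = (e * e * (?q * ?q)) * (r\<^sub>0 \<beta> x / r\<^sub>0 \<beta> y)" by simp
    also have "\<dots> \<le> (?q * ?q * (?q * ?q)) * (r\<^sub>0 \<beta> x / r\<^sub>0 \<beta> y)"
      using e r_pos[of \<beta> x] r_pos[of \<beta> y] by (intro mult_right_mono mult_mono) auto
    also have "?q * ?q * (?q * ?q) = exp \<tau>" by (simp flip: exp_add)
    finally show ?thesis .
  qed
  with \<delta>(1) show ?thesis by blast
qed

lemma tiltn_one_measurable:
  "(\<lambda>(\<alpha>, x). tiltn \<alpha> n (\<lambda>x. 1) x) \<in> borel_measurable (borel \<Otimes>\<^sub>M borel)"
proof (induction n)
  case (Suc n)
  note [measurable] = this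
  have "tiltn \<alpha> (Suc n) (\<lambda>x. 1) x =
    enn2real (\<integral>\<^sup>+y. ennreal (exp (\<alpha> \<bullet> g y) * tiltn \<alpha> n (\<lambda>x. 1) y) \<partial>p x)" for \<alpha> x
    using tilt_nn_integral[of "tiltn \<alpha> n (\<lambda>x. 1)" x \<alpha>] less_imp_le[OF tiltn_one_pos[of "Suc n" \<alpha> x]]
    by (simp add: tiltn_bdd_borel less_imp_le tiltn_one_pos)
  moreover have "(\<lambda>z::(real^'d) \<times> 's. \<integral>\<^sup>+y. ennreal (exp (fst z \<bullet> g y) * tiltn (fst z) n (\<lambda>x. 1) y) \<partial>p (snd z))
      \<in> borel_measurable (borel \<Otimes>\<^sub>M borel)"
    by (rule nn_integral_measurable_subprob_algebra2[where N=borel]) measurable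
  ultimately show ?case by (simp add: case_prod_beta')
qed simp

lemma r_ratio_measurable [measurable]:
  "(\<lambda>(\<alpha>, x, y). r\<^sub>0 \<alpha> x / r\<^sub>0 \<alpha> y) \<in> borel_measurable (borel \<Otimes>\<^sub>M (borel \<Otimes>\<^sub>M borel))"
proof (rule borel_measurable_LIMSEQ_real)
  let ?f = "\<lambda>j \<alpha>. tiltn \<alpha> (j * m) (\<lambda>x. 1)"
  note [measurable] = tiltn_one_measurable
  show "(\<lambda>(\<alpha>, x, y). ?f j \<alpha> x / ?f j \<alpha> y) \<in> borel_measurable (borel \<Otimes>\<^sub>M (borel \<Otimes>\<^sub>M borel))" for j
    by measurable
  have "(\<lambda>j. ?f j \<alpha> x / ?f j \<alpha> y) \<longlonglongrightarrow> r\<^sub>0 \<alpha> x / r\<^sub>0 \<alpha> y" for \<alpha> x y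
  proof (rule tendsto_sandwich)
    let ?q = "r\<^sub>0 \<alpha> x / r\<^sub>0 \<alpha> y"
    let ?e = "\<lambda>j. 1 + (harnack_const (norm \<alpha>))\<^sup>2 * contraction (norm \<alpha>) ^ j"
    have e: "0 < ?e j" for j
      using contraction_bounds(1)[OF norm_ge_zero[of \<alpha>]] by (simp add: add_pos_nonneg)
    have fp: "0 < ?f j \<alpha> x" for j x by (rule tiltn_one_pos)
    have swap: "a / b \<le> e * (c / d)" if "a * d \<le> e * (b * c)" "0 < b" "0 < d" for a b c d e :: real
      using that by (simp add: field_simps)
    have "?q \<le> ?e j * (?f j \<alpha> x / ?f j \<alpha> y)" for j
      by (intro swap r_approx r_pos fp) auto
    then show "\<forall>\<^sub>F j in sequentially. ?q / ?e j \<le> ?f j \<alpha> x / ?f j \<alpha> y"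
      using e by (intro always_eventually allI) (simp only: pos_divide_le_eq mult.commute)
    have "?f j \<alpha> x * r\<^sub>0 \<alpha> y \<le> ?e j * (?f j \<alpha> y * r\<^sub>0 \<alpha> x)" for j
      using r_approx[of \<alpha> "norm \<alpha>" j "j * m" y x] by (simp only: mult.commute order_refl)
    then show "\<forall>\<^sub>F j in sequentially. ?f j \<alpha> x / ?f j \<alpha> y \<le> ?e j * ?q"
      by (intro always_eventually allI swap r_pos fp)
    have "(\<lambda>j. ?q / ?e j) \<longlonglongrightarrow> ?q / (1 + 0)"
      by (intro tendsto_intros contraction_tendsto) auto
    then show "(\<lambda>j. ?q / ?e j) \<longlonglongrightarrow> ?q" by simp
    have "(\<lambda>j. ?e j * ?q) \<longlonglongrightarrow> (1 + 0) * ?q"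
      by (intro tendsto_intros contraction_tendsto) auto
    then show "(\<lambda>j. ?e j * ?q) \<longlonglongrightarrow> ?q" by simp
  qed
  then show "(\<lambda>j. (case z of (\<alpha>, x, y) \<Rightarrow> ?f j \<alpha> x / ?f j \<alpha> y)) \<longlonglongrightarrow> (case z of (\<alpha>, x, y) \<Rightarrow> r\<^sub>0 \<alpha> x / r\<^sub>0 \<alpha> y)" for z
    by (simp add: case_prod_beta')
qed

text \<open>Boundedness of the eigenfunction compares its iterates, which are known exactly, with
  those of 1. This supplies the growth of the exponential moments that \<open>epi_dual\<close>
  contradicts.\<close>

lemma moment_lower: "\<exists>k>0. \<forall>n x. k * exp (n * H \<alpha>) \<le> tiltn \<alpha> n (\<lambda>x. 1) x"
proof -
  obtain c where c: "c > 0" "\<And>x. c \<le> r\<^sub>0 \<alpha> x" using r_lower by blast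
  obtain B where B: "\<And>x. \<bar>r\<^sub>0 \<alpha> x\<bar> \<le> B" using r_bdd_borel[of \<alpha>] by (auto simp: bdd_borel_def)
  have B0: "0 < B" using B[of undefined] r_pos[of \<alpha> undefined] by auto
  have "c / B * exp (n * H \<alpha>) \<le> tiltn \<alpha> n (\<lambda>x. 1) x" for n x
  proof -
    have "exp (n * H \<alpha>) * c \<le> exp (n * H \<alpha>) * r\<^sub>0 \<alpha> x" using c by simp
    also have "\<dots> = tiltn \<alpha> n (r\<^sub>0 \<alpha>) x" by (simp add: tiltn_r)
    also have "\<dots> \<le> tiltn \<alpha> n (\<lambda>x. B * 1) x"
      using B by (intro tiltn_mono r_bdd_borel bdd_borel_const) (auto simp: abs_le_iff)
    also have "\<dots> = B * tiltn \<alpha> n (\<lambda>x. 1) x" by (simp only: tiltn_scale[OF bdd_borel_const])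
    finally show ?thesis using B0 by (simp add: field_simps)
  qed
  then show ?thesis using c B0 by (intro exI[of _ "c / B"]) auto
qed

end

text \<open>The subtracted 1 absorbs the rounding down of \<open>u * n\<close> in
  \<open>convex_epi\<close>; elsewhere it is slack.\<close>

lemma eventually_linear_ge:
  fixes c Z :: real
  assumes "0 < c" shows "\<forall>\<^sub>F n in sequentially. Z \<le> c * real n - 1"
  using eventually_ge_at_top[of "nat \<lceil>(Z + 1) / c\<rceil>"]
proof eventually_elim
  case (elim n)
  then have "(Z + 1) / c \<le> real n" by linarith
  then show ?case using assms by (simp add: field_simps)
qed

context bounded_chain
begin

subsection \<open>Lower large deviation bound\<close>

text \<open>\<open>walk n f x v\<close> is the expectation of \<open>f (v + g Y\<^sub>1 + \<dots> + g Y\<^sub>n)\<close> for the chain started at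
  \<open>Y\<^sub>0 = x\<close>.\<close>

primrec walk :: "nat \<Rightarrow> (real^'d \<Rightarrow> ennreal) \<Rightarrow> 's \<Rightarrow> real^'d \<Rightarrow> ennreal" where
  "walk 0 f x v = f v"
| "walk (Suc n) f x v = (\<integral>\<^sup>+y. walk n f y (v + g y) \<partial>p x)"

lemma walk_measurable [measurable]:
  assumes [measurable]: "f \<in> borel_measurable borel"
  shows "(\<lambda>(x, v). walk n f x v) \<in> borel_measurable (borel \<Otimes>\<^sub>M borel)"
proof (induction n)
  case (Suc n)
  note [measurable] = this
  have "(\<lambda>z::'s \<times> (real^'d). \<integral>\<^sup>+y. walk n f y (snd z + g y) \<partial>p (fst z))
      \<in> borel_measurable (borel \<Otimes>\<^sub>M borel)"
    by (rule nn_integral_measurable_subprob_algebra2[where N=borel]) measurable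
  then show ?case by (simp add: case_prod_beta')
qed simp

text \<open>Each increment has norm at most \<open>R\<close>, so only points within distance
  \<open>n * R\<close> of \<open>v\<close> can be reached.\<close>

lemma walk_mono:
  assumes "\<And>w. norm (w - v) \<le> n * R \<Longrightarrow> f w \<le> h w"
  shows "walk n f x v \<le> walk n h x v"
  using assms
proof (induction n arbitrary: x v)
  case (Suc n)
  have "walk n f y (v + g y) \<le> walk n h y (v + g y)" for y
  proof (rule Suc.IH)
    fix w assume "norm (w - (v + g y)) \<le> n * R"
    then have "norm (w - v) \<le> Suc n * R"
      using norm_triangle_ineq[of "w - (v + g y)" "g y"] g_le[of y] by (simp add: algebra_simps)
    then show "f w \<le> h w" by (rule Suc.prems)
  qed
  then show ?case by (simp add: nn_integral_mono)
qed simp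

lemma emeasure_p_UNIV [simp]: "emeasure (p x) UNIV = 1"
  using prob_space.emeasure_space_1[OF prob_space_p, of x] by (simp only: space_p)

lemma walk_const [simp]: "walk n (\<lambda>w. c) x v = c"
  by (induction n arbitrary: x v) simp_all

lemma walk_translate: "walk n (\<lambda>z. f (z + w)) x v = walk n f x (v + w)"
  by (induction n arbitrary: x v) (simp_all add: add_ac)

lemma walk_sum:
  assumes [measurable]: "\<And>i. f i \<in> borel_measurable borel"
  shows "walk n (\<lambda>w. \<Sum>i\<in>I. c i * f i w) x v = (\<Sum>i\<in>I. c i * walk n (f i) x v)"
proof (induction n arbitrary: x v)
  case (Suc n)
  have [measurable]: "(\<lambda>y. walk n (f i) y (v + g y)) \<in> borel_measurable borel" for i
    by measurable
  show ?case by (simp add: Suc nn_integral_sum nn_integral_cmult)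
qed simp

text \<open>Markov property at time k. Nothing is known about the state reached then, so the bound
  on the remaining \<open>l\<close> steps has to hold from every state.\<close>

lemma walk_chain:
  assumes [measurable]: "h \<in> borel_measurable borel"
    and le: "\<And>y w. q * h w \<le> walk l f y w"
  shows "q * walk k h x v \<le> walk (k + l) f x v"
proof (induction k arbitrary: x v)
  case (Suc k)
  have "q * walk (Suc k) h x v = (\<integral>\<^sup>+y. q * walk k h y (v + g y) \<partial>p x)"
    by (simp add: nn_integral_cmult)
  also have "\<dots> \<le> walk (Suc k + l) f x v"
    by (simp add: nn_integral_mono Suc)
  finally show ?case .
qed (simp add: le)

lemma walk_exp:
  "walk n (\<lambda>w. ennreal (exp (\<alpha> \<bullet> w))) x v = ennreal (exp (\<alpha> \<bullet> v) * tiltn \<alpha> n (\<lambda>x. 1) x)"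
proof (induction n arbitrary: x v)
  case (Suc n)
  have [measurable]: "tiltn \<alpha> n (\<lambda>x. 1) \<in> borel_measurable borel"
    by (intro bdd_borel_measurable tiltn_bdd_borel) simp
  have "walk (Suc n) (\<lambda>w. ennreal (exp (\<alpha> \<bullet> w))) x v =
    (\<integral>\<^sup>+y. ennreal (exp (\<alpha> \<bullet> v)) * ennreal (exp (\<alpha> \<bullet> g y) * tiltn \<alpha> n (\<lambda>x. 1) y) \<partial>p x)"
    by (simp add: Suc inner_add_right exp_add mult.assoc ennreal_mult')
  also have "\<dots> = ennreal (exp (\<alpha> \<bullet> v)) * ennreal (tilt \<alpha> (tiltn \<alpha> n (\<lambda>x. 1)) x)"
    using tilt_nn_integral[of "tiltn \<alpha> n (\<lambda>x. 1)" x \<alpha>]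
    by (simp add: nn_integral_cmult tiltn_bdd_borel less_imp_le tiltn_one_pos)
  finally show ?case by (simp add: ennreal_mult')
qed simp

text \<open>The first \<open>k\<close> increments move the position by at most \<open>k * R\<close>.
  Once the hypothesis tolerates this displacement, only the law of the k-th state is left, and to
  that law \<open>nn_harnack\<close> applies. \<open>kernel_power_le_walk\<close> is the reverse
  passage.\<close>

lemma walk_le_kernel_power:
  assumes [measurable]: "h \<in> borel_measurable borel"
    and "\<And>y w. norm (w - v) \<le> k * R \<Longrightarrow> walk n f y w \<le> h y"
  shows "walk (k + n) f x v \<le> (\<integral>\<^sup>+y. h y \<partial>kernel_power p k x)"
  using assms(2)
proof (induction k arbitrary: x v)
  case 0
  then show ?case by (simp add: nn_integral_return)
next
  case (Suc k)
  have "walk (k + n) f y (v + g y) \<le> (\<integral>\<^sup>+z. h z \<partial>kernel_power p k y)" for y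
  proof (rule Suc.IH)
    fix z w assume "norm (w - (v + g y)) \<le> k * R"
    then have "norm (w - v) \<le> Suc k * R"
      using norm_triangle_ineq[of "w - (v + g y)" "g y"] g_le[of y] by (simp add: algebra_simps)
    then show "walk n f z w \<le> h z" by (rule Suc.prems)
  qed
  then show ?case
    by (simp add: nn_integral_kernel_power_Suc nn_integral_mono del: kernel_power.simps)
qed

lemma kernel_power_le_walk:
  assumes [measurable]: "h \<in> borel_measurable borel"
    and "\<And>y w. norm (w - v) \<le> k * R \<Longrightarrow> h y \<le> walk n f y w"
  shows "(\<integral>\<^sup>+y. h y \<partial>kernel_power p k x) \<le> walk (k + n) f x v"
  using assms(2)
proof (induction k arbitrary: x v)
  case 0
  then show ?case by (simp add: nn_integral_return)
next
  case (Suc k)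
  have "(\<integral>\<^sup>+z. h z \<partial>kernel_power p k y) \<le> walk (k + n) f y (v + g y)" for y
  proof (rule Suc.IH)
    fix z w assume "norm (w - (v + g y)) \<le> k * R"
    then have "norm (w - v) \<le> Suc k * R"
      using norm_triangle_ineq[of "w - (v + g y)" "g y"] g_le[of y] by (simp add: algebra_simps)
    then show "h z \<le> walk n f z w" by (rule Suc.prems)
  qed
  then show ?case
    by (simp add: nn_integral_kernel_power_Suc nn_integral_mono del: kernel_power.simps)
qed

section \<open>Probabilities that the walk ends in a ball\<close>

definition hit :: "nat \<Rightarrow> 's \<Rightarrow> real^'d \<Rightarrow> real \<Rightarrow> ennreal" where
  "hit n x b \<rho> = walk n (indicator (cball b \<rho>)) x 0"

lemma indicator_cball_measurable [measurable]:
  "(indicator (cball b \<rho>) :: real^'d \<Rightarrow> ennreal) \<in> borel_measurable borel"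
  by (intro borel_measurable_indicator borel_closed closed_cball)

lemma hit_measurable [measurable]: "(\<lambda>x. hit n x b \<rho>) \<in> borel_measurable borel"
  unfolding hit_def by measurable

lemma hit_mono:
  assumes "dist b b' + \<rho> \<le> \<rho>'"
  shows "hit n x b \<rho> \<le> hit n x b' \<rho>'"
  unfolding hit_def
proof (rule walk_mono)
  fix w
  have "dist b' w \<le> \<rho>'" if "dist b w \<le> \<rho>"
    using that assms dist_triangle[of b' w b] by (simp add: dist_commute)
  then show "(indicator (cball b \<rho>) w :: ennreal) \<le> indicator (cball b' \<rho>') w"
    by (auto simp: indicator_def)
qed

lemma hit_le_one: "hit n x b \<rho> \<le> 1"
  using walk_mono[of 0 n "indicator (cball b \<rho>)" "\<lambda>w. 1" x] by (auto simp: hit_def indicator_def)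

lemma hit_full: "hit n x 0 (n * R) = 1"
proof -
  have "walk n (\<lambda>w. 1) x 0 \<le> hit n x 0 (n * R)"
    unfolding hit_def by (rule walk_mono) (auto simp: indicator_def)
  with hit_le_one[of n x 0 "n * R"] show ?thesis by (intro order_antisym) simp_all
qed

lemma hit_add:
  assumes "\<And>y. q \<le> hit l y b' \<rho>'"
  shows "q * hit k x b \<rho> \<le> hit (k + l) x (b + b') (\<rho> + \<rho>')"
  unfolding hit_def
proof (rule walk_chain)
  fix y w
  let ?f = "indicator (cball (b + b') (\<rho> + \<rho>')) :: real^'d \<Rightarrow> ennreal"
  show "q * indicator (cball b \<rho>) w \<le> walk l ?f y w"
  proof (cases "w \<in> cball b \<rho>")
    case True
    have "hit l y b' \<rho>' \<le> walk l (\<lambda>z. ?f (z + w)) y 0"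
      unfolding hit_def
    proof (rule walk_mono)
      fix z :: "real^'d"
      have "z + w \<in> cball (b + b') (\<rho> + \<rho>')" if "z \<in> cball b' \<rho>'"
        using that True norm_triangle_ineq[of "b - w" "b' - z"]
        by (simp add: dist_norm algebra_simps)
      then show "(indicator (cball b' \<rho>') z :: ennreal) \<le> ?f (z + w)"
        by (auto simp: indicator_def)
    qed
    then show ?thesis using assms[of y] True by (simp add: walk_translate)
  qed simp
qed simp

lemma hit_power:
  assumes "\<And>x. q \<le> hit N x b \<rho>"
  shows "q ^ k \<le> hit (k * N) x (real k *\<^sub>R b) (k * \<rho>)"
proof (induction k arbitrary: x)
  case 0
  have "hit 0 x 0 0 = 1" using hit_full[of 0 x] by simp
  then show ?case by simp
next
  case (Suc k)
  have "q * q ^ k \<le> q * hit (k * N) x (real k *\<^sub>R b) (k * \<rho>)"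
    by (intro mult_left_mono Suc) simp
  also have "\<dots> \<le> hit (k * N + N) x (real k *\<^sub>R b + b) (k * \<rho> + \<rho>)"
    by (intro hit_add assms)
  finally show ?case by (simp add: algebra_simps)
qed

text \<open>The radius grows by \<open>m * R\<close> when the first m increments of the walk from
  \<open>x\<close> are forgotten, and by \<open>m * R\<close> again when those of the walk from
  \<open>z\<close> are put in their place.\<close>

lemma hit_harnack:
  assumes "m \<le> n"
  shows "hit n x b \<rho> \<le> ennreal D * hit n z b (\<rho> + 2 * m * R)"
proof -
  obtain l where n: "n = m + l" using assms le_Suc_ex by blast
  let ?h = "\<lambda>y. hit l y b (\<rho> + m * R)"
  have "hit n x b \<rho> \<le> (\<integral>\<^sup>+y. ?h y \<partial>kernel_power p m x)"
    unfolding n hit_def[of "m + l"]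
  proof (rule walk_le_kernel_power)
    fix y :: 's and w :: "real^'d" assume w: "norm (w - 0) \<le> m * R"
    have "walk l (\<lambda>z. indicator (cball b \<rho>) (z + w)) y 0 \<le> ?h y"
      unfolding hit_def
    proof (rule walk_mono)
      fix z :: "real^'d"
      have "z \<in> cball b (\<rho> + m * R)" if "z + w \<in> cball b \<rho>"
        using that w norm_triangle_ineq[of "b - (z + w)" w] by (simp add: dist_norm)
      then show "(indicator (cball b \<rho>) (z + w) :: ennreal) \<le> indicator (cball b (\<rho> + m * R)) z"
        by (auto simp: indicator_def)
    qed
    then show "walk l (indicator (cball b \<rho>)) y w \<le> ?h y" by (simp add: walk_translate)
  qed simp
  also have "\<dots> \<le> ennreal D * (\<integral>\<^sup>+y. ?h y \<partial>kernel_power p m z)"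
    by (rule nn_harnack) simp
  also have "(\<integral>\<^sup>+y. ?h y \<partial>kernel_power p m z) \<le> hit n z b (\<rho> + 2 * m * R)"
    unfolding n hit_def[of "m + l"]
  proof (rule kernel_power_le_walk)
    fix y :: 's and w :: "real^'d" assume w: "norm (w - 0) \<le> m * R"
    have "?h y \<le> walk l (\<lambda>z. indicator (cball b (\<rho> + 2 * m * R)) (z + w)) y 0"
      unfolding hit_def
    proof (rule walk_mono)
      fix z :: "real^'d"
      have "z + w \<in> cball b (\<rho> + 2 * m * R)" if "z \<in> cball b (\<rho> + m * R)"
        using that w norm_triangle_ineq4[of "b - z" w] by (simp add: dist_norm algebra_simps)
      then show "(indicator (cball b (\<rho> + m * R)) z :: ennreal) \<le> indicator (cball b (\<rho> + 2 * m * R)) (z + w)"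
        by (auto simp: indicator_def)
    qed
    then show "?h y \<le> walk l (indicator (cball b (\<rho> + 2 * m * R))) y w" by (simp add: walk_translate)
  qed simp
  finally show ?thesis by (simp add: mult_left_mono)
qed

lemma ennreal_exp_le_one: "ennreal (exp (- u)) \<le> 1 \<Longrightarrow> 0 \<le> u"
  by (simp add: ennreal_le_1)

text \<open>A bound at the single time \<open>N\<close> is repeated over \<open>n div N\<close>
  blocks. The fewer than \<open>N\<close> remaining steps are left uncontrolled; together with the
  missing part of the drift they shift the end point by a bounded amount, which the second
  \<epsilon> covers for large n.\<close>

lemma hit_eventually:
  fixes s \<epsilon> :: real
  assumes N: "1 \<le> N" and \<epsilon>: "0 < \<epsilon>"
    and le: "\<And>x. ennreal (exp (- (N * s))) \<le> hit N x (real N *\<^sub>R \<beta>) (N * \<epsilon>)"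
  shows "\<forall>\<^sub>F n in sequentially. \<forall>x. ennreal (exp (- (n * s))) \<le> hit n x (real n *\<^sub>R \<beta>) (n * (2 * \<epsilon>))"
proof -
  \<comment> \<open>Probabilities are at most 1, so the exponent is nonnegative; this lets the
    blocks, which fill only part of the time n, be charged with \<open>n * s\<close>.\<close>
  have "0 \<le> real N * s"
    by (rule ennreal_exp_le_one[OF order_trans[OF le hit_le_one]])
  then have s: "0 \<le> s" using N by (simp add: zero_le_mult_iff)
  have "\<forall>\<^sub>F n in sequentially. N * (norm \<beta> + R) \<le> \<epsilon> * real n - 1"
    by (rule eventually_linear_ge[OF \<epsilon>])
  then show ?thesis
  proof eventually_elim
    case (elim n)
    show ?case
    proof
      fix x
      define k l where "k = n div N" and "l = n mod N"
      have n: "n = k * N + l" and l: "l < N" using N by (simp_all add: k_def l_def)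
      have "real k * real N * s \<le> n * s"
        using s n by (intro mult_right_mono) (auto simp flip: of_nat_mult)
      then have "ennreal (exp (- (n * s))) \<le> ennreal (exp (- (real N * s)) ^ k)"
        by (simp add: algebra_simps flip: exp_of_nat_mult)
      also have "\<dots> = ennreal (exp (- (real N * s))) ^ k" by (simp add: ennreal_power)
      also have "\<dots> \<le> 1 * hit (k * N) x (real k *\<^sub>R real N *\<^sub>R \<beta>) (k * (N * \<epsilon>))"
        using hit_power[OF le] by simp
      also have "\<dots> \<le> hit (k * N + l) x (real k *\<^sub>R real N *\<^sub>R \<beta> + 0) (k * (N * \<epsilon>) + l * R)"
        by (intro hit_add) (simp add: hit_full)
      also have "\<dots> \<le> hit n x (real n *\<^sub>R \<beta>) (n * (2 * \<epsilon>))"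
        unfolding n[symmetric]
      proof (rule hit_mono)
        have "real k *\<^sub>R real N *\<^sub>R \<beta> + 0 - real n *\<^sub>R \<beta> = - (real l *\<^sub>R \<beta>)"
          by (simp add: n algebra_simps)
        then have d: "dist (real k *\<^sub>R real N *\<^sub>R \<beta> + 0) (real n *\<^sub>R \<beta>) = l * norm \<beta>"
          by (simp only: dist_norm norm_minus_cancel norm_scaleR abs_of_nat)
        have "l * (norm \<beta> + R) \<le> N * (norm \<beta> + R)"
          using l R_nonneg by (intro mult_right_mono) auto
        moreover have "N * (norm \<beta> + R) \<le> n * \<epsilon>" using elim by (simp add: mult.commute)
        moreover have "k * (N * \<epsilon>) \<le> n * \<epsilon>"
          using \<epsilon> n by (simp flip: mult.assoc of_nat_mult)
        moreover have "n * (2 * \<epsilon>) = n * \<epsilon> + n * \<epsilon>" by simp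
        ultimately show "dist (real k *\<^sub>R real N *\<^sub>R \<beta> + 0) (real n *\<^sub>R \<beta>) + (k * (N * \<epsilon>) + l * R) \<le> n * (2 * \<epsilon>)"
          unfolding d distrib_left by linarith
      qed
      finally show "ennreal (exp (- (n * s))) \<le> hit n x (real n *\<^sub>R \<beta>) (n * (2 * \<epsilon>))" .
    qed
  qed
qed

text \<open>The epigraph of the rate at which the walk can be forced, uniformly in its starting point, to
  have mean \<open>\<beta>\<close>. By supermultiplicativity it is convex, so that it can be compared with \<open>rate_L\<close> by
  convex duality, without using differentiability of \<open>H\<close>.\<close>

definition epi :: "((real^'d) \<times> real) set" where
  "epi = {(\<beta>, s). \<forall>\<epsilon>::real. 0 < \<epsilon> \<longrightarrow> (\<forall>\<^sub>F n in sequentially. \<forall>x.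
     ennreal (exp (- (n * (s + \<epsilon>)))) \<le> hit n x (real n *\<^sub>R \<beta>) (n * \<epsilon>))}"

lemma epiI:
  fixes s :: real
  assumes "\<And>\<epsilon>::real. 0 < \<epsilon> \<Longrightarrow> \<forall>\<^sub>F n in sequentially. \<forall>x.
     ennreal (exp (- (n * (s + \<epsilon>)))) \<le> hit n x (real n *\<^sub>R \<beta>) (n * \<epsilon>)"
  shows "(\<beta>, s) \<in> epi"
  using assms by (simp add: epi_def)

lemma epiD:
  fixes s \<epsilon> :: real
  assumes "(\<beta>, s) \<in> epi" "0 < \<epsilon>"
  shows "\<forall>\<^sub>F n in sequentially. \<forall>x.
     ennreal (exp (- (n * (s + \<epsilon>)))) \<le> hit n x (real n *\<^sub>R \<beta>) (n * \<epsilon>)"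
  using assms by (simp add: epi_def)

lemma epi_nonneg:
  assumes "(\<beta>, s) \<in> epi" shows "0 \<le> s"
proof (rule field_le_epsilon)
  fix \<epsilon> :: real assume "0 < \<epsilon>"
  from eventually_conj[OF epiD[OF assms this] eventually_gt_at_top[of 0]]
  obtain n where n: "\<And>x. ennreal (exp (- (real n * (s + \<epsilon>)))) \<le> hit n x (real n *\<^sub>R \<beta>) (n * \<epsilon>)" "0 < n"
    by (auto simp: eventually_sequentially)
  have "0 \<le> real n * (s + \<epsilon>)" by (rule ennreal_exp_le_one[OF order_trans[OF n(1) hit_le_one]])
  with n(2) show "0 \<le> s + \<epsilon>" by (simp add: zero_le_mult_iff)
qed

lemma epi_upward:
  assumes "(\<beta>, s) \<in> epi" "s \<le> t" shows "(\<beta>, t) \<in> epi"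
proof (rule epiI)
  fix \<epsilon> :: real assume "0 < \<epsilon>"
  from epiD[OF assms(1) this]
  show "\<forall>\<^sub>F n in sequentially. \<forall>x. ennreal (exp (- (n * (t + \<epsilon>)))) \<le> hit n x (real n *\<^sub>R \<beta>) (n * \<epsilon>)"
  proof eventually_elim
    case (elim n)
    have "ennreal (exp (- (n * (t + \<epsilon>)))) \<le> ennreal (exp (- (n * (s + \<epsilon>))))"
      using assms(2) by (simp add: mult_left_mono)
    with elim show ?case by (blast intro: order_trans)
  qed
qed

lemma closed_epi: "closed epi"
proof -
  have "z \<in> epi" if z: "z \<in> closure epi" for z
  proof -
    obtain \<beta> s where zz: "z = (\<beta>, s)" by (cases z)
    show ?thesis unfolding zz
    proof (rule epiI)
      fix \<epsilon> :: real assume "0 < \<epsilon>"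
      then have e2: "0 < \<epsilon> / 2" by simp
      with z obtain y where y: "y \<in> epi" "dist y z < \<epsilon> / 2" unfolding closure_approachable by blast
      obtain \<beta>' s' where yy: "y = (\<beta>', s')" by (cases y)
      have d: "dist \<beta>' \<beta> < \<epsilon> / 2" "dist s' s < \<epsilon> / 2"
        using y(2) dist_fst_le[of y z] dist_snd_le[of y z] by (auto simp: yy zz)
      from epiD[OF y(1)[unfolded yy] e2]
      show "\<forall>\<^sub>F n in sequentially. \<forall>x. ennreal (exp (- (n * (s + \<epsilon>)))) \<le> hit n x (real n *\<^sub>R \<beta>) (n * \<epsilon>)"
      proof eventually_elim
        case (elim n)
        show ?case
        proof
          fix x
          have "real n * (s' + \<epsilon> / 2) \<le> n * (s + \<epsilon>)"
            using d(2) by (intro mult_left_mono) (auto simp: dist_real_def abs_if split: if_splits)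
          then have "ennreal (exp (- (n * (s + \<epsilon>)))) \<le> ennreal (exp (- (n * (s' + \<epsilon> / 2))))" by simp
          also have "\<dots> \<le> hit n x (real n *\<^sub>R \<beta>') (n * (\<epsilon> / 2))" using elim by blast
          also have "\<dots> \<le> hit n x (real n *\<^sub>R \<beta>) (n * \<epsilon>)"
          proof (rule hit_mono)
            have "dist (real n *\<^sub>R \<beta>') (real n *\<^sub>R \<beta>) = n * dist \<beta>' \<beta>"
              by (simp add: dist_norm flip: scaleR_diff_right)
            also have "\<dots> \<le> n * (\<epsilon> / 2)" using d(1) by (intro mult_left_mono) auto
            finally show "dist (real n *\<^sub>R \<beta>') (real n *\<^sub>R \<beta>) + n * (\<epsilon> / 2) \<le> n * \<epsilon>" by simp
          qed
          finally show "ennreal (exp (- (n * (s + \<epsilon>)))) \<le> hit n x (real n *\<^sub>R \<beta>) (n * \<epsilon>)" .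
        qed
      qed
    qed
  qed
  then show ?thesis by (auto simp flip: closure_subset_eq)
qed

text \<open>Spend the first \<open>l n\<close> of the n steps on moving with mean \<beta> and the
  other \<open>k n\<close>, about \<open>u * n\<close>, on mean \<beta>'. Rounding changes the
  exponent and the end point by bounded amounts, for which one half of \<epsilon> is
  reserved.\<close>

lemma convex_epi: "convex epi"
  unfolding convex_alt
proof (intro ballI allI impI)
  fix z w :: "(real^'d) \<times> real" and u :: real
  assume zw: "z \<in> epi" "w \<in> epi" and u: "0 \<le> u \<and> u \<le> 1"
  consider "u = 0" | "u = 1" | "0 < u" "u < 1" using u by linarith
  then show "(1 - u) *\<^sub>R z + u *\<^sub>R w \<in> epi"
  proof cases
    case 3
    obtain \<beta> s where z: "z = (\<beta>, s)" by (cases z)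
    obtain \<beta>' s' where w: "w = (\<beta>', s')" by (cases w)
    have "((1 - u) *\<^sub>R \<beta> + u *\<^sub>R \<beta>', (1 - u) * s + u * s') \<in> epi"
    proof (rule epiI)
      fix \<epsilon> :: real assume \<epsilon>: "0 < \<epsilon>"
      define \<eta> where "\<eta> = \<epsilon> / 2"
      have \<eta>: "0 < \<eta>" using \<epsilon> by (simp add: \<eta>_def)
      define k l where "k n = nat \<lfloor>u * real n\<rfloor>" and "l n = n - k n" for n
      have k: "real (k n) \<le> u * n" "u * n - 1 \<le> real (k n)" for n
        using 3 by (auto simp: k_def)
      have kn: "k n \<le> n" for n
      proof -
        have "u * real n \<le> 1 * real n" using 3 by (intro mult_right_mono) auto
        with k(1)[of n] show ?thesis by simp
      qed
      have l: "real (l n) = real n - real (k n)" for n using kn by (simp add: l_def of_nat_diff)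
      have lk: "l n + k n = n" for n using kn by (simp add: l_def)
      have kinf: "filterlim k at_top sequentially"
        unfolding filterlim_at_top
      proof
        fix Z
        have "\<forall>\<^sub>F n in sequentially. real Z \<le> u * n - 1"
          by (rule eventually_linear_ge[OF 3(1)])
        then show "\<forall>\<^sub>F n in sequentially. Z \<le> k n"
          by eventually_elim (use k in \<open>smt (verit) of_nat_le_iff\<close>)
      qed
      have linf: "filterlim l at_top sequentially"
        unfolding filterlim_at_top
      proof
        fix Z
        have "\<forall>\<^sub>F n in sequentially. real Z \<le> (1 - u) * n - 1"
          using 3 by (intro eventually_linear_ge) simp
        then show "\<forall>\<^sub>F n in sequentially. Z \<le> l n"
        proof eventually_elim
          case (elim n)
          have "real Z \<le> real (l n)" using elim k(1)[of n] by (simp add: l algebra_simps)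
          then show ?case by simp
        qed
      qed
      have e1: "\<forall>\<^sub>F n in sequentially. \<forall>x.
          ennreal (exp (- (l n * (s + \<eta>)))) \<le> hit (l n) x (real (l n) *\<^sub>R \<beta>) (l n * \<eta>)"
        using filterlim_iff[THEN iffD1, OF linf] epiD[OF zw(1)[unfolded z] \<eta>] by blast
      have e2: "\<forall>\<^sub>F n in sequentially. \<forall>x.
          ennreal (exp (- (k n * (s' + \<eta>)))) \<le> hit (k n) x (real (k n) *\<^sub>R \<beta>') (k n * \<eta>)"
        using filterlim_iff[THEN iffD1, OF kinf] epiD[OF zw(2)[unfolded w] \<eta>] by blast
      have e3: "\<forall>\<^sub>F n in sequentially. norm \<beta> + norm \<beta>' + \<bar>s\<bar> + \<bar>s'\<bar> \<le> \<eta> * n - 1"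
        by (rule eventually_linear_ge[OF \<eta>])
      from e1 e2 e3
      show "\<forall>\<^sub>F n in sequentially. \<forall>x. ennreal (exp (- (n * ((1 - u) * s + u * s' + \<epsilon>))))
          \<le> hit n x (real n *\<^sub>R ((1 - u) *\<^sub>R \<beta> + u *\<^sub>R \<beta>')) (n * \<epsilon>)"
      proof eventually_elim
        case (elim n)
        define d where "d = u * n - k n"
        have d: "0 \<le> d" "d \<le> 1" using k[of n] by (auto simp: d_def)
        have kd: "real (k n) = u * n - d" and ld: "real (l n) = (1 - u) * n + d"
          by (auto simp: d_def l algebra_simps)
        have ne: "real n * \<epsilon> = n * \<eta> + n * \<eta>" by (simp add: \<eta>_def)
        show ?case
        proof
          fix x
          have ds: "\<bar>d * s\<bar> \<le> \<bar>s\<bar>" "\<bar>d * s'\<bar> \<le> \<bar>s'\<bar>"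
            using d by (auto simp: abs_mult mult_left_le_one_le)
          have "l n * (s + \<eta>) + k n * (s' + \<eta>) = n * ((1 - u) * s + u * s') + d * s - d * s' + n * \<eta>"
            unfolding kd ld by (simp add: algebra_simps)
          also have "\<dots> \<le> n * ((1 - u) * s + u * s') + n * \<epsilon>"
            using ds elim(3) norm_ge_zero[of \<beta>] norm_ge_zero[of \<beta>'] mult.commute[of \<eta> n]
            unfolding ne by linarith
          also have "\<dots> = n * ((1 - u) * s + u * s' + \<epsilon>)" by (simp only: distrib_left)
          finally have "ennreal (exp (- (n * ((1 - u) * s + u * s' + \<epsilon>))))
              \<le> ennreal (exp (- (k n * (s' + \<eta>)))) * ennreal (exp (- (l n * (s + \<eta>))))"
            by (simp flip: ennreal_mult exp_add)
          also have "\<dots> \<le> ennreal (exp (- (k n * (s' + \<eta>)))) * hit (l n) x (real (l n) *\<^sub>R \<beta>) (l n * \<eta>)"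
            using elim(1) by (intro mult_left_mono) auto
          also have "\<dots> \<le> hit (l n + k n) x (real (l n) *\<^sub>R \<beta> + real (k n) *\<^sub>R \<beta>') (l n * \<eta> + k n * \<eta>)"
            using elim(2) by (intro hit_add) auto
          also have "\<dots> \<le> hit n x (real n *\<^sub>R ((1 - u) *\<^sub>R \<beta> + u *\<^sub>R \<beta>')) (n * \<epsilon>)"
            unfolding lk
          proof (rule hit_mono)
            have "real (l n) *\<^sub>R \<beta> + real (k n) *\<^sub>R \<beta>' - real n *\<^sub>R ((1 - u) *\<^sub>R \<beta> + u *\<^sub>R \<beta>')
              = d *\<^sub>R \<beta> - d *\<^sub>R \<beta>'"
              unfolding kd ld by (simp add: algebra_simps)
            then have "dist (real (l n) *\<^sub>R \<beta> + real (k n) *\<^sub>R \<beta>') (real n *\<^sub>R ((1 - u) *\<^sub>R \<beta> + u *\<^sub>R \<beta>'))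
              \<le> d * norm \<beta> + d * norm \<beta>'"
              using norm_triangle_ineq4[of "d *\<^sub>R \<beta>" "d *\<^sub>R \<beta>'"] d by (simp add: dist_norm)
            also have "\<dots> \<le> norm \<beta> + norm \<beta>'"
              using d by (intro add_mono) (auto simp: mult_left_le_one_le)
            also have "\<dots> \<le> n * \<eta>" using elim(3) by (simp add: algebra_simps)
            finally have "dist (real (l n) *\<^sub>R \<beta> + real (k n) *\<^sub>R \<beta>') (real n *\<^sub>R ((1 - u) *\<^sub>R \<beta> + u *\<^sub>R \<beta>'))
              \<le> n * \<eta>" .
            moreover have "l n * \<eta> + k n * \<eta> = n * \<eta>" by (simp add: l left_diff_distrib)
            ultimately show "dist (real (l n) *\<^sub>R \<beta> + real (k n) *\<^sub>R \<beta>') (real n *\<^sub>R ((1 - u) *\<^sub>R \<beta> + u *\<^sub>R \<beta>'))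
              + (l n * \<eta> + k n * \<eta>) \<le> n * \<epsilon>"
              using ne by linarith
          qed
          finally show "ennreal (exp (- (n * ((1 - u) * s + u * s' + \<epsilon>))))
            \<le> hit n x (real n *\<^sub>R ((1 - u) *\<^sub>R \<beta> + u *\<^sub>R \<beta>')) (n * \<epsilon>)" .
        qed
      qed
    qed
    then show ?thesis by (simp add: z w)
  qed (use zw in simp_all)
qed

text \<open>Failure of the defining bound gives a bad state for infinitely many times only. By
  \<open>hit_eventually\<close>, a single time at which every state satisfied the bound with radius
  \<open>n * (\<epsilon> / 2)\<close> would restore it for all large times, so there is a bad state
  at every time. \<open>hit_harnack\<close> then makes all states bad, up to the factor
  \<open>D\<close>.\<close>

lemma hit_upper_of_not_epi:
  fixes s \<eta>\<^sub>0 :: real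
  assumes not: "(\<beta>, s) \<notin> epi" and \<eta>: "0 < \<eta>\<^sub>0"
  shows "\<exists>\<eta>::real. 0 < \<eta> \<and> \<eta> \<le> \<eta>\<^sub>0 \<and>
    (\<forall>\<^sub>F n in sequentially. \<forall>z. hit n z (real n *\<^sub>R \<beta>) (n * \<eta>) \<le> ennreal (D * exp (- (n * s))))"
proof -
  obtain \<epsilon> :: real where \<epsilon>: "0 < \<epsilon>"
    and ne: "\<not> (\<forall>\<^sub>F n in sequentially. \<forall>x.
      ennreal (exp (- (n * (s + \<epsilon>)))) \<le> hit n x (real n *\<^sub>R \<beta>) (n * \<epsilon>))"
    using not by (auto simp: epi_def)
  \<comment> \<open>The radius \<open>n * (\<epsilon> / 4)\<close> leaves room for the enlargement
    by \<open>2 * m * R\<close> in \<open>hit_harnack\<close> before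
    \<open>n * (\<epsilon> / 2)\<close> is reached.\<close>
  define \<eta> where "\<eta> = min (\<epsilon> / 4) \<eta>\<^sub>0"
  have *: "\<exists>x. hit n x (real n *\<^sub>R \<beta>) (n * (\<epsilon> / 2)) \<le> ennreal (exp (- (n * s)))" if "1 \<le> n" for n
  proof (rule ccontr)
    assume "\<not> ?thesis"
    then have lt: "ennreal (exp (- (n * s))) < hit n x (real n *\<^sub>R \<beta>) (n * (\<epsilon> / 2))" for x
      by (simp add: not_le)
    have "ennreal (exp (- (n * (s + \<epsilon>)))) \<le> hit n x (real n *\<^sub>R \<beta>) (n * (\<epsilon> / 2))" for x
    proof (rule order_trans[OF _ less_imp_le[OF lt]])
      show "ennreal (exp (- (n * (s + \<epsilon>)))) \<le> ennreal (exp (- (n * s)))"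
        using \<epsilon> by (simp add: mult_left_mono)
    qed
    from hit_eventually[OF that half_gt_zero[OF \<epsilon>] this] ne show False by simp
  qed
  have "\<forall>\<^sub>F n in sequentially. 2 * m * R \<le> \<epsilon> / 4 * n - 1"
    using \<epsilon> by (intro eventually_linear_ge) simp
  then have "\<forall>\<^sub>F n in sequentially. \<forall>z. hit n z (real n *\<^sub>R \<beta>) (n * \<eta>) \<le> ennreal (D * exp (- (n * s)))"
    using eventually_ge_at_top[of m]
  proof eventually_elim
    case (elim n)
    obtain x where x: "hit n x (real n *\<^sub>R \<beta>) (n * (\<epsilon> / 2)) \<le> ennreal (exp (- (n * s)))"
      using * elim(2) m_pos by force
    show ?case
    proof
      fix z
      have "n * \<eta> \<le> n * (\<epsilon> / 4)" by (intro mult_left_mono) (auto simp: \<eta>_def)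
      then have le: "n * \<eta> + 2 * m * R \<le> n * (\<epsilon> / 2)" using elim(1) by (simp add: algebra_simps)
      have "hit n z (real n *\<^sub>R \<beta>) (n * \<eta>) \<le> ennreal D * hit n x (real n *\<^sub>R \<beta>) (n * \<eta> + 2 * m * R)"
        using hit_harnack[OF elim(2)] by simp
      also have "\<dots> \<le> ennreal D * hit n x (real n *\<^sub>R \<beta>) (n * (\<epsilon> / 2))"
        using le by (intro mult_left_mono hit_mono) auto
      also have "\<dots> \<le> ennreal D * ennreal (exp (- (n * s)))"
        by (intro mult_left_mono x) simp
      finally show "hit n z (real n *\<^sub>R \<beta>) (n * \<eta>) \<le> ennreal (D * exp (- (n * s)))"
        using D_ge by (simp add: ennreal_mult)
    qed
  qed
  then show ?thesis using \<epsilon> \<eta> by (intro exI[of _ \<eta>]) (auto simp: \<eta>_def)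
qed

text \<open>If every point of the compact ball that carries the means were beyond the claimed bound, a
  finite cover would make the exponential moment grow slower than \<open>exp (n H)\<close>.\<close>

lemma epi_dual:
  assumes \<delta>: "0 < \<delta>"
  shows "\<exists>(\<beta>, s)\<in>epi. H \<alpha> - \<delta> \<le> \<alpha> \<bullet> \<beta> - s"
proof (rule ccontr)
  assume neg: "\<not> ?thesis"
  \<comment> \<open>The height at which the claimed inequality is an equality, so that by assumption
    no point of this graph belongs to \<open>epi\<close>.\<close>
  define s where "s \<beta> = \<alpha> \<bullet> \<beta> - H \<alpha> + \<delta>" for \<beta>
  \<comment> \<open>With this radius, replacing a point of a ball by its centre costs at most
    \<delta> / 2 per step in the exponential moment. The other half of \<delta> remains as decay
    relative to \<open>exp (n * H \<alpha>)\<close>.\<close>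
  define \<eta>\<^sub>0 where "\<eta>\<^sub>0 = \<delta> / (2 * (norm \<alpha> + 1))"
  have \<eta>\<^sub>0: "0 < \<eta>\<^sub>0" using \<delta> by (simp add: \<eta>\<^sub>0_def add_nonneg_pos)
  have "(\<beta>, s \<beta>) \<notin> epi" for \<beta> using neg by (auto simp: s_def)
  then have "\<exists>\<eta>::real. 0 < \<eta> \<and> \<eta> \<le> \<eta>\<^sub>0 \<and> (\<forall>\<^sub>F n in sequentially. \<forall>z.
      hit n z (real n *\<^sub>R \<beta>) (n * \<eta>) \<le> ennreal (D * exp (- (n * s \<beta>))))" for \<beta>
    by (rule hit_upper_of_not_epi[OF _ \<eta>\<^sub>0])
  then have "\<forall>\<beta>. \<exists>\<eta>::real. 0 < \<eta> \<and> \<eta> \<le> \<eta>\<^sub>0 \<and> (\<forall>\<^sub>F n in sequentially. \<forall>z.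
      hit n z (real n *\<^sub>R \<beta>) (n * \<eta>) \<le> ennreal (D * exp (- (n * s \<beta>))))" by (rule allI)
  from choice[OF this] obtain \<eta> :: "real^'d \<Rightarrow> real" where all: "\<forall>\<beta>. 0 < \<eta> \<beta> \<and> \<eta> \<beta> \<le> \<eta>\<^sub>0 \<and>
      (\<forall>\<^sub>F n in sequentially. \<forall>z. hit n z (real n *\<^sub>R \<beta>) (n * \<eta> \<beta>) \<le> ennreal (D * exp (- (n * s \<beta>))))"
    by (rule exE)
  have \<eta>: "0 < \<eta> \<beta>" "\<eta> \<beta> \<le> \<eta>\<^sub>0"
    "\<forall>\<^sub>F n in sequentially. \<forall>z. hit n z (real n *\<^sub>R \<beta>) (n * \<eta> \<beta>) \<le> ennreal (D * exp (- (n * s \<beta>)))" for \<beta>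
    using spec[OF all, of \<beta>] by blast+
  obtain C where C: "finite C" "cball 0 R \<subseteq> (\<Union>\<beta>\<in>C. ball \<beta> (\<eta> \<beta>))"
  proof (rule compactE_image[of "cball 0 R" UNIV "\<lambda>\<beta>. ball \<beta> (\<eta> \<beta>)"])
    show "cball 0 R \<subseteq> (\<Union>\<beta>\<in>UNIV. ball \<beta> (\<eta> \<beta>))" using centre_in_ball \<eta>(1) by blast
  qed auto
  obtain k where k: "0 < k" "\<And>n x. k * exp (n * H \<alpha>) \<le> tiltn \<alpha> n (\<lambda>x. 1) x"
    using moment_lower by blast
  obtain z :: 's where True by simp
  have "\<forall>\<^sub>F n in sequentially. \<forall>\<beta>\<in>C. \<forall>z.
      hit n z (real n *\<^sub>R \<beta>) (n * \<eta> \<beta>) \<le> ennreal (D * exp (- (n * s \<beta>)))"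
    by (intro eventually_ball_finite C ballI \<eta>)
  moreover have "\<forall>\<^sub>F n in sequentially. ln (card C * D / k + 1) \<le> \<delta> / 2 * n - 1"
    using \<delta> by (intro eventually_linear_ge) simp
  ultimately have "\<forall>\<^sub>F n in sequentially. False"
    using eventually_gt_at_top[of 0]
  proof eventually_elim
    case (elim n)
    let ?c = "\<lambda>\<beta>. ennreal (exp (n * (\<alpha> \<bullet> \<beta>) + n * (\<delta> / 2)))"
    let ?I = "\<lambda>\<beta>. indicator (cball (real n *\<^sub>R \<beta>) (n * \<eta> \<beta>)) :: real^'d \<Rightarrow> ennreal"
    have "ennreal (tiltn \<alpha> n (\<lambda>x. 1) z) = walk n (\<lambda>w. ennreal (exp (\<alpha> \<bullet> w))) z 0"
      by (simp add: walk_exp)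
    also have "\<dots> \<le> walk n (\<lambda>w. \<Sum>\<beta>\<in>C. ?c \<beta> * ?I \<beta> w) z 0"
    proof (rule walk_mono)
      fix w :: "real^'d" assume "norm (w - 0) \<le> n * R"
      then have "(1 / real n) *\<^sub>R w \<in> cball 0 R" using elim(3) by (simp add: field_simps)
      then have "(1 / real n) *\<^sub>R w \<in> (\<Union>\<beta>\<in>C. ball \<beta> (\<eta> \<beta>))" by (rule subsetD[OF C(2)])
      then obtain \<beta> where \<beta>: "\<beta> \<in> C" "dist \<beta> ((1 / real n) *\<^sub>R w) < \<eta> \<beta>"
        unfolding UN_iff mem_ball by blast
      have wn: "w = real n *\<^sub>R ((1 / real n) *\<^sub>R w)" using elim(3) by simp
      have dw: "dist (real n *\<^sub>R \<beta>) w \<le> n * \<eta> \<beta>"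
      proof -
        have "dist (real n *\<^sub>R \<beta>) w = n * dist \<beta> ((1 / real n) *\<^sub>R w)"
          by (subst (1) wn) (simp only: dist_norm scaleR_diff_right[symmetric] norm_scaleR abs_of_nat)
        also have "\<dots> \<le> n * \<eta> \<beta>" using \<beta>(2) by (intro mult_left_mono) auto
        finally show ?thesis .
      qed
      have "\<alpha> \<bullet> w = n * (\<alpha> \<bullet> \<beta>) + \<alpha> \<bullet> (w - real n *\<^sub>R \<beta>)" by (simp add: inner_diff_right)
      also have "\<alpha> \<bullet> (w - real n *\<^sub>R \<beta>) \<le> norm \<alpha> * (n * \<eta> \<beta>)"
        using norm_cauchy_schwarz[of \<alpha> "w - real n *\<^sub>R \<beta>"] dw mult_left_mono[OF dw norm_ge_zero[of \<alpha>]]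
        by (simp add: dist_norm norm_minus_commute)
      also have "\<dots> \<le> n * (\<delta> / 2)"
      proof -
        have "norm \<alpha> * \<eta> \<beta> \<le> (norm \<alpha> + 1) * \<eta>\<^sub>0"
          using \<eta>(1,2)[of \<beta>] by (intro mult_mono) (auto intro: less_imp_le)
        also have "\<dots> = \<delta> / 2"
        proof -
          have "a * (\<delta> / (2 * a)) = \<delta> / 2" if "0 < a" for a using that by simp
          from this[of "norm \<alpha> + 1"] show ?thesis by (simp add: \<eta>\<^sub>0_def add_nonneg_pos)
        qed
        finally have "norm \<alpha> * \<eta> \<beta> \<le> \<delta> / 2" .
        from mult_left_mono[OF this, of n] show ?thesis by (simp add: algebra_simps)
      qed
      finally have "ennreal (exp (\<alpha> \<bullet> w)) \<le> ?c \<beta> * ?I \<beta> w" using dw by simp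
      also have "\<dots> \<le> (\<Sum>\<beta>\<in>C. ?c \<beta> * ?I \<beta> w)"
        by (rule member_le_sum[OF \<beta>(1)]) (auto simp: C)
      finally show "ennreal (exp (\<alpha> \<bullet> w)) \<le> (\<Sum>\<beta>\<in>C. ?c \<beta> * ?I \<beta> w)" .
    qed
    also have "\<dots> = (\<Sum>\<beta>\<in>C. ?c \<beta> * hit n z (real n *\<^sub>R \<beta>) (n * \<eta> \<beta>))"
      by (simp add: walk_sum hit_def)
    also have "\<dots> \<le> (\<Sum>\<beta>\<in>C. ?c \<beta> * ennreal (D * exp (- (n * s \<beta>))))"
      using elim(1) by (intro sum_mono mult_left_mono) auto
    also have "\<dots> = (\<Sum>\<beta>\<in>C. ennreal (D * exp (n * H \<alpha> - \<delta> / 2 * n)))"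
    proof (intro sum.cong refl)
      fix \<beta>
      have "?c \<beta> * ennreal (D * exp (- (n * s \<beta>))) =
          ennreal (D * (exp (n * (\<alpha> \<bullet> \<beta>) + n * (\<delta> / 2)) * exp (- (n * s \<beta>))))"
        using D_ge by (simp add: ac_simps flip: ennreal_mult)
      also have "exp (n * (\<alpha> \<bullet> \<beta>) + n * (\<delta> / 2)) * exp (- (n * s \<beta>)) = exp (n * H \<alpha> - \<delta> / 2 * n)"
        by (simp add: s_def algebra_simps flip: exp_add)
      finally show "?c \<beta> * ennreal (D * exp (- (n * s \<beta>))) = ennreal (D * exp (n * H \<alpha> - \<delta> / 2 * n))" .
    qed
    also have "\<dots> = ennreal (card C * D * exp (n * H \<alpha> - \<delta> / 2 * n))"
      using D_ge by (simp add: ennreal_of_nat_eq_real_of_nat mult.assoc flip: ennreal_mult)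
    finally have "tiltn \<alpha> n (\<lambda>x. 1) z \<le> card C * D * exp (n * H \<alpha> - \<delta> / 2 * n)"
      using D_ge by simp
    with k(2)[of n z] have "k * exp (n * H \<alpha>) \<le> card C * D * exp (n * H \<alpha> - \<delta> / 2 * n)" by linarith
    then have "k * exp (n * H \<alpha>) * exp (\<delta> / 2 * n) \<le> card C * D * exp (n * H \<alpha> - \<delta> / 2 * n) * exp (\<delta> / 2 * n)"
      by (rule mult_right_mono) simp
    also have "\<dots> = exp (n * H \<alpha>) * (card C * D)"
      by (simp only: mult.assoc exp_add[symmetric] diff_add_cancel) (simp only: ac_simps)
    finally have "exp (n * H \<alpha>) * (k * exp (\<delta> / 2 * n)) \<le> exp (n * H \<alpha>) * (card C * D)"
      by (simp only: ac_simps)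
    then have "k * exp (\<delta> / 2 * n) \<le> card C * D" by (rule mult_left_le_imp_le) simp
    then have "exp (\<delta> / 2 * n) \<le> card C * D / k" using k(1) by (simp only: pos_le_divide_eq mult.commute)
    also have "\<dots> < card C * D / k + 1" by simp
    also have "\<dots> = exp (ln (card C * D / k + 1))"
      using D_ge k(1) by (subst exp_ln) (auto intro!: add_nonneg_pos)
    also have "\<dots> \<le> exp (\<delta> / 2 * n)" using elim(2) by simp
    finally show False by simp
  qed
  then show False by simp
qed

text \<open>Separate the point from the closed convex set \<open>epi\<close> and distinguish the
  vertical component \<tau> of the normal. A negative one is impossible because \<open>epi\<close>
  is closed upwards. A positive one gives a parameter whose Legendre term exceeds \<open>c\<close>,
  by \<open>epi_dual\<close>. A vertical hyperplane gives a direction in which the Legendre terms at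
  \<open>\<beta>\<^sub>0\<close> are unbounded.\<close>

lemma epi_of_legendre_le:
  fixes c :: real
  assumes c: "\<And>\<alpha>. \<alpha> \<bullet> \<beta>\<^sub>0 - H \<alpha> \<le> c"
  shows "(\<beta>\<^sub>0, c) \<in> epi"
proof (rule ccontr)
  assume "(\<beta>\<^sub>0, c) \<notin> epi"
  from separating_hyperplane_closed_point[OF convex_epi closed_epi this]
  obtain a b where ab: "a \<bullet> (\<beta>\<^sub>0, c) < b" "\<And>z. z \<in> epi \<Longrightarrow> b < a \<bullet> z" by blast
  obtain v \<tau> where a: "a = (v, \<tau>)" by (cases a)
  have b0: "v \<bullet> \<beta>\<^sub>0 + \<tau> * c < b" using ab(1) by (simp add: a)
  have b1: "b < v \<bullet> \<beta> + \<tau> * s" if "(\<beta>, s) \<in> epi" for \<beta> s using ab(2)[OF that] by (simp add: a)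
  have c0: "0 \<le> c" using c[of 0] by simp
  consider "\<tau> < 0" | "0 < \<tau>" | "\<tau> = 0" by linarith
  then show False
  proof cases
    case 1
    obtain \<beta> s where bs: "(\<beta>, s) \<in> epi" using epi_dual[of 1 0] by auto
    define t where "t = max 0 ((b - v \<bullet> \<beta> - \<tau> * s) / \<tau>)"
    have "b < v \<bullet> \<beta> + \<tau> * (s + t)" by (rule b1[OF epi_upward[OF bs]]) (simp add: t_def)
    moreover have "\<tau> * t \<le> b - v \<bullet> \<beta> - \<tau> * s"
      using 1 mult_left_mono_neg[of "(b - v \<bullet> \<beta> - \<tau> * s) / \<tau>" t \<tau>] by (simp add: t_def)
    ultimately show False by (simp add: algebra_simps)
  next
    case 2
    let ?\<alpha> = "(- 1 / \<tau>) *\<^sub>R v"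
    have "H ?\<alpha> \<le> - b / \<tau> + \<delta>" if \<delta>: "0 < \<delta>" for \<delta>
    proof -
      obtain \<beta> s where bs: "(\<beta>, s) \<in> epi" "H ?\<alpha> - \<delta> \<le> ?\<alpha> \<bullet> \<beta> - s"
        using epi_dual[OF \<delta>, of ?\<alpha>] by auto
      have "?\<alpha> \<bullet> \<beta> - s = - ((v \<bullet> \<beta> + \<tau> * s) / \<tau>)" using 2 by (simp add: field_simps)
      also have "\<dots> < - b / \<tau>" using divide_strict_right_mono[OF b1[OF bs(1)] 2] by simp
      finally have "?\<alpha> \<bullet> \<beta> - s < - b / \<tau>" .
      with bs(2) show ?thesis by simp
    qed
    then have "H ?\<alpha> \<le> - b / \<tau>" by (rule field_le_epsilon)
    with c[of ?\<alpha>] have "?\<alpha> \<bullet> \<beta>\<^sub>0 + b / \<tau> \<le> c" by simp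
    then have "b \<le> v \<bullet> \<beta>\<^sub>0 + \<tau> * c" using 2 by (simp add: field_simps)
    with b0 show False by simp
  next
    case 3
    define d where "d = b - v \<bullet> \<beta>\<^sub>0"
    have d: "0 < d" using b0 3 by (simp add: d_def)
    \<comment> \<open>Large enough that \<open>t * d\<close> exceeds \<open>c\<close> by more than
      the error 1 allowed in the use of \<open>epi_dual\<close>.\<close>
    define t where "t = (c + 2) / d"
    have t: "0 \<le> t" "t * d = c + 2" using c0 d by (auto simp: t_def)
    let ?\<alpha> = "(- t) *\<^sub>R v"
    obtain \<beta> s where bs: "(\<beta>, s) \<in> epi" "H ?\<alpha> - 1 \<le> ?\<alpha> \<bullet> \<beta> - s" using epi_dual[of 1 ?\<alpha>] by auto
    have "t * b \<le> t * (v \<bullet> \<beta>)" using b1[OF bs(1)] 3 t(1) by (intro mult_left_mono) auto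
    then have "H ?\<alpha> - 1 \<le> - (t * b)" using bs(2) epi_nonneg[OF bs(1)] by simp
    moreover have "t * d = t * b - t * (v \<bullet> \<beta>\<^sub>0)" by (simp add: d_def algebra_simps)
    ultimately show False using c[of ?\<alpha>] t(2) by simp
  qed
qed

text \<open>The walk starts at the deterministic first summand \<open>g y\<^sub>0\<close> of \<open>S\<^sub>n\<close>, which leaves \<open>n - 1\<close> steps.\<close>

lemma ldp_lower:
  fixes c \<epsilon> :: real
  assumes \<beta>: "\<beta> \<in> interior A" and c: "rate_L p g \<beta> \<le> ereal c" and \<epsilon>: "0 < \<epsilon>"
  shows "\<forall>\<^sub>F n in sequentially. ennreal (exp (- (n * (c + \<epsilon>)))) \<le>
    walk (n - 1) (\<lambda>v. indicator A ((1 / real n) *\<^sub>R v)) y\<^sub>0 (g y\<^sub>0)"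
proof -
  have "\<alpha> \<bullet> \<beta> - H \<alpha> \<le> c" for \<alpha>
  proof -
    have "ereal (\<alpha> \<bullet> \<beta> - H \<alpha>) \<le> rate_L p g \<beta>" unfolding rate_L_def by (rule SUP_upper) simp
    with c show ?thesis using order_trans by fastforce
  qed
  then have epi: "(\<beta>, c) \<in> epi" by (rule epi_of_legendre_le)
  obtain e where e: "0 < e" "cball \<beta> e \<subseteq> A" using \<beta> by (auto simp: mem_interior_cball)
  \<comment> \<open>Half of \<open>e\<close> is for the radius of the ball to be hit; the other half
    takes up the first summand and the passage from n - 1 to n steps.\<close>
  define \<eta> where "\<eta> = min (e / 2) \<epsilon>"
  have \<eta>: "0 < \<eta>" "\<eta> \<le> e / 2" "\<eta> \<le> \<epsilon>" using e \<epsilon> by (auto simp: \<eta>_def)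
  have "\<forall>\<^sub>F n in sequentially. \<forall>x. ennreal (exp (- (real (n - 1) * (c + \<eta>)))) \<le>
      hit (n - 1) x (real (n - 1) *\<^sub>R \<beta>) (real (n - 1) * \<eta>)"
    using filterlim_iff[THEN iffD1, OF filterlim_minus_const_nat_at_top[of 1]] epiD[OF epi \<eta>(1)] by blast
  moreover have "\<forall>\<^sub>F n in sequentially. R + norm \<beta> \<le> e / 2 * n - 1"
    using e by (intro eventually_linear_ge) simp
  ultimately show ?thesis
    using eventually_gt_at_top[of 0]
  proof eventually_elim
    case (elim n)
    let ?k = "n - 1"
    have n: "real n = real ?k + 1" using elim(3) by simp
    have c0: "0 \<le> c + \<eta>" using epi_nonneg[OF epi] \<eta> by simp
    have "real ?k * (c + \<eta>) \<le> real n * (c + \<epsilon>)" using c0 \<eta>(3) by (intro mult_mono) auto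
    then have "ennreal (exp (- (n * (c + \<epsilon>)))) \<le> ennreal (exp (- (real ?k * (c + \<eta>))))" by simp
    also have "\<dots> \<le> walk ?k (indicator (cball (real ?k *\<^sub>R \<beta>) (real ?k * \<eta>))) y\<^sub>0 0"
      using elim(1) by (simp add: hit_def)
    also have "\<dots> \<le> walk ?k (\<lambda>v. indicator A ((1 / real n) *\<^sub>R (v + g y\<^sub>0))) y\<^sub>0 0"
    proof (rule walk_mono)
      fix v
      have "(1 / real n) *\<^sub>R (v + g y\<^sub>0) \<in> A" if v: "dist (real ?k *\<^sub>R \<beta>) v \<le> real ?k * \<eta>"
      proof -
        have eq: "real n *\<^sub>R \<beta> - (v + g y\<^sub>0) = (real ?k *\<^sub>R \<beta> - v) + (\<beta> - g y\<^sub>0)"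
          by (simp only: n) (simp add: algebra_simps)
        have "norm (real n *\<^sub>R \<beta> - (v + g y\<^sub>0)) \<le> real ?k * \<eta> + (norm \<beta> + R)"
          using norm_triangle_ineq[of "real ?k *\<^sub>R \<beta> - v" "\<beta> - g y\<^sub>0"] v
            norm_triangle_ineq4[of \<beta> "g y\<^sub>0"] g_le[of y\<^sub>0] unfolding eq dist_norm by linarith
        also have "real ?k * \<eta> \<le> n * (e / 2)" using \<eta> by (intro mult_mono) auto
        also have "n * (e / 2) + (norm \<beta> + R) \<le> n * e" using elim(2) by (simp add: algebra_simps)
        finally have le: "norm (real n *\<^sub>R \<beta> - (v + g y\<^sub>0)) \<le> n * e" by simp
        have "\<beta> - (1 / real n) *\<^sub>R (v + g y\<^sub>0) = (1 / real n) *\<^sub>R (real n *\<^sub>R \<beta> - (v + g y\<^sub>0))"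
          using elim(3) by (simp add: scaleR_diff_right)
        then have "dist \<beta> ((1 / real n) *\<^sub>R (v + g y\<^sub>0)) = norm (real n *\<^sub>R \<beta> - (v + g y\<^sub>0)) / n"
          by (simp only: dist_norm norm_scaleR) simp
        also have "\<dots> \<le> e" using le elim(3) by (simp add: pos_divide_le_eq mult.commute)
        finally have "dist \<beta> ((1 / real n) *\<^sub>R (v + g y\<^sub>0)) \<le> e" .
        with e show ?thesis by auto
      qed
      then show "(indicator (cball (real ?k *\<^sub>R \<beta>) (real ?k * \<eta>)) v :: ennreal)
          \<le> indicator A ((1 / real n) *\<^sub>R (v + g y\<^sub>0))"
        by (auto simp: indicator_def)
    qed
    also have "\<dots> = walk ?k (\<lambda>v. indicator A ((1 / real n) *\<^sub>R v)) y\<^sub>0 (g y\<^sub>0)"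
      using walk_translate[of ?k "\<lambda>v. indicator A ((1 / real n) *\<^sub>R v)" "g y\<^sub>0" y\<^sub>0 0] by simp
    finally show ?case .
  qed
qed

subsection \<open>The controlled chain\<close>

definition dens :: "real^'d \<Rightarrow> 's \<Rightarrow> 's \<Rightarrow> real" where
  "dens \<alpha> x y = exp (\<alpha> \<bullet> g y - H \<alpha>) * (r\<^sub>0 \<alpha> y / r\<^sub>0 \<alpha> x)"

lemma dens_pos: "0 < dens \<alpha> x y"
  by (simp add: dens_def r_pos)

lemma dens_measurable [measurable]:
  assumes [measurable]: "a \<in> borel_measurable M" "b \<in> borel_measurable M" "c \<in> borel_measurable M"
  shows "(\<lambda>\<omega>. dens (a \<omega>) (b \<omega>) (c \<omega>)) \<in> borel_measurable M"
proof -
  have "(\<lambda>\<omega>. (a \<omega>, c \<omega>, b \<omega>)) \<in> M \<rightarrow>\<^sub>M borel \<Otimes>\<^sub>M (borel \<Otimes>\<^sub>M borel)" by measurable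
  from measurable_compose[OF this r_ratio_measurable]
  have [measurable]: "(\<lambda>\<omega>. r\<^sub>0 (a \<omega>) (c \<omega>) / r\<^sub>0 (a \<omega>) (b \<omega>)) \<in> borel_measurable M" by simp
  show ?thesis unfolding dens_def by measurable
qed

lemma step_measurable:
  assumes [measurable]: "(\<lambda>(x, v). \<Phi> x v) \<in> borel_measurable (borel \<Otimes>\<^sub>M borel)"
  shows "(\<lambda>y. ennreal (dens \<alpha> x y * (1 / dens \<alpha> x y) ^ q) * \<Phi> y (s + g y)) \<in> borel_measurable (p z)"
  by measurable

lemma twisted_kernel_eq: "twisted_kernel p g \<alpha> x = density (p x) (\<lambda>y. ennreal (dens \<alpha> x y))"
  by (simp add: twisted_kernel_def dens_def)

text \<open>This is the eigenvalue equation divided by its right-hand side.\<close>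

lemma dens_nn_integral: "(\<integral>\<^sup>+y. ennreal (dens \<alpha> x y) \<partial>p x) = 1"
proof -
  let ?c = "exp (- H \<alpha>) / r\<^sub>0 \<alpha> x"
  have [measurable]: "r\<^sub>0 \<alpha> \<in> borel_measurable borel" by (rule bdd_borel_measurable[OF r_bdd_borel])
  have "(\<integral>\<^sup>+y. ennreal (dens \<alpha> x y) \<partial>p x) = (\<integral>\<^sup>+y. ennreal ?c * ennreal (exp (\<alpha> \<bullet> g y) * r\<^sub>0 \<alpha> y) \<partial>p x)"
    using r_pos[of \<alpha>] by (intro nn_integral_cong)
      (simp add: dens_def exp_diff exp_minus field_simps less_imp_le flip: ennreal_mult)
  also have "\<dots> = ennreal ?c * ennreal (exp (H \<alpha>) * r\<^sub>0 \<alpha> x)"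
    using tilt_nn_integral[OF r_bdd_borel[of \<alpha>] less_imp_le[OF r_pos[of \<alpha>]], of x \<alpha>]
    by (simp add: nn_integral_cmult tilt_r)
  also have "\<dots> = 1"
    using r_pos[of \<alpha> x] by (simp add: exp_minus field_simps less_imp_le flip: ennreal_mult)
  finally show ?thesis .
qed

lemma twisted_kernel_prob: "prob_space (twisted_kernel p g \<alpha> x)"
  by (intro prob_spaceI) (simp add: twisted_kernel_eq emeasure_density dens_nn_integral)

lemma twisted_kernel_measurable:
  assumes [measurable]: "a \<in> borel_measurable M" "b \<in> borel_measurable M"
  shows "(\<lambda>\<omega>. twisted_kernel p g (a \<omega>) (b \<omega>)) \<in> M \<rightarrow>\<^sub>M subprob_algebra borel"
proof (rule measurable_subprob_algebra)
  fix \<omega>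
  show "subprob_space (twisted_kernel p g (a \<omega>) (b \<omega>))"
    by (rule prob_space_imp_subprob_space[OF twisted_kernel_prob])
  show "sets (twisted_kernel p g (a \<omega>) (b \<omega>)) = sets borel" by (simp add: twisted_kernel_eq)
next
  fix B :: "'s set" assume [measurable]: "B \<in> sets borel"
  have "(\<lambda>\<omega>. \<integral>\<^sup>+y. ennreal (dens (a \<omega>) (b \<omega>) y) * indicator B y \<partial>p (b \<omega>)) \<in> borel_measurable M"
    by (rule nn_integral_measurable_subprob_algebra2[where N=borel]) measurable
  then show "(\<lambda>\<omega>. emeasure (twisted_kernel p g (a \<omega>) (b \<omega>)) B) \<in> borel_measurable M"
    by (simp add: twisted_kernel_eq emeasure_density)
qed

abbreviation path_space :: "nat \<Rightarrow> (nat \<Rightarrow> 's) measure" where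
  "path_space k \<equiv> PiM {0..<k} (\<lambda>_. borel)"

lemma coordinate_measurable:
  "i < k \<Longrightarrow> (\<lambda>\<omega>. \<omega> i) \<in> path_space k \<rightarrow>\<^sub>M borel"
  by (rule measurable_component_singleton) simp

lemma S_bar_measurable: "j \<le> k \<Longrightarrow> S_bar g j \<in> borel_measurable (path_space k)"
proof -
  assume jk: "j \<le> k"
  have "(\<lambda>\<omega>. g (\<omega> i)) \<in> borel_measurable (path_space k)" if "i < j" for i
    by (rule measurable_compose[OF coordinate_measurable g_meas]) (use that jk in simp)
  then show ?thesis unfolding S_bar_def by (intro borel_measurable_sum) auto
qed

lemma S_bar_upd: "S_bar g k (fun_upd \<omega> k y) = S_bar g k \<omega>"
  unfolding S_bar_def by (intro sum.cong) auto

lemma S_bar_Suc_upd: "S_bar g (Suc k) (fun_upd \<omega> k y) = S_bar g k \<omega> + g y"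
  using S_bar_upd[of k \<omega> y] by (simp add: S_bar_def)

lemma S_bar_upd_less: "j \<le> k \<Longrightarrow> S_bar g j (fun_upd \<omega> k y) = S_bar g j \<omega>"
  unfolding S_bar_def by (intro sum.cong) auto

end

section \<open>The likelihood ratio and the moments of the estimator\<close>

locale controlled_chain = bounded_chain p g R D m
  for p :: "'s::polish_space \<Rightarrow> 's measure" and g :: "'s \<Rightarrow> real^'d::finite" and R D m +
  fixes y\<^sub>0 :: 's and n :: nat and u :: "('s, 'd) control"
  assumes u: "u \<in> controls n" and n_pos: "1 \<le> n"
begin

abbreviation "ctrl j \<omega> \<equiv> applied_control g n u j \<omega>"

lemma ctrl_measurable:
  assumes "j \<in> {1..<n}" "j \<le> k"
  shows "(\<lambda>\<omega>. ctrl j \<omega>) \<in> borel_measurable (path_space k)"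
proof -
  have [measurable]: "u j \<in> borel_measurable (borel \<Otimes>\<^sub>M borel)"
    using u assms by (simp add: controls_def borel_prod)
  have [measurable]: "S_bar g j \<in> borel_measurable (path_space k)"
    using assms by (intro S_bar_measurable) auto
  have [measurable]: "(\<lambda>\<omega>. \<omega> (j - 1)) \<in> path_space k \<rightarrow>\<^sub>M borel"
    using assms by (intro coordinate_measurable) auto
  show ?thesis unfolding applied_control_def by measurable
qed

lemma ctrl_upd: "1 \<le> j \<Longrightarrow> j \<le> k \<Longrightarrow> ctrl j (fun_upd \<omega> k y) = ctrl j \<omega>"
  by (cases j) (auto simp: applied_control_def S_bar_upd_less)

sublocale IT: Ionescu_Tulcea "control_step p g y\<^sub>0 n u" "\<lambda>_. borel"
proof (rule Ionescu_Tulcea.intro)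
  fix j
  show "control_step p g y\<^sub>0 n u j \<in> path_space j \<rightarrow>\<^sub>M subprob_algebra borel"
  proof (cases "j \<in> {1..<n}")
    case True
    then have "control_step p g y\<^sub>0 n u j = (\<lambda>\<omega>. twisted_kernel p g (ctrl j \<omega>) (\<omega> (j - 1)))"
      by (auto simp: control_step_def)
    moreover have "(\<lambda>\<omega>. twisted_kernel p g (ctrl j \<omega>) (\<omega> (j - 1))) \<in> path_space j \<rightarrow>\<^sub>M subprob_algebra borel"
      using True by (intro twisted_kernel_measurable ctrl_measurable coordinate_measurable) auto
    ultimately show ?thesis by simp
  next
    case False
    then have "control_step p g y\<^sub>0 n u j = (\<lambda>\<omega>. return borel y\<^sub>0)"
      by (auto simp: control_step_def)
    then show ?thesis by (simp add: prob_space_imp_subprob_space prob_space_return space_subprob_algebra)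
  qed
next
  fix j \<omega>
  show "prob_space (control_step p g y\<^sub>0 n u j \<omega>)"
    by (auto simp: control_step_def intro: twisted_kernel_prob prob_space_return)
qed

text \<open>Law of the first \<open>k\<close> states, with the horizon \<open>n\<close> of the
  control fixed, so that inductions over time can run up to \<open>law n\<close>.\<close>

definition law :: "nat \<Rightarrow> (nat \<Rightarrow> 's) measure" where
  "law k = IT.C 0 k (\<lambda>_. undefined)"

lemma law_n: "controlled_law p g y\<^sub>0 n u = law n"
  by (simp add: controlled_law_def law_def)

lemma undef_space [simp]: "(\<lambda>_. undefined) \<in> space (path_space 0)"
  by (simp add: space_PiM)

lemma sets_law [measurable_cong]: "sets (law k) = sets (path_space k)"
  using IT.sets_C[OF undef_space, of k] by (simp add: law_def)

lemma space_law: "space (law k) = space (path_space k)"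
  by (rule sets_eq_imp_space_eq[OF sets_law])

lemma prob_space_law: "prob_space (law k)"
  unfolding law_def by (rule IT.prob_space_C[OF undef_space])

lemma law_Suc:
  assumes [measurable]: "F \<in> borel_measurable (path_space (Suc k))"
  shows "(\<integral>\<^sup>+\<omega>. F \<omega> \<partial>law (Suc k)) = (\<integral>\<^sup>+\<omega>. \<integral>\<^sup>+y. F (fun_upd \<omega> k y) \<partial>control_step p g y\<^sub>0 n u k \<omega> \<partial>law k)"
proof -
  have "law (Suc k) = law k \<bind> IT.eP k" by (simp add: law_def)
  moreover have "IT.eP k \<in> law k \<rightarrow>\<^sub>M subprob_algebra (path_space (Suc k))"
    using IT.measurable_eP[of k] by (simp add: measurable_cong_sets[OF sets_law refl])
  ultimately have "(\<integral>\<^sup>+\<omega>. F \<omega> \<partial>law (Suc k)) = (\<integral>\<^sup>+\<omega>. \<integral>\<^sup>+\<omega>'. F \<omega>' \<partial>IT.eP k \<omega> \<partial>law k)"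
    using assms by (simp add: nn_integral_bind[where B="path_space (Suc k)"])
  also have "\<dots> = (\<integral>\<^sup>+\<omega>. \<integral>\<^sup>+y. F (fun_upd \<omega> k y) \<partial>control_step p g y\<^sub>0 n u k \<omega> \<partial>law k)"
    by (intro nn_integral_cong IT.nn_integral_eP assms) (simp add: space_law)
  finally show ?thesis .
qed

lemma upd_measurable:
  assumes "F \<in> borel_measurable (path_space (Suc k))" "\<omega> \<in> space (path_space k)"
  shows "(\<lambda>y. F (fun_upd \<omega> k y)) \<in> borel_measurable borel"
  using assms(2) by (intro measurable_compose[OF measurable_fun_upd[where J="{0..<k}"] assms(1)]) auto

lemma law_1:
  assumes F: "F \<in> borel_measurable (path_space 1)"
  shows "(\<integral>\<^sup>+\<omega>. F \<omega> \<partial>law 1) = F (fun_upd (\<lambda>_. undefined) 0 y\<^sub>0)"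
proof -
  have "(\<integral>\<^sup>+\<omega>. F \<omega> \<partial>law 1) = (\<integral>\<^sup>+\<omega>. \<integral>\<^sup>+y. F (fun_upd \<omega> 0 y) \<partial>return borel y\<^sub>0 \<partial>law 0)"
    using law_Suc[of F 0] F by (simp add: control_step_def)
  also have "\<dots> = (\<integral>\<^sup>+\<omega>. F (fun_upd \<omega> 0 y\<^sub>0) \<partial>law 0)"
    using F by (intro nn_integral_cong nn_integral_return upd_measurable) (auto simp: space_law)
  also have "\<dots> = F (fun_upd (\<lambda>_. undefined) 0 y\<^sub>0)"
  proof -
    have "(\<lambda>\<omega>. F (fun_upd \<omega> 0 y\<^sub>0)) \<in> borel_measurable (path_space 0)"
      by (intro measurable_compose[OF measurable_fun_upd[where J="{}"] F]) auto
    then show ?thesis by (simp add: law_def nn_integral_return)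
  qed
  finally show ?thesis .
qed

lemma law_step:
  assumes k: "k \<in> {1..<n}" and F: "F \<in> borel_measurable (path_space (Suc k))"
  shows "(\<integral>\<^sup>+\<omega>. F \<omega> \<partial>law (Suc k)) =
    (\<integral>\<^sup>+\<omega>. \<integral>\<^sup>+y. ennreal (dens (ctrl k \<omega>) (\<omega> (k - 1)) y) * F (fun_upd \<omega> k y) \<partial>p (\<omega> (k - 1)) \<partial>law k)"
  unfolding law_Suc[OF F]
proof (rule nn_integral_cong)
  fix \<omega> assume "\<omega> \<in> space (law k)"
  then have [measurable]: "(\<lambda>y. F (fun_upd \<omega> k y)) \<in> borel_measurable borel"
    by (intro upd_measurable F) (simp add: space_law)
  show "(\<integral>\<^sup>+y. F (fun_upd \<omega> k y) \<partial>control_step p g y\<^sub>0 n u k \<omega>) =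
    (\<integral>\<^sup>+y. ennreal (dens (ctrl k \<omega>) (\<omega> (k - 1)) y) * F (fun_upd \<omega> k y) \<partial>p (\<omega> (k - 1)))"
    using k by (simp add: control_step_def twisted_kernel_eq nn_integral_density)
qed

text \<open>Likelihood ratio of the original chain with respect to the controlled one along the
  first \<open>k\<close> states.\<close>

definition wt :: "nat \<Rightarrow> (nat \<Rightarrow> 's) \<Rightarrow> real" where
  "wt k \<omega> = (\<Prod>j\<in>{1..<k}. 1 / dens (ctrl j \<omega>) (\<omega> (j - 1)) (\<omega> j))"

lemma wt_pos: "0 < wt k \<omega>"
  by (auto simp: wt_def dens_pos intro!: prod_pos)

lemma wt_measurable:
  assumes "k \<le> n" shows "wt k \<in> borel_measurable (path_space k)"
proof -
  have "(\<lambda>\<omega>. 1 / dens (ctrl j \<omega>) (\<omega> (j - 1)) (\<omega> j)) \<in> borel_measurable (path_space k)"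
    if "j \<in> {1..<k}" for j
    using that assms
    by (intro borel_measurable_divide dens_measurable ctrl_measurable coordinate_measurable) auto
  then show ?thesis unfolding wt_def by (intro borel_measurable_prod)
qed

lemma wt_upd:
  assumes "1 \<le> k"
  shows "wt (Suc k) (fun_upd \<omega> k y) = wt k \<omega> * (1 / dens (ctrl k \<omega>) (\<omega> (k - 1)) y)"
proof -
  have "{1..<Suc k} = insert k {1..<k}" using assms by auto
  moreover have "(\<Prod>j\<in>{1..<k}. 1 / dens (ctrl j (fun_upd \<omega> k y)) ((fun_upd \<omega> k y) (j - 1)) ((fun_upd \<omega> k y) j)) = wt k \<omega>"
    unfolding wt_def by (intro prod.cong) (auto simp: ctrl_upd)
  moreover have "k - 1 \<noteq> k" using assms by simp
  ultimately show ?thesis using assms by (simp add: wt_def ctrl_upd)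
qed

lemma X_bar_eq: "X_bar p g A n u \<omega> = indicator A ((1 / real n) *\<^sub>R S_bar g n \<omega>) * wt n \<omega>"
proof -
  have "exp (\<Sum>j\<in>{1..<n}. - (ctrl j \<omega> \<bullet> g (\<omega> j)) + H (ctrl j \<omega>)) *
     (\<Prod>j\<in>{1..<n}. r\<^sub>0 (ctrl j \<omega>) (\<omega> (j - 1)) / r\<^sub>0 (ctrl j \<omega>) (\<omega> j)) = wt n \<omega>"
    unfolding wt_def exp_sum[OF finite_atLeastLessThan] prod.distrib[symmetric]
    by (intro prod.cong) (auto simp: dens_def exp_diff exp_add exp_minus field_simps)
  then show ?thesis by (simp add: X_bar_def mult.assoc)
qed

text \<open>With \<open>q = 1\<close> this is the likelihood ratio identity, with \<open>q = 2\<close> the recursion for second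
  moments.\<close>

lemma weighted_step:
  assumes k: "k \<in> {1..<n}"
    and \<Phi> [measurable]: "(\<lambda>(x, v). \<Phi> x v) \<in> borel_measurable (borel \<Otimes>\<^sub>M borel)"
  shows "(\<integral>\<^sup>+\<omega>. ennreal (wt (Suc k) \<omega> ^ q) * \<Phi> (\<omega> k) (S_bar g (Suc k) \<omega>) \<partial>law (Suc k)) =
    (\<integral>\<^sup>+\<omega>. ennreal (wt k \<omega> ^ q) *
      (\<integral>\<^sup>+y. ennreal (dens (ctrl k \<omega>) (\<omega> (k - 1)) y * (1 / dens (ctrl k \<omega>) (\<omega> (k - 1)) y) ^ q) *
         \<Phi> y (S_bar g k \<omega> + g y) \<partial>p (\<omega> (k - 1))) \<partial>law k)"
proof -
  have [measurable]: "wt (Suc k) \<in> borel_measurable (path_space (Suc k))"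
    using k by (intro wt_measurable) auto
  have [measurable]: "S_bar g (Suc k) \<in> borel_measurable (path_space (Suc k))" by (rule S_bar_measurable) simp
  have [measurable]: "(\<lambda>\<omega>. \<omega> k) \<in> path_space (Suc k) \<rightarrow>\<^sub>M borel" by (rule coordinate_measurable) simp
  have F: "(\<lambda>\<omega>. ennreal (wt (Suc k) \<omega> ^ q) * \<Phi> (\<omega> k) (S_bar g (Suc k) \<omega>)) \<in> borel_measurable (path_space (Suc k))"
    by measurable
  show ?thesis
    unfolding law_step[OF k F]
  proof (rule nn_integral_cong)
    fix \<omega>
    let ?d = "\<lambda>y. dens (ctrl k \<omega>) (\<omega> (k - 1)) y"
    have "ennreal (?d y) * (ennreal (wt (Suc k) (fun_upd \<omega> k y) ^ q) * \<Phi> ((fun_upd \<omega> k y) k) (S_bar g (Suc k) (fun_upd \<omega> k y)))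
      = ennreal (wt k \<omega> ^ q) * (ennreal (?d y * (1 / ?d y) ^ q) * \<Phi> y (S_bar g k \<omega> + g y))" for y
    proof -
      have "1 \<le> k" using k by simp
      have "ennreal (?d y) * ennreal (wt (Suc k) (fun_upd \<omega> k y) ^ q) = ennreal (wt k \<omega> ^ q) * ennreal (?d y * (1 / ?d y) ^ q)"
        unfolding wt_upd[OF \<open>1 \<le> k\<close>] power_mult_distrib
        using dens_pos[of "ctrl k \<omega>" "\<omega> (k - 1)" y] wt_pos[of k \<omega>]
        by (simp add: less_imp_le ac_simps flip: ennreal_mult)
      then show ?thesis by (simp add: S_bar_Suc_upd mult.assoc[symmetric])
    qed
    moreover have "(\<lambda>y. ennreal (?d y * (1 / ?d y) ^ q) * \<Phi> y (S_bar g k \<omega> + g y)) \<in> borel_measurable (p (\<omega> (k - 1)))"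
      by (rule step_measurable[OF \<Phi>])
    ultimately show "(\<integral>\<^sup>+y. ennreal (?d y) * (ennreal (wt (Suc k) (fun_upd \<omega> k y) ^ q) *
        \<Phi> ((fun_upd \<omega> k y) k) (S_bar g (Suc k) (fun_upd \<omega> k y))) \<partial>p (\<omega> (k - 1))) =
      ennreal (wt k \<omega> ^ q) * (\<integral>\<^sup>+y. ennreal (?d y * (1 / ?d y) ^ q) * \<Phi> y (S_bar g k \<omega> + g y) \<partial>p (\<omega> (k - 1)))"
      by (simp only: nn_integral_cmult)
  qed
qed

lemma weighted_1:
  assumes [measurable]: "(\<lambda>(x, v). \<Phi> x v) \<in> borel_measurable (borel \<Otimes>\<^sub>M borel)"
  shows "(\<integral>\<^sup>+\<omega>. ennreal (wt 1 \<omega> ^ q) * \<Phi> (\<omega> (1 - 1)) (S_bar g 1 \<omega>) \<partial>law 1) = \<Phi> y\<^sub>0 (g y\<^sub>0)"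
proof -
  have [measurable]: "wt 1 \<in> borel_measurable (path_space 1)" using n_pos by (rule wt_measurable)
  have [measurable]: "S_bar g 1 \<in> borel_measurable (path_space 1)" by (rule S_bar_measurable) simp
  have [measurable]: "(\<lambda>\<omega>. \<omega> (1 - 1)) \<in> path_space 1 \<rightarrow>\<^sub>M borel" by (rule coordinate_measurable) simp
  show ?thesis
    by (subst law_1) (measurable, simp add: wt_def S_bar_def)
qed

text \<open>Let the control be switched off at time k, after which the original chain runs. The
  weighted expectation does not depend on k, because \<open>dens\<close> cancels against the new
  factor of \<open>wt\<close>; the two sides are the cases k = n and k = 1.\<close>

lemma first_moment:
  assumes [measurable]: "f \<in> borel_measurable borel"
  shows "(\<integral>\<^sup>+\<omega>. ennreal (wt n \<omega>) * f (S_bar g n \<omega>) \<partial>law n) = walk (n - 1) f y\<^sub>0 (g y\<^sub>0)"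
proof -
  have "(\<integral>\<^sup>+\<omega>. ennreal (wt k \<omega> ^ 1) * walk (n - k) f (\<omega> (k - 1)) (S_bar g k \<omega>) \<partial>law k) = walk (n - 1) f y\<^sub>0 (g y\<^sub>0)"
    if "1 \<le> k" "k \<le> n" for k
    using that
  proof (induction k rule: dec_induct)
    case base
    show ?case by (rule weighted_1) measurable
  next
    case (step k)
    have k: "k \<in> {1..<n}" using step by auto
    have nk: "n - k = Suc (n - Suc k)" using k by auto
    have "(\<integral>\<^sup>+\<omega>. ennreal (wt (Suc k) \<omega> ^ 1) * walk (n - Suc k) f (\<omega> (Suc k - 1)) (S_bar g (Suc k) \<omega>) \<partial>law (Suc k))
      = (\<integral>\<^sup>+\<omega>. ennreal (wt k \<omega> ^ 1) *
      (\<integral>\<^sup>+y. ennreal (dens (ctrl k \<omega>) (\<omega> (k - 1)) y * (1 / dens (ctrl k \<omega>) (\<omega> (k - 1)) y) ^ 1) *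
         walk (n - Suc k) f y (S_bar g k \<omega> + g y) \<partial>p (\<omega> (k - 1))) \<partial>law k)"
      using weighted_step[OF k walk_measurable[OF assms], of 1] by simp
    also have "\<dots> = (\<integral>\<^sup>+\<omega>. ennreal (wt k \<omega> ^ 1) * walk (n - k) f (\<omega> (k - 1)) (S_bar g k \<omega>) \<partial>law k)"
      using dens_pos by (simp add: nk less_imp_neq[symmetric])
    also have "\<dots> = walk (n - 1) f y\<^sub>0 (g y\<^sub>0)" using step by simp
    finally show ?case .
  qed
  from this[of n] n_pos show ?thesis by simp
qed

lemma second_moment_lower:
  assumes [measurable]: "A \<in> sets borel"
  shows "(walk (n - 1) (\<lambda>v. indicator A ((1 / real n) *\<^sub>R v)) y\<^sub>0 (g y\<^sub>0))\<^sup>2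
    \<le> (\<integral>\<^sup>+\<omega>. ennreal ((X_bar p g A n u \<omega>)\<^sup>2) \<partial>controlled_law p g y\<^sub>0 n u)"
proof -
  interpret law: prob_space "law n" by (rule prob_space_law)
  let ?f = "\<lambda>v. indicator A ((1 / real n) *\<^sub>R v) :: ennreal"
  have [measurable]: "wt n \<in> borel_measurable (path_space n)" by (rule wt_measurable) simp
  have [measurable]: "S_bar g n \<in> borel_measurable (path_space n)" by (rule S_bar_measurable) simp
  have "walk (n - 1) ?f y\<^sub>0 (g y\<^sub>0) = (\<integral>\<^sup>+\<omega>. ennreal (wt n \<omega>) * ?f (S_bar g n \<omega>) \<partial>law n)"
    by (rule first_moment[symmetric]) measurable
  also have "\<dots> = (\<integral>\<^sup>+\<omega>. ennreal (X_bar p g A n u \<omega>) * 1 \<partial>law n)"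
    by (intro nn_integral_cong) (auto simp: X_bar_eq indicator_def)
  finally have "(walk (n - 1) ?f y\<^sub>0 (g y\<^sub>0))\<^sup>2 = (\<integral>\<^sup>+\<omega>. ennreal (X_bar p g A n u \<omega>) * 1 \<partial>law n)\<^sup>2" by simp
  also have "\<dots> \<le> (\<integral>\<^sup>+\<omega>. (ennreal (X_bar p g A n u \<omega>))\<^sup>2 \<partial>law n) * (\<integral>\<^sup>+\<omega>. 1\<^sup>2 \<partial>law n)"
    unfolding X_bar_eq by (rule Cauchy_Schwarz_nn_integral) measurable
  also have "\<dots> = (\<integral>\<^sup>+\<omega>. ennreal ((X_bar p g A n u \<omega>)\<^sup>2) \<partial>law n)"
    using law.emeasure_space_1 wt_pos[of n]
    by (simp add: X_bar_eq ennreal_power less_imp_le)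
  finally show ?thesis by (simp add: law_n)
qed

text \<open>A verification argument: the expectation of \<Phi> weighted by the squared likelihood
  ratio does not increase with time. Sampling contributes \<open>dens\<close> and the squared weight
  its inverse square, which is why a single \<open>1 / dens\<close> appears under \<open>p x\<close>
  in \<open>step\<close>.\<close>

lemma second_moment_upper:
  fixes \<Phi> :: "nat \<Rightarrow> 's \<Rightarrow> real^'d \<Rightarrow> ennreal"
  assumes [measurable]: "\<And>k. (\<lambda>(x, v). \<Phi> k x v) \<in> borel_measurable (borel \<Otimes>\<^sub>M borel)"
    and step: "\<And>k x v. k \<in> {1..<n} \<Longrightarrow>
      (\<integral>\<^sup>+y. ennreal (1 / dens (u k (x, (1 / real n) *\<^sub>R v)) x y) * \<Phi> (Suc k) y (v + g y) \<partial>p x) \<le> \<Phi> k x v"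
    and final: "\<And>x v. norm v \<le> n * R \<Longrightarrow> indicator A ((1 / real n) *\<^sub>R v) \<le> \<Phi> n x v"
  shows "(\<integral>\<^sup>+\<omega>. ennreal ((X_bar p g A n u \<omega>)\<^sup>2) \<partial>controlled_law p g y\<^sub>0 n u) \<le> \<Phi> 1 y\<^sub>0 (g y\<^sub>0)"
proof -
  have "(\<integral>\<^sup>+\<omega>. ennreal (wt k \<omega> ^ 2) * \<Phi> k (\<omega> (k - 1)) (S_bar g k \<omega>) \<partial>law k) \<le> \<Phi> 1 y\<^sub>0 (g y\<^sub>0)"
    if "1 \<le> k" "k \<le> n" for k
    using that
  proof (induction k rule: dec_induct)
    case base
    show ?case by (rule eq_refl[OF weighted_1]) measurable
  next
    case (step k)
    have k: "k \<in> {1..<n}" using step by auto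
    have "(\<integral>\<^sup>+\<omega>. ennreal (wt (Suc k) \<omega> ^ 2) * \<Phi> (Suc k) (\<omega> (Suc k - 1)) (S_bar g (Suc k) \<omega>) \<partial>law (Suc k))
      = (\<integral>\<^sup>+\<omega>. ennreal (wt k \<omega> ^ 2) *
      (\<integral>\<^sup>+y. ennreal (dens (ctrl k \<omega>) (\<omega> (k - 1)) y * (1 / dens (ctrl k \<omega>) (\<omega> (k - 1)) y) ^ 2) *
         \<Phi> (Suc k) y (S_bar g k \<omega> + g y) \<partial>p (\<omega> (k - 1))) \<partial>law k)"
      using weighted_step[OF k assms(1), of 2 "Suc k"] by simp
    also have "\<dots> \<le> (\<integral>\<^sup>+\<omega>. ennreal (wt k \<omega> ^ 2) * \<Phi> k (\<omega> (k - 1)) (S_bar g k \<omega>) \<partial>law k)"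
    proof (intro nn_integral_mono mult_left_mono)
      fix \<omega>
      have "a * (1 / a) ^ 2 = 1 / a" if "0 < a" for a :: real using that by (simp add: power2_eq_square)
      then show "(\<integral>\<^sup>+y. ennreal (dens (ctrl k \<omega>) (\<omega> (k - 1)) y * (1 / dens (ctrl k \<omega>) (\<omega> (k - 1)) y) ^ 2) *
         \<Phi> (Suc k) y (S_bar g k \<omega> + g y) \<partial>p (\<omega> (k - 1))) \<le> \<Phi> k (\<omega> (k - 1)) (S_bar g k \<omega>)"
        using assms(2)[OF k, of "\<omega> (k - 1)" "S_bar g k \<omega>"] dens_pos by (simp add: applied_control_def)
    qed simp
    also have "\<dots> \<le> \<Phi> 1 y\<^sub>0 (g y\<^sub>0)" using step by simp
    finally show ?case .
  qed
  from this[of n] have "(\<integral>\<^sup>+\<omega>. ennreal (wt n \<omega> ^ 2) * \<Phi> n (\<omega> (n - 1)) (S_bar g n \<omega>) \<partial>law n) \<le> \<Phi> 1 y\<^sub>0 (g y\<^sub>0)"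
    using n_pos by simp
  moreover have "ennreal ((X_bar p g A n u \<omega>)\<^sup>2) \<le> ennreal (wt n \<omega> ^ 2) * \<Phi> n (\<omega> (n - 1)) (S_bar g n \<omega>)" for \<omega>
  proof -
    have "norm (S_bar g n \<omega>) \<le> n * R"
      unfolding S_bar_def using sum_norm_bound[of "{..<n}" "\<lambda>i. g (\<omega> i)" R] g_le by simp
    from final[OF this] have "indicator A ((1 / real n) *\<^sub>R S_bar g n \<omega>) \<le> \<Phi> n (\<omega> (n - 1)) (S_bar g n \<omega>)" .
    then have "ennreal (wt n \<omega> ^ 2) * indicator A ((1 / real n) *\<^sub>R S_bar g n \<omega>)
      \<le> ennreal (wt n \<omega> ^ 2) * \<Phi> n (\<omega> (n - 1)) (S_bar g n \<omega>)" by (rule mult_left_mono) simp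
    then show ?thesis by (auto simp: X_bar_eq indicator_def)
  qed
  ultimately show ?thesis unfolding law_n by (rule order_trans[OF nn_integral_mono, rotated])
qed

end

lemma exp_le_quadratic:
  fixes z :: real
  assumes "\<bar>z\<bar> \<le> 1"
  shows "exp z \<le> 1 + z + z\<^sup>2"
proof (cases "0 \<le> z")
  case True
  then show ?thesis using exp_bound[of z] assms by simp
next
  case False
  define w where "w = - z"
  have w: "0 \<le> w" using False by (simp add: w_def)
  have "1 \<le> 1 + w ^ 3" using w by simp
  also have "\<dots> = (1 + w) * (1 - w + w\<^sup>2)" by (simp add: power2_eq_square power3_eq_cube algebra_simps)
  also have "\<dots> \<le> exp w * (1 - w + w\<^sup>2)"
  proof (rule mult_right_mono)
    have "1 - w + w\<^sup>2 = (1 - w / 2)\<^sup>2 + 3 / 4 * w\<^sup>2" by (simp add: power2_eq_square algebra_simps)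
    then show "0 \<le> 1 - w + w\<^sup>2" by simp
  qed (rule exp_ge_add_one_self)
  finally have "exp (- w) \<le> 1 - w + w\<^sup>2" by (simp add: exp_minus field_simps)
  then show ?thesis by (simp add: w_def)
qed

context bounded_chain
begin

subsection \<open>The softmax control\<close>

lemma abs_H_le: "\<bar>H \<alpha>\<bar> \<le> R * norm \<alpha>"
  using H_lipschitz[of \<alpha> 0] H_lipschitz[of 0 \<alpha>] by simp

definition Z :: "(real^'d) set \<Rightarrow> real \<Rightarrow> nat \<Rightarrow> real^'d \<Rightarrow> real" where
  "Z F \<eta> k v = (\<Sum>a\<in>F. exp (\<eta> * (a \<bullet> v - k * H a)))"

definition soft :: "(real^'d) set \<Rightarrow> real \<Rightarrow> nat \<Rightarrow> real^'d \<Rightarrow> real^'d \<Rightarrow> real" where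
  "soft F \<eta> k v a = exp (\<eta> * (a \<bullet> v - k * H a)) / Z F \<eta> k v"

text \<open>The gradient in \<open>v\<close> of \<open>ln (Z F \<eta> k v) / \<eta>\<close>.\<close>

definition soft_mean :: "(real^'d) set \<Rightarrow> real \<Rightarrow> nat \<Rightarrow> real^'d \<Rightarrow> real^'d" where
  "soft_mean F \<eta> k v = (\<Sum>a\<in>F. soft F \<eta> k v a *\<^sub>R a)"

context
  fixes F :: "(real^'d) set" and \<eta> K :: real
  assumes F: "finite F" "F \<noteq> {}" and K: "\<And>a. a \<in> F \<Longrightarrow> norm a \<le> K" and \<eta>: "0 < \<eta>"
begin

abbreviation (input) "B \<equiv> 2 * R * K"

lemma increment_le: "a \<in> F \<Longrightarrow> \<bar>a \<bullet> g y - H a\<bar> \<le> B"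
  using inner_g_le[of a y] abs_H_le[of a] mult_left_mono[OF K R_nonneg, of a] by simp

lemma Z_pos: "0 < Z F \<eta> k v"
  unfolding Z_def by (rule sum_pos) (use F in auto)

lemma soft_pos: "0 < soft F \<eta> k v a"
  by (simp add: soft_def Z_pos)

lemma soft_sum: "sum (soft F \<eta> k v) F = 1"
  using Z_pos[of k v] by (simp add: soft_def flip: sum_divide_distrib) (simp add: Z_def)

lemma soft_mean_norm: "norm (soft_mean F \<eta> k v) \<le> K"
proof -
  have "norm (soft_mean F \<eta> k v) \<le> (\<Sum>a\<in>F. soft F \<eta> k v a * K)"
    unfolding soft_mean_def
    by (intro sum_norm_le) (use K soft_pos in \<open>auto simp: less_imp_le intro!: mult_mono\<close>)
  then show ?thesis by (simp add: soft_sum flip: sum_distrib_right)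
qed

lemma soft_mean_measurable [measurable]: "soft_mean F \<eta> k \<in> borel_measurable borel"
  unfolding soft_mean_def soft_def Z_def by measurable

lemma Z_measurable [measurable]: "Z F \<eta> k \<in> borel_measurable borel"
  unfolding Z_def by measurable

lemma Z_Suc: "Z F \<eta> (Suc k) (v + g y) = Z F \<eta> k v * (\<Sum>a\<in>F. soft F \<eta> k v a * exp (\<eta> * (a \<bullet> g y - H a)))"
proof -
  have "exp (\<eta> * (a \<bullet> (v + g y) - Suc k * H a)) =
      Z F \<eta> k v * (soft F \<eta> k v a * exp (\<eta> * (a \<bullet> g y - H a)))" for a
    using Z_pos[of k v] by (simp add: soft_def inner_add_right algebra_simps flip: exp_add)
  then show ?thesis unfolding sum_distrib_left by (simp add: Z_def[of F \<eta> "Suc k"])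
qed

text \<open>A quadratic expansion of each exponential leaves the softmax average of the increments
  \<open>a \<bullet> g y - H a\<close> and a second-order error. By \<open>H_jensen\<close>, the
  average of \<open>H a\<close> is at least \<open>H\<close> at the averaged parameter, and it
  enters with a minus sign.\<close>

lemma Z_Suc_le:
  assumes "\<eta> * B \<le> 1"
  shows "Z F \<eta> (Suc k) (v + g y) \<le>
    Z F \<eta> k v * exp (\<eta> * (soft_mean F \<eta> k v \<bullet> g y - H (soft_mean F \<eta> k v)) + (\<eta> * B)\<^sup>2)"
proof -
  let ?x = "\<lambda>a. a \<bullet> g y - H a" and ?s = "soft F \<eta> k v"
  have "(\<Sum>a\<in>F. ?s a * exp (\<eta> * ?x a)) \<le> (\<Sum>a\<in>F. ?s a * (1 + \<eta> * ?x a + (\<eta> * B)\<^sup>2))"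
  proof (intro sum_mono mult_left_mono less_imp_le[OF soft_pos])
    fix a assume a: "a \<in> F"
    have le: "\<bar>\<eta> * ?x a\<bar> \<le> \<eta> * B" using mult_left_mono[OF increment_le[OF a, of y], of \<eta>] \<eta> by (simp add: abs_mult)
    have "exp (\<eta> * ?x a) \<le> 1 + \<eta> * ?x a + (\<eta> * ?x a)\<^sup>2" using le assms by (intro exp_le_quadratic) linarith
    also have "(\<eta> * ?x a)\<^sup>2 \<le> (\<eta> * B)\<^sup>2" using power_mono[OF le, of 2] by simp
    finally show "exp (\<eta> * ?x a) \<le> 1 + \<eta> * ?x a + (\<eta> * B)\<^sup>2" by simp
  qed
  also have "\<dots> = (1 + (\<eta> * B)\<^sup>2) * sum ?s F + \<eta> * ((\<Sum>a\<in>F. ?s a *\<^sub>R a) \<bullet> g y - (\<Sum>a\<in>F. ?s a * H a))"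
  proof -
    have "(\<Sum>a\<in>F. ?s a * (1 + \<eta> * ?x a + b)) =
        (\<Sum>a\<in>F. (1 + b) * ?s a + \<eta> * (?s a * (a \<bullet> g y)) - \<eta> * (?s a * H a))" for b
      by (intro sum.cong) (auto simp: algebra_simps)
    then show ?thesis
      by (simp only: sum_subtractf sum.distrib sum_distrib_left[symmetric] inner_sum_left
          inner_scaleR_left right_diff_distrib add_diff_eq)
  qed
  also have "\<dots> \<le> 1 + (\<eta> * (soft_mean F \<eta> k v \<bullet> g y - H (soft_mean F \<eta> k v)) + (\<eta> * B)\<^sup>2)"
    using H_jensen[OF F(1) less_imp_le[OF soft_pos] soft_sum, of k v] \<eta>
    by (simp add: soft_sum soft_mean_def)
  also have "\<dots> \<le> exp (\<eta> * (soft_mean F \<eta> k v \<bullet> g y - H (soft_mean F \<eta> k v)) + (\<eta> * B)\<^sup>2)"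
    by (rule exp_ge_add_one_self)
  finally show ?thesis unfolding Z_Suc using Z_pos by (intro mult_left_mono) (auto intro: less_imp_le)
qed

text \<open>In one step each weight changes by a factor between
  \<open>exp (- (2 * \<eta> * B))\<close> and \<open>exp (2 * \<eta> * B)\<close>: half of the
  exponent is due to its own exponential, half to the normalising sum.\<close>

lemma soft_mean_increment:
  "norm (soft_mean F \<eta> (Suc k) (v + g y) - soft_mean F \<eta> k v) \<le> K * (exp (2 * \<eta> * B) - 1)"
proof -
  let ?e = "\<lambda>a. exp (\<eta> * (a \<bullet> g y - H a))" and ?s = "soft F \<eta> k v" and ?s' = "soft F \<eta> (Suc k) (v + g y)"
  let ?S = "\<Sum>a\<in>F. ?s a * ?e a"
  have e: "exp (- (\<eta> * B)) \<le> ?e a" "?e a \<le> exp (\<eta> * B)" if "a \<in> F" for a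
    using mult_left_mono[OF increment_le[OF that, of y], of \<eta>] \<eta> abs_le_iff[of "\<eta> * (a \<bullet> g y - H a)" "\<eta> * B"]
    by (simp_all add: abs_mult)
  have S1: "exp (- (\<eta> * B)) \<le> ?S"
  proof -
    have "exp (- (\<eta> * B)) = (\<Sum>a\<in>F. ?s a * exp (- (\<eta> * B)))" by (simp add: soft_sum flip: sum_distrib_right)
    also have "\<dots> \<le> ?S" using e soft_pos by (intro sum_mono mult_left_mono) (auto intro: less_imp_le)
    finally show ?thesis .
  qed
  have S2: "?S \<le> exp (\<eta> * B)"
  proof -
    have "?S \<le> (\<Sum>a\<in>F. ?s a * exp (\<eta> * B))" using e soft_pos by (intro sum_mono mult_left_mono) (auto intro: less_imp_le)
    also have "\<dots> = exp (\<eta> * B)" by (simp add: soft_sum flip: sum_distrib_right)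
    finally show ?thesis .
  qed
  have Sp: "0 < ?S" using S1 exp_gt_zero less_le_trans by blast
  have s': "?s' a = ?s a * (?e a / ?S)" for a
  proof -
    have "exp (\<eta> * (a \<bullet> (v + g y) - Suc k * H a)) = Z F \<eta> k v * ?s a * ?e a"
      using Z_pos[of k v] by (simp add: soft_def inner_add_right algebra_simps flip: exp_add)
    then show ?thesis using Z_pos[of k v] unfolding soft_def[of F \<eta> "Suc k"] Z_Suc by simp
  qed
  have q: "\<bar>?e a / ?S - 1\<bar> \<le> exp (2 * \<eta> * B) - 1" if "a \<in> F" for a
  proof -
    have "?e a / ?S \<le> exp (\<eta> * B) / exp (- (\<eta> * B))" using e[OF that] S1 by (intro frac_le) auto
    also have "\<dots> = exp (2 * \<eta> * B)" by (simp flip: exp_diff)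
    finally have 1: "?e a / ?S \<le> exp (2 * \<eta> * B)" .
    have "exp (- (2 * \<eta> * B)) = exp (- (\<eta> * B)) / exp (\<eta> * B)" by (simp flip: exp_diff)
    also have "\<dots> \<le> ?e a / ?S" using e[OF that] S2 Sp by (intro frac_le) auto
    finally have 2: "exp (- (2 * \<eta> * B)) \<le> ?e a / ?S" .
    have "1 - 2 * \<eta> * B \<le> exp (- (2 * \<eta> * B))" "1 + 2 * \<eta> * B \<le> exp (2 * \<eta> * B)"
      using exp_ge_add_one_self[of "- (2 * \<eta> * B)"] exp_ge_add_one_self[of "2 * \<eta> * B"] by simp_all
    with 1 2 show ?thesis by (simp only: abs_le_iff) linarith
  qed
  have "soft_mean F \<eta> (Suc k) (v + g y) - soft_mean F \<eta> k v = (\<Sum>a\<in>F. (?s a * (?e a / ?S - 1)) *\<^sub>R a)"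
    unfolding soft_mean_def s' by (simp add: algebra_simps flip: sum_subtractf)
  also have "norm \<dots> \<le> (\<Sum>a\<in>F. ?s a * ((exp (2 * \<eta> * B) - 1) * K))"
  proof (intro sum_norm_le)
    fix a assume a: "a \<in> F"
    have "norm ((?s a * (?e a / ?S - 1)) *\<^sub>R a) = ?s a * (\<bar>?e a / ?S - 1\<bar> * norm a)"
      using soft_pos[of k v a] by (simp add: abs_mult)
    also have "\<dots> \<le> ?s a * ((exp (2 * \<eta> * B) - 1) * K)"
      by (intro mult_left_mono mult_mono q K a norm_ge_zero less_imp_le[OF soft_pos]
          order_trans[OF abs_ge_zero q[OF a]])
    finally show "norm ((?s a * (?e a / ?S - 1)) *\<^sub>R a) \<le> ?s a * ((exp (2 * \<eta> * B) - 1) * K)" .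
  qed
  also have "\<dots> = K * (exp (2 * \<eta> * B) - 1)"
    by (simp only: sum_distrib_right[symmetric] soft_sum) simp
  finally show ?thesis .
qed

text \<open>The softened maximum \<open>Z\<close>, corrected by the square of the eigenfunction, is a supermartingale
  bound for the second moment up to a factor close to one per step.\<close>

lemma subsolution_step:
  fixes N :: nat and \<tau> :: real and z :: 's
  assumes N: "N * \<eta> = 2" and \<eta>B: "\<eta> * B \<le> 1"
    and mod: "\<And>\<alpha> \<beta> x y. norm \<alpha> \<le> K \<Longrightarrow> norm \<beta> \<le> K \<Longrightarrow> norm (\<alpha> - \<beta>) \<le> K * (exp (2 * \<eta> * B) - 1) \<Longrightarrow>
      r\<^sub>0 \<alpha> x / r\<^sub>0 \<alpha> y \<le> exp \<tau> * (r\<^sub>0 \<beta> x / r\<^sub>0 \<beta> y)"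
  defines "G \<equiv> \<lambda>k x v. Z F \<eta> k v ^ N * (r\<^sub>0 (soft_mean F \<eta> k v) x / r\<^sub>0 (soft_mean F \<eta> k v) z)\<^sup>2"
  shows "1 / dens (soft_mean F \<eta> k v) x y * G (Suc k) y (v + g y) \<le>
    exp (2 * \<eta> * B\<^sup>2 + 2 * \<tau>) * G k x v * dens (soft_mean F \<eta> k v) x y"
proof -
  let ?\<alpha> = "soft_mean F \<eta> k v" and ?\<alpha>' = "soft_mean F \<eta> (Suc k) (v + g y)"
  let ?E = "exp (?\<alpha> \<bullet> g y - H ?\<alpha>)"
  define X Y W where "X = r\<^sub>0 ?\<alpha> x" and "Y = r\<^sub>0 ?\<alpha> y" and "W = r\<^sub>0 ?\<alpha> z"
  have pos: "0 < X" "0 < Y" "0 < W" by (simp_all add: X_def Y_def W_def r_pos)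
  \<comment> \<open>Since \<open>N * \<eta> = 2\<close>, the N-th power produces \<open>?E\<close>
    twice. One copy cancels in \<open>1 / dens\<close>, the other rebuilds \<open>dens\<close>,
    which integrates to 1. The accumulated quadratic error \<open>N * (\<eta> * B)\<^sup>2\<close>
    is \<open>2 * \<eta> * B\<^sup>2\<close>, still small with \<eta>.\<close>
  have "Z F \<eta> (Suc k) (v + g y) ^ N \<le> (Z F \<eta> k v * exp (\<eta> * (?\<alpha> \<bullet> g y - H ?\<alpha>) + (\<eta> * B)\<^sup>2)) ^ N"
    by (intro power_mono Z_Suc_le \<eta>B less_imp_le[OF Z_pos])
  also have "\<dots> = Z F \<eta> k v ^ N * exp (N * (\<eta> * (?\<alpha> \<bullet> g y - H ?\<alpha>) + (\<eta> * B)\<^sup>2))"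
    by (simp add: power_mult_distrib flip: exp_of_nat_mult)
  also have "N * (\<eta> * (?\<alpha> \<bullet> g y - H ?\<alpha>) + (\<eta> * B)\<^sup>2) = (N * \<eta>) * (?\<alpha> \<bullet> g y - H ?\<alpha>) + (N * \<eta>) * (\<eta> * B\<^sup>2)"
    by (simp add: power2_eq_square algebra_simps)
  also have "\<dots> = (?\<alpha> \<bullet> g y - H ?\<alpha>) + (?\<alpha> \<bullet> g y - H ?\<alpha>) + 2 * \<eta> * B\<^sup>2" by (simp add: N)
  also have "exp \<dots> = ?E * ?E * exp (2 * \<eta> * B\<^sup>2)" by (simp only: exp_add)
  finally have Z: "Z F \<eta> (Suc k) (v + g y) ^ N \<le> Z F \<eta> k v ^ N * (?E * ?E * exp (2 * \<eta> * B\<^sup>2))" .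
  have "r\<^sub>0 ?\<alpha>' y / r\<^sub>0 ?\<alpha>' z \<le> exp \<tau> * (Y / W)"
    unfolding Y_def W_def by (rule mod[OF soft_mean_norm soft_mean_norm soft_mean_increment])
  then have "(r\<^sub>0 ?\<alpha>' y / r\<^sub>0 ?\<alpha>' z)\<^sup>2 \<le> (exp \<tau> * (Y / W))\<^sup>2"
    by (rule power_mono) (simp add: r_pos less_imp_le)
  then have r: "(r\<^sub>0 ?\<alpha>' y / r\<^sub>0 ?\<alpha>' z)\<^sup>2 \<le> exp (2 * \<tau>) * (Y / W)\<^sup>2"
    by (simp only: power_mult_distrib exp_double)
  have d: "dens ?\<alpha> x y = ?E * (Y / X)" by (simp add: dens_def X_def Y_def)
  have "1 / dens ?\<alpha> x y * G (Suc k) y (v + g y) \<le> 1 / dens ?\<alpha> x y *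
      ((Z F \<eta> k v ^ N * (?E * ?E * exp (2 * \<eta> * B\<^sup>2))) * (exp (2 * \<tau>) * (Y / W)\<^sup>2))"
    unfolding G_def using Z r Z_pos[of k v] dens_pos[of ?\<alpha> x y]
    by (intro mult_left_mono mult_mono) auto
  also have "\<dots> = exp (2 * \<eta> * B\<^sup>2) * exp (2 * \<tau>) * (Z F \<eta> k v ^ N * (X / W)\<^sup>2) * (?E * (Y / X))"
    unfolding d using pos by (simp add: field_simps power2_eq_square)
  also have "\<dots> = exp (2 * \<eta> * B\<^sup>2 + 2 * \<tau>) * G k x v * dens ?\<alpha> x y"
    by (simp add: G_def d X_def W_def exp_add)
  finally show ?thesis .
qed

end

text \<open>Only the part of \<open>A\<close> within norm \<open>R\<close> matters, because the means cannot leave that ball.\<close>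

lemma V_min_upper:
  fixes c \<epsilon> :: real
  assumes F: "finite F" "F \<noteq> {}"
    and cover: "\<And>\<beta>. \<beta> \<in> A \<Longrightarrow> norm \<beta> \<le> R \<Longrightarrow> \<exists>a\<in>F. c \<le> a \<bullet> \<beta> - H a" and \<epsilon>: "0 < \<epsilon>"
  shows "\<exists>C>0. \<forall>n\<ge>1. V_min p g A y\<^sub>0 n \<le> ennreal (C * exp (n * (\<epsilon> - 2 * c)))"
proof -
  define K where "K = Max (norm ` F)"
  have K: "norm a \<le> K" if "a \<in> F" for a using that F by (simp add: K_def)
  obtain a\<^sub>0 where "a\<^sub>0 \<in> F" using F by blast
  then have K0: "0 \<le> K" using K[of a\<^sub>0] norm_ge_zero[of a\<^sub>0] by linarith
  let ?B = "2 * R * K"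
  obtain \<delta> where \<delta>: "0 < \<delta>" "\<And>\<alpha> \<beta> x y. norm \<alpha> \<le> K \<Longrightarrow> norm \<beta> \<le> K \<Longrightarrow> norm (\<alpha> - \<beta>) \<le> \<delta> \<Longrightarrow>
      r\<^sub>0 \<alpha> x / r\<^sub>0 \<alpha> y \<le> exp (\<epsilon> / 4) * (r\<^sub>0 \<beta> x / r\<^sub>0 \<beta> y)"
    using r_ratio_continuous[OF K0, of "\<epsilon> / 4"] \<epsilon> by auto
  have lim: "(\<lambda>N. 2 / real N) \<longlonglongrightarrow> 0" by (rule lim_const_over_n)
  have "(\<lambda>N. 2 / real N * ?B) \<longlonglongrightarrow> 0 * ?B" by (intro tendsto_intros lim)
  then have e1: "\<forall>\<^sub>F N in sequentially. 2 / real N * ?B < 1" by (rule order_tendstoD) simp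
  have "(\<lambda>N. 2 * (2 / real N) * ?B\<^sup>2) \<longlonglongrightarrow> 2 * 0 * ?B\<^sup>2" by (intro tendsto_intros lim)
  then have e2: "\<forall>\<^sub>F N in sequentially. 2 * (2 / real N) * ?B\<^sup>2 < \<epsilon> / 2" by (rule order_tendstoD) (use \<epsilon> in simp)
  have "(\<lambda>N. K * (exp (2 * (2 / real N) * ?B) - 1)) \<longlonglongrightarrow> K * (exp (2 * 0 * ?B) - 1)" by (intro tendsto_intros lim)
  then have e3: "\<forall>\<^sub>F N in sequentially. K * (exp (2 * (2 / real N) * ?B) - 1) < \<delta>" by (rule order_tendstoD) (use \<delta> in simp)
  \<comment> \<open>Choose \<open>N\<close> from \<open>F\<close> and \<epsilon> alone, before n, so
    that the start value of \<open>Z ^ N\<close> only affects the constant \<open>C\<close>. The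
    three smallness conditions serve the quadratic expansion, the error it leaves, and the movement
    of the control per step.\<close>
  obtain N :: nat where N: "0 < N" "2 / real N * ?B < 1" "2 * (2 / real N) * ?B\<^sup>2 < \<epsilon> / 2"
    "K * (exp (2 * (2 / real N) * ?B) - 1) < \<delta>"
    using eventually_conj[OF e1 eventually_conj[OF e2 eventually_conj[OF e3 eventually_gt_at_top[of 0]]]]
    by (auto simp: eventually_sequentially)
  define \<eta> where "\<eta> = 2 / real N"
  have \<eta>: "0 < \<eta>" "real N * \<eta> = 2" using N(1) by (auto simp: \<eta>_def)
  note ctx = F K \<eta>(1)
  define \<kappa> where "\<kappa> = 2 * \<eta> * ?B\<^sup>2 + 2 * (\<epsilon> / 4)"
  have \<kappa>: "0 \<le> \<kappa>" "\<kappa> \<le> \<epsilon>" using N(3) \<eta> \<epsilon> by (auto simp: \<kappa>_def \<eta>_def)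
  define \<alpha> where "\<alpha> = soft_mean F \<eta>"
  \<comment> \<open>Dividing by the value at \<open>y\<^sub>0\<close> leaves only ratios of the
    eigenfunction, whose measurability and continuity in the parameter are known.\<close>
  define G where "G = (\<lambda>k x v. Z F \<eta> k v ^ N * (r\<^sub>0 (\<alpha> k v) x / r\<^sub>0 (\<alpha> k v) y\<^sub>0)\<^sup>2)"
  note Zp = Z_pos[OF ctx] and \<alpha>_norm = soft_mean_norm[OF ctx, folded \<alpha>_def]
  have \<alpha>_meas [measurable]: "\<alpha> k \<in> borel_measurable borel" for k
    unfolding \<alpha>_def by (rule soft_mean_measurable[OF ctx])
  have [measurable]: "Z F \<eta> k \<in> borel_measurable borel" for k by (rule Z_measurable[OF ctx])
  have G_nonneg: "0 \<le> G k x v" for k x v using Zp[of k v] by (simp add: G_def)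
  have G_meas: "(\<lambda>(x, v). G k x v) \<in> borel_measurable (borel \<Otimes>\<^sub>M borel)" for k
  proof -
    have "(\<lambda>z::'s \<times> (real^'d). (\<alpha> k (snd z), fst z, y\<^sub>0)) \<in> borel \<Otimes>\<^sub>M borel \<rightarrow>\<^sub>M borel \<Otimes>\<^sub>M (borel \<Otimes>\<^sub>M borel)"
      by measurable
    from measurable_compose[OF this r_ratio_measurable]
    have [measurable]: "(\<lambda>z. r\<^sub>0 (\<alpha> k (snd z)) (fst z) / r\<^sub>0 (\<alpha> k (snd z)) y\<^sub>0) \<in> borel_measurable (borel \<Otimes>\<^sub>M borel)"
      by simp
    show ?thesis unfolding G_def case_prod_beta' by measurable
  qed
  have step: "1 / dens (\<alpha> k v) x y * G (Suc k) y (v + g y) \<le> exp \<kappa> * G k x v * dens (\<alpha> k v) x y" for k v x y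
    unfolding G_def \<alpha>_def \<kappa>_def
  proof (rule subsolution_step[OF ctx \<eta>(2)])
    show "\<eta> * ?B \<le> 1" using N(2) by (simp add: \<eta>_def)
    show "r\<^sub>0 \<alpha> x / r\<^sub>0 \<alpha> y \<le> exp (\<epsilon> / 4) * (r\<^sub>0 \<beta> x / r\<^sub>0 \<beta> y)"
      if "norm \<alpha> \<le> K" "norm \<beta> \<le> K" "norm (\<alpha> - \<beta>) \<le> K * (exp (2 * \<eta> * ?B) - 1)" for \<alpha> \<beta> x y
      using that N(4) by (intro \<delta>(2)) (auto simp: \<eta>_def)
  qed
  define D' where "D' = harnack_const K"
  have D': "1 \<le> D'" unfolding D'_def by (rule harnack_const_ge[OF K0])
  define C where "C = D'\<^sup>2 * Z F \<eta> 1 (g y\<^sub>0) ^ N"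
  have C: "0 < C" using D' Zp by (simp add: C_def)
  have "V_min p g A y\<^sub>0 n \<le> ennreal (C * exp (n * (\<epsilon> - 2 * c)))" if n: "1 \<le> n" for n
  proof -
    \<comment> \<open>The control receives the sum divided by n; multiplying by n recovers the
      unscaled argument of \<open>soft_mean\<close>.\<close>
    define u :: "('s, 'd) control" where "u = (\<lambda>k z. \<alpha> k (real n *\<^sub>R snd z))"
    have "u k \<in> borel_measurable (borel \<Otimes>\<^sub>M borel)" for k
      unfolding u_def by measurable
    then have u: "u \<in> controls n" by (simp add: controls_def borel_prod)
    interpret controlled_chain p g R D m y\<^sub>0 n u
      by unfold_locales (use u n in auto)
    \<comment> \<open>The last factor decreases by \<open>exp \<kappa>\<close> per step and so pays
      for the error in \<open>step\<close>. The other two lift the terminal value to at least 1 on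
      \<open>A\<close>: \<open>Z ^ N\<close> is at least \<open>exp (2 * n * c)\<close> there, and
      the squared ratio in \<open>G\<close> at least the inverse square of D'.\<close>
    define s where "s k = D'\<^sup>2 * exp (- (2 * n * c)) * exp ((real n - real k) * \<kappa>)" for k
    have s0: "0 < s k" for k using D' by (simp add: s_def)
    have s_Suc: "s (Suc k) * exp \<kappa> = s k" for k
      by (simp add: s_def mult.assoc flip: exp_add) (simp add: algebra_simps)
    have "V_min p g A y\<^sub>0 n \<le> (\<integral>\<^sup>+\<omega>. ennreal ((X_bar p g A n u \<omega>)\<^sup>2) \<partial>controlled_law p g y\<^sub>0 n u)"
      unfolding V_min_def by (rule INF_lower[OF u])
    also have "\<dots> \<le> ennreal (s 1 * G 1 y\<^sub>0 (g y\<^sub>0))"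
    proof (rule second_moment_upper)
      show "(\<lambda>(x, v). ennreal (s k * G k x v)) \<in> borel_measurable (borel \<Otimes>\<^sub>M borel)" for k
        using G_meas[of k] by (simp add: case_prod_beta')
    next
      fix k x v assume "k \<in> {1..<n}"
      have uk: "u k (x, (1 / real n) *\<^sub>R v) = \<alpha> k v" using n by (simp add: u_def)
      have [measurable]: "dens (\<alpha> k v) x \<in> borel_measurable borel" by measurable
      have "(\<integral>\<^sup>+y. ennreal (1 / dens (\<alpha> k v) x y) * ennreal (s (Suc k) * G (Suc k) y (v + g y)) \<partial>p x)
        \<le> (\<integral>\<^sup>+y. ennreal (s k * G k x v) * ennreal (dens (\<alpha> k v) x y) \<partial>p x)"
      proof (rule nn_integral_mono)
        fix y
        have "1 / dens (\<alpha> k v) x y * (s (Suc k) * G (Suc k) y (v + g y)) \<le> s k * G k x v * dens (\<alpha> k v) x y"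
          using mult_left_mono[OF step[of k v x y] less_imp_le[OF s0[of "Suc k"]]]
          by (simp add: s_Suc[of k, symmetric] ac_simps)
        then show "ennreal (1 / dens (\<alpha> k v) x y) * ennreal (s (Suc k) * G (Suc k) y (v + g y))
          \<le> ennreal (s k * G k x v) * ennreal (dens (\<alpha> k v) x y)"
          using dens_pos[of "\<alpha> k v" x y] s0 G_nonneg by (simp add: less_imp_le flip: ennreal_mult)
      qed
      also have "\<dots> = ennreal (s k * G k x v)"
        by (simp add: nn_integral_cmult dens_nn_integral)
      finally show "(\<integral>\<^sup>+y. ennreal (1 / dens (u k (x, (1 / real n) *\<^sub>R v)) x y) *
          ennreal (s (Suc k) * G (Suc k) y (v + g y)) \<partial>p x) \<le> ennreal (s k * G k x v)"
        unfolding uk .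
    next
      fix x and v :: "real^'d" assume v: "norm v \<le> n * R"
      show "indicator A ((1 / real n) *\<^sub>R v) \<le> ennreal (s n * G n x v)"
      proof (cases "(1 / real n) *\<^sub>R v \<in> A")
        case True
        have "norm ((1 / real n) *\<^sub>R v) \<le> R" using v n by (simp add: field_simps)
        with cover[OF True] obtain a where a: "a \<in> F" "c \<le> a \<bullet> ((1 / real n) *\<^sub>R v) - H a" by blast
        have "n * c \<le> a \<bullet> v - n * H a" using a(2) n by (simp add: field_simps)
        then have "exp (\<eta> * (n * c)) \<le> exp (\<eta> * (a \<bullet> v - n * H a))" using \<eta> by simp
        also have "\<dots> \<le> Z F \<eta> n v" unfolding Z_def by (rule member_le_sum[OF a(1)]) (use F in auto)
        finally have "exp (\<eta> * (n * c)) ^ N \<le> Z F \<eta> n v ^ N" by (rule power_mono) simp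
        moreover have "exp (\<eta> * (n * c)) ^ N = exp (2 * n * c)"
          using \<eta>(2) by (simp add: exp_of_nat_mult[symmetric] mult.assoc[symmetric])
        ultimately have Z: "exp (2 * n * c) \<le> Z F \<eta> n v ^ N" by simp
        let ?q = "r\<^sub>0 (\<alpha> n v) x / r\<^sub>0 (\<alpha> n v) y\<^sub>0"
        have "1 \<le> D' * ?q"
          using r_harnack[OF \<alpha>_norm, of n v y\<^sub>0 x] r_pos[of "\<alpha> n v" y\<^sub>0] by (simp add: D'_def field_simps)
        then have q: "1 \<le> (D' * ?q)\<^sup>2" by (rule one_le_power)
        have "1 \<le> exp (- (2 * n * c)) * Z F \<eta> n v ^ N" using Z by (simp add: exp_minus field_simps)
        from mult_mono[OF this q] have "1 \<le> (exp (- (2 * n * c)) * Z F \<eta> n v ^ N) * (D' * ?q)\<^sup>2"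
          using Zp[of n v] by simp
        also have "\<dots> = s n * G n x v" by (simp add: s_def G_def power_mult_distrib power_divide ac_simps)
        finally show ?thesis using True by simp
      qed simp
    qed
    also have "ennreal (s 1 * G 1 y\<^sub>0 (g y\<^sub>0)) \<le> ennreal (C * exp (n * (\<epsilon> - 2 * c)))"
    proof (rule ennreal_leI)
      have "G 1 y\<^sub>0 (g y\<^sub>0) = Z F \<eta> 1 (g y\<^sub>0) ^ N" using r_pos[of "\<alpha> 1 (g y\<^sub>0)" y\<^sub>0] by (simp add: G_def)
      then have "s 1 * G 1 y\<^sub>0 (g y\<^sub>0) = C * exp (- (2 * n * c) + (real n - 1) * \<kappa>)"
        by (simp only: s_def C_def exp_add of_nat_1 ac_simps)
      also have "\<dots> \<le> C * exp (n * (\<epsilon> - 2 * c))"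
      proof -
        have "(real n - 1) * \<kappa> \<le> n * \<epsilon>" using \<kappa> n by (intro mult_mono) auto
        then have "- (2 * n * c) + (real n - 1) * \<kappa> \<le> n * (\<epsilon> - 2 * c)" by (simp add: algebra_simps)
        then show ?thesis using C by simp
      qed
      finally show "s 1 * G 1 y\<^sub>0 (g y\<^sub>0) \<le> C * exp (n * (\<epsilon> - 2 * c))" .
    qed
    finally show ?thesis .
  qed
  with C show ?thesis by blast
qed

end

section \<open>From second moments to logarithmic rates, and the limit\<close>

lemma ext_ln_le: "v \<le> ennreal (exp x) \<Longrightarrow> ext_ln v \<le> ereal x"
  by (cases v) (auto simp: ext_ln_def ennreal_eq_0_iff ln_le_cancel_iff[symmetric] top_unique
      simp del: ln_le_cancel_iff)

lemma ext_ln_ge: "ennreal (exp x) \<le> v \<Longrightarrow> ereal x \<le> ext_ln v"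
proof (cases v)
  case (real s)
  assume "ennreal (exp x) \<le> v"
  then have "exp x \<le> s" using real by simp
  moreover have "0 < s" using calculation exp_gt_zero less_le_trans by blast
  ultimately show ?thesis using real by (simp add: ext_ln_def ln_ge_iff)
qed (simp add: ext_ln_def)

lemma W_rate_ge:
  assumes "1 \<le> n" "V_min p g A y\<^sub>0 n \<le> ennreal (exp (- (n * x)))"
  shows "ereal x \<le> W_rate p g A y\<^sub>0 n"
proof -
  have "ereal (1 / n) * ext_ln (V_min p g A y\<^sub>0 n) \<le> ereal (1 / n) * ereal (- (n * x))"
    by (intro ereal_mult_left_mono ext_ln_le assms) simp
  also have "\<dots> = - ereal x" using assms(1) by simp
  finally show ?thesis unfolding W_rate_def by (metis ereal_minus_le_minus ereal_uminus_uminus)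
qed

lemma W_rate_le:
  assumes "1 \<le> n" "ennreal (exp (- (n * x))) \<le> V_min p g A y\<^sub>0 n"
  shows "W_rate p g A y\<^sub>0 n \<le> ereal x"
proof -
  have "- ereal x = ereal (1 / n) * ereal (- (n * x))" using assms(1) by simp
  also have "\<dots> \<le> ereal (1 / n) * ext_ln (V_min p g A y\<^sub>0 n)"
    by (intro ereal_mult_left_mono ext_ln_ge assms) simp
  finally show ?thesis unfolding W_rate_def by (metis ereal_minus_le_minus ereal_uminus_uminus)
qed

lemma uniformly_recurrent_harnack:
  fixes p :: "'s::polish_space \<Rightarrow> 's measure"
  assumes "uniformly_recurrent p"
  shows "\<exists>m\<ge>1. \<exists>D\<ge>1. \<forall>x y. \<forall>B\<in>sets borel.
    measure (kernel_power p m x) B \<le> D * measure (kernel_power p m y) B"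
proof -
  from assms obtain \<nu> m a b where m: "1 \<le> m" and ab: "0 < a" "0 < b"
    and le: "\<And>x B. B \<in> sets borel \<Longrightarrow> a * measure \<nu> B \<le> measure (kernel_power p m x) B"
      "\<And>x B. B \<in> sets borel \<Longrightarrow> measure (kernel_power p m x) B \<le> b * measure \<nu> B"
    unfolding uniformly_recurrent_def by blast
  let ?D = "max 1 (b / a)"
  have "measure (kernel_power p m x) B \<le> ?D * measure (kernel_power p m y) B" if B: "B \<in> sets borel" for x y B
  proof -
    have "measure (kernel_power p m x) B \<le> (b / a) * (a * measure \<nu> B)" using le(2)[OF B, of x] ab by simp
    also have "\<dots> \<le> ?D * measure (kernel_power p m y) B"
      using ab by (intro mult_mono le(1) B) auto
    finally show ?thesis .
  qed
  with m show ?thesis by (intro exI[of _ m] conjI exI[of _ ?D]) auto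
qed

context bounded_chain
begin

lemma W_rate_eventually_gt:
  assumes t: "ereal t < 2 * (INF \<beta>\<in>closure A. rate_L p g \<beta>)"
  shows "\<forall>\<^sub>F n in sequentially. ereal t < W_rate p g A y\<^sub>0 n"
proof -
  let ?I = "INF \<beta>\<in>closure A. rate_L p g \<beta>"
  have "ereal (t / 2) < ?I" using t by (cases ?I) auto
  then obtain c where c: "t / 2 < c" "ereal c < ?I" using ereal_dense2 by fastforce
  define U where "U \<alpha> = {\<beta>::real^'d. c + H \<alpha> < \<alpha> \<bullet> \<beta>}" for \<alpha>
  obtain F where F: "finite F" "closure A \<inter> cball 0 R \<subseteq> (\<Union>\<alpha>\<in>F. U \<alpha>)"
  proof (rule compactE_image[of "closure A \<inter> cball 0 R" UNIV U])
    show "compact (closure A \<inter> cball 0 R)" by (simp add: closed_Int_compact)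
    show "open (U \<alpha>)" for \<alpha> unfolding U_def by (rule open_halfspace_gt)
    show "closure A \<inter> cball 0 R \<subseteq> (\<Union>\<alpha>\<in>UNIV. U \<alpha>)"
    proof
      fix \<beta> assume "\<beta> \<in> closure A \<inter> cball 0 R"
      then have "?I \<le> rate_L p g \<beta>" by (intro INF_lower) simp
      with c(2) have "ereal c < rate_L p g \<beta>" by (rule less_le_trans)
      then obtain \<alpha> where "ereal c < ereal (\<alpha> \<bullet> \<beta> - H \<alpha>)" unfolding rate_L_def less_SUP_iff by blast
      then show "\<beta> \<in> (\<Union>\<alpha>\<in>UNIV. U \<alpha>)" by (auto simp: U_def algebra_simps)
    qed
  qed auto
  \<comment> \<open>The exponent \<open>\<epsilon> - 2 * c\<close> of \<open>V_min_upper\<close>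
    equals \<open>- t - \<epsilon>\<close>. Half of this surplus absorbs the constant
    \<open>C\<close>, the other half makes the final inequality strict.\<close>
  define \<epsilon> where "\<epsilon> = c - t / 2"
  have \<epsilon>: "0 < \<epsilon>" using c by (simp add: \<epsilon>_def)
  \<comment> \<open>The cover is empty if \<open>closure A\<close> does not meet the ball; adding 0
    provides the nonempty set that the control needs.\<close>
  have "\<exists>a\<in>insert 0 F. c \<le> a \<bullet> \<beta> - H a" if "\<beta> \<in> A" "norm \<beta> \<le> R" for \<beta>
  proof -
    have "\<beta> \<in> (\<Union>\<alpha>\<in>F. U \<alpha>)" using F(2) that closure_subset[of A] by auto
    then obtain a where "a \<in> F" "\<beta> \<in> U a" by blast
    then show ?thesis by (intro bexI[of _ a]) (auto simp: U_def)
  qed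
  from V_min_upper[OF _ _ this \<epsilon>, where y\<^sub>0=y\<^sub>0] F(1) obtain C where C: "0 < C"
    "\<And>n. 1 \<le> n \<Longrightarrow> V_min p g A y\<^sub>0 n \<le> ennreal (C * exp (n * (\<epsilon> - 2 * c)))" by auto
  have "\<forall>\<^sub>F n in sequentially. ln C \<le> \<epsilon> / 2 * n - 1"
    using \<epsilon> by (intro eventually_linear_ge) simp
  then show ?thesis using eventually_ge_at_top[of 1]
  proof eventually_elim
    case (elim n)
    have "C * exp (n * (\<epsilon> - 2 * c)) = exp (ln C + n * (\<epsilon> - 2 * c))" using C(1) by (simp add: exp_add)
    also have "\<dots> \<le> exp (- (n * (t + \<epsilon> / 2)))"
    proof -
      have "c = t / 2 + \<epsilon>" by (simp add: \<epsilon>_def)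
      then show ?thesis using elim(1) by (simp add: algebra_simps)
    qed
    finally have "V_min p g A y\<^sub>0 n \<le> ennreal (exp (- (n * (t + \<epsilon> / 2))))"
      using C(2)[OF elim(2)] by (meson ennreal_leI order_trans)
    from W_rate_ge[OF elim(2) this] have "ereal (t + \<epsilon> / 2) \<le> W_rate p g A y\<^sub>0 n" .
    moreover have "ereal t < ereal (t + \<epsilon> / 2)" using \<epsilon> by simp
    ultimately show ?case by (rule less_le_trans[rotated])
  qed
qed

lemma W_rate_eventually_lt:
  assumes A: "A \<in> sets borel" and t: "2 * (INF \<beta>\<in>interior A. rate_L p g \<beta>) < ereal t"
  shows "\<forall>\<^sub>F n in sequentially. W_rate p g A y\<^sub>0 n < ereal t"
proof -
  let ?I = "INF \<beta>\<in>interior A. rate_L p g \<beta>"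
  have "?I < ereal (t / 2)" using t by (cases ?I) auto
  then obtain \<beta> where \<beta>: "\<beta> \<in> interior A" "rate_L p g \<beta> < ereal (t / 2)" by (auto simp: INF_less_iff)
  then obtain c where c: "rate_L p g \<beta> < ereal c" "c < t / 2" using ereal_dense2 by fastforce
  define \<epsilon> where "\<epsilon> = (t / 2 - c) / 2"
  have \<epsilon>: "0 < \<epsilon>" using c by (simp add: \<epsilon>_def)
  from ldp_lower[OF \<beta>(1) less_imp_le[OF c(1)] \<epsilon>, of y\<^sub>0] eventually_ge_at_top[of 1]
  show ?thesis
  proof eventually_elim
    case (elim n)
    have "ennreal (exp (- (n * (2 * (c + \<epsilon>))))) = (ennreal (exp (- (n * (c + \<epsilon>)))))\<^sup>2"
      by (simp add: ennreal_power exp_double[symmetric] mult.left_commute)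
    also have "\<dots> \<le> V_min p g A y\<^sub>0 n"
      unfolding V_min_def
    proof (rule INF_greatest)
      fix u :: "('s, 'd) control" assume u: "u \<in> controls n"
      interpret controlled_chain p g R D m y\<^sub>0 n u
        by unfold_locales (use u elim(2) in auto)
      show "(ennreal (exp (- (n * (c + \<epsilon>)))))\<^sup>2
          \<le> (\<integral>\<^sup>+\<omega>. ennreal ((X_bar p g A n u \<omega>)\<^sup>2) \<partial>controlled_law p g y\<^sub>0 n u)"
        by (rule order_trans[OF power_mono[OF elim(1)] second_moment_lower[OF A]]) simp
    qed
    finally have "W_rate p g A y\<^sub>0 n \<le> ereal (2 * (c + \<epsilon>))" by (rule W_rate_le[OF elim(2)])
    also have "\<dots> < ereal t" using c by (simp add: \<epsilon>_def field_simps)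
    finally show ?case .
  qed
qed

end

theorem theorem3p1:
  fixes p :: "'s::polish_space \<Rightarrow> 's measure"
    and g :: "'s \<Rightarrow> real^'d"
    and y0 :: 's
    and A :: "(real^'d) set"
  assumes kernel: "p \<in> borel \<rightarrow>\<^sub>M prob_algebra borel"
    and g_meas: "g \<in> borel_measurable borel"
    and g_bdd: "bounded (range g)"
    and A_borel: "A \<in> sets borel"
    and recurrent: "uniformly_recurrent p"
    and A_cont: "(INF \<beta>\<in>closure A. rate_L p g \<beta>) = (INF \<beta>\<in>interior A. rate_L p g \<beta>)"
  shows "(\<lambda>n. W_rate p g A y0 n) \<longlonglongrightarrow> 2 * (INF \<beta>\<in>A. rate_L p g \<beta>)"
proof -
  obtain R where R: "\<And>x. norm (g x) \<le> R" using g_bdd by (auto simp: bounded_iff)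
  obtain m D where mD: "1 \<le> m" "1 \<le> D" "\<And>x y B. B \<in> sets borel \<Longrightarrow>
      measure (kernel_power p m x) B \<le> D * measure (kernel_power p m y) B"
    using uniformly_recurrent_harnack[OF recurrent] by auto
  interpret bounded_chain p g R D m
    by (rule bounded_chain.intro) (use kernel g_meas R mD in auto)
  let ?I = "INF \<beta>\<in>A. rate_L p g \<beta>"
  \<comment> \<open>\<open>A\<close> lies between its interior and its closure, so the equality of
    the outer infima squeezes the one over \<open>A\<close>, and both one-sided estimates refer to
    the same number.\<close>
  have "(INF \<beta>\<in>closure A. rate_L p g \<beta>) \<le> ?I" by (rule INF_superset_mono[OF closure_subset]) simp
  moreover have "?I \<le> (INF \<beta>\<in>interior A. rate_L p g \<beta>)" by (rule INF_superset_mono[OF interior_subset]) simp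
  ultimately have I: "(INF \<beta>\<in>closure A. rate_L p g \<beta>) = ?I" "(INF \<beta>\<in>interior A. rate_L p g \<beta>) = ?I"
    using A_cont by auto
  show ?thesis
  proof (rule order_tendstoI)
    fix a assume "a < 2 * ?I"
    then obtain t where t: "a < ereal t" "ereal t < 2 * ?I" using ereal_dense2 by blast
    from W_rate_eventually_gt[of t A y0] t(2)
    show "\<forall>\<^sub>F n in sequentially. a < W_rate p g A y0 n"
      unfolding I by (auto elim!: eventually_mono intro: less_trans[OF t(1)])
  next
    fix a assume "2 * ?I < a"
    then obtain t where t: "2 * ?I < ereal t" "ereal t < a" using ereal_dense2 by blast
    from W_rate_eventually_lt[OF A_borel, of t y0] t(1)
    show "\<forall>\<^sub>F n in sequentially. W_rate p g A y0 n < a"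
      unfolding I by (auto elim!: eventually_mono intro: less_trans[OF _ t(2)])
  qed
qed

end
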